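(* For $\ell\in\{2,5,11\}$ let $H_\ell^\dagger=H_\ell^\dagger(\tau)=\left(\frac{\eta(3\tau)\eta(3\ell\tau)}{\eta(\tau)\eta(\ell\tau)}\right)^{\frac{12}{\ell+1}}$ and let $q=e^{\pi i\tau}$. Then \begin{align*} C_2(q^2)&=-6\frac{H_2^\dagger}{(1+9H_2^\dagger)^2},\\ C_5(q^2)&=-6H_5^\dagger\frac{1+4H_5^\dagger+9(H_5^\dagger)^2}{(1+9H_5^\dagger+9(H_5^\dagger)^2)^2},\\ C_{11}(q^2)&=-6H_{11}^\dagger\frac{U(H_{11}^\dagger)}{V^2(H_{11}^\dagger)}, \end{align*} where $U(s)=1+5s+18s^2+37s^3+54s^4+45s^5+27s^6$ and $V(s)=1+9s+18s^2+27s^3+9s^4$.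
   Context: $\eta(\tau)=e^{\pi i\tau/12}\prod_{k\ge1}(1-e^{2\pi ik\tau})$ is the Dedekind eta function. Let $a(q)=\sum_{m,n\in\mathbb Z}q^{m^2+mn+n^2}$ and for a positive integer $N$ $$C_N(q)=\frac{1}{a^2(q)a^2(q^N)}\det\begin{pmatrix}a(q)&a(q^N)\\ q\frac{da(q)}{dq}&q\frac{da(q^N)}{dq}\end{pmatrix}.$$ *)

theory Defs
  imports "HOL-Complex_Analysis.Complex_Analysis"
begin

definition dedekind_eta :: "complex \<Rightarrow> complex" where
  "dedekind_eta \<tau> = exp (of_real pi * \<i> * \<tau> / 12) *
     (\<Prod>k. 1 - exp (2 * of_real pi * \<i> * of_nat (Suc k) * \<tau>))"

text \<open>
  The double series over \<open>\<int> \<times> \<int>\<close> is taken as an unordered sum; it converges absolutely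
  for \<open>norm q < 1\<close>.  The exponents are nonnegative.
\<close>
definition cubic_a :: "complex \<Rightarrow> complex" where
  "cubic_a q = (\<Sum>\<^sub>\<infinity>(m, n) \<in> (UNIV :: (int \<times> int) set). q powi (m\<^sup>2 + m * n + n\<^sup>2))"

definition C :: "nat \<Rightarrow> complex \<Rightarrow> complex" where
  "C N q = 1 / ((cubic_a q)\<^sup>2 * (cubic_a (q ^ N))\<^sup>2) *
     det (vector [vector [cubic_a q, cubic_a (q ^ N)],
                  vector [q * deriv cubic_a q, q * deriv (\<lambda>z. cubic_a (z ^ N)) q]]
          :: complex ^ 2 ^ 2)"

text \<open>
  For \<open>l \<in> {2, 5, 11}\<close> the number \<open>l + 1\<close> divides 12, so the exponent \<open>12 / (l + 1)\<close> is the
  integer 4, 2, 1, respectively, and no branch of a complex power has to be chosen.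
\<close>
definition H_dagger :: "nat \<Rightarrow> complex \<Rightarrow> complex" where
  "H_dagger l \<tau> =
     (dedekind_eta (3 * \<tau>) * dedekind_eta (3 * of_nat l * \<tau>) /
      (dedekind_eta \<tau> * dedekind_eta (of_nat l * \<tau>))) ^ (12 div (l + 1))"

definition U :: "complex \<Rightarrow> complex" where
  "U s = 1 + 5 * s + 18 * s ^ 2 + 37 * s ^ 3 + 54 * s ^ 4 + 45 * s ^ 5 + 27 * s ^ 6"

definition V :: "complex \<Rightarrow> complex" where
  "V s = 1 + 9 * s + 18 * s ^ 2 + 27 * s ^ 3 + 9 * s ^ 4"

text \<open>
  \<open>C N\<close> has poles in the unit disc, at the zeros of \<open>cubic_a q\<close> and \<open>cubic_a (q ^ N)\<close>, where the
  HOL term has the default value 0.  An identity between values of \<open>C N\<close> and of a rational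
  function is therefore stated at the points where \<open>C N\<close> is defined, together with the claim
  that the denominator of the rational function does not vanish there.
\<close>
definition C_defined :: "nat \<Rightarrow> complex \<Rightarrow> bool" where
  "C_defined N q \<longleftrightarrow> cubic_a q \<noteq> 0 \<and> cubic_a (q ^ N) \<noteq> 0"

end

theory Submission
  imports Defs
begin

text \<open>
  Let \<open>a\<close>, \<open>b\<close>, \<open>c\<close> be the cubic theta functions of the Borweins and \<open>D = q d/dq\<close>.  The cube of the Jacobi theta
  function \<open>\<theta>(w, \<tau>)\<close> is a combination of two theta series of level 3 whose coefficients are \<open>a(q)\<close> and a multiple of
  \<open>c(q)\<close>.  Comparing Taylor coefficients at \<open>w = 0\<close> and at the 3-torsion point, and using the heat equation
  and the triple product, one gets with \<open>\<rho> = D b / b\<close> the system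
  \<open>D a = a \<rho> + (a\<^sup>3 - b\<^sup>3)/3\<close>, \<open>D \<rho> = \<rho>\<^sup>2 - a (a\<^sup>3 - b\<^sup>3)/9\<close>, together with \<open>D log (c/b) = a\<^sup>2/3\<close>
  and \<open>a\<^sup>3 = b\<^sup>3 + c\<^sup>3\<close>.

  Write \<open>a'\<close> for \<open>a(q\<^sup>l)\<close> and so on.  The quantities \<open>v = a a'/(b b')\<close> and \<open>d = (l a'\<^sup>2 - a\<^sup>2)/(b b')\<close>, along with three
  auxiliary ones, satisfy a system of differential and algebraic equations in which \<open>H\<close> occurs as a
  coefficient and which has a unique power series solution with given first coefficients.  For
  \<open>l = 2, 5, 11\<close> this solution consists of polynomials in \<open>H\<close>; in particular \<open>v\<close> is the denominator in the
  claim, and the Wronskian \<open>a D a' - a' D a\<close> is read off from \<open>d/v\<close>.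
\<close>

section \<open>Gaussian series\<close>

text \<open>Polynomials in H fit the system because D log(\<eta>(3\<tau>)/\<eta>(\<tau>)) = a^2/12,
  applied at q and at q^l, gives (l+1) D log H = K with K = a^2 + l a'^2. All derivatives in the
  system carry the factor K, and D acts on a polynomial in H as H d/dH times K/(l+1), so K cancels
  and need not be known as a function of H. The choice of v and d comes from d/v = l a'/a - a/a',
  whose derivative is K (a D a' - a' D a)/(a a')^2, and from d^2 + 4 l v^2 = K^2/(b b')^2. Of the
  auxiliary quantities, s = D log(b'/b)/(b b') is forced by D d, while k and z normalise b^3 a' + l
  b'^3 a and b^3 a' - l b'^3 a, which appear in D v and D d. No differential equation for k and z is
  used; two algebraic relations determine them. Explicit powers of H enter only there, through (a^3
  - b^3)(a'^3 - b'^3) = 729 H^(l+1) (b b')^3.\<close>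

lemma summable_on_exp_neg_abs: "(\<lambda>n::int. exp (- \<bar>real_of_int n\<bar>)) summable_on UNIV"
proof -
  have geo: "(\<lambda>n::nat. exp (- real n)) summable_on UNIV"
  proof -
    have "summable (\<lambda>n. exp (-1 :: real) ^ n)"
      by (rule summable_geometric) simp
    also have "(\<lambda>n. exp (-1 :: real) ^ n) = (\<lambda>n. exp (- real n))"
      by (simp flip: exp_of_nat_mult)
    finally show ?thesis
      by (subst summable_on_UNIV_nonneg_real_iff) auto
  qed
  have 1: "(\<lambda>n::int. exp (- \<bar>real_of_int n\<bar>)) summable_on range int"
    by (subst summable_on_reindex) (use geo in \<open>auto simp: o_def\<close>)
  have 2: "(\<lambda>n::int. exp (- \<bar>real_of_int n\<bar>)) summable_on range (\<lambda>n. - int n)"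
    by (subst summable_on_reindex) (use geo in \<open>auto simp: o_def inj_on_def\<close>)
  have "UNIV = range int \<union> range (\<lambda>n. - int n)"
    using int_cases2 by blast
  with summable_on_union[OF 1 2] show ?thesis by simp
qed

text \<open>The enumeration \<open>int_decode\<close> turns an unordered sum over the integers into
  an ordinary series, the form in which termwise differentiation and Tannery's theorem are
  applied.\<close>

lemma infsum_int_conv_suminf:
  fixes f :: "int \<Rightarrow> complex"
  assumes "(\<lambda>n. norm (f n)) summable_on UNIV"
  shows "(\<lambda>k. f (int_decode k)) sums infsum f UNIV"
proof -
  have "f summable_on UNIV" using assms by (rule abs_summable_summable)
  hence "(f has_sum infsum f UNIV) UNIV" by (rule has_sum_infsum)
  hence "((\<lambda>k. f (int_decode k)) has_sum infsum f UNIV) UNIV"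
    by (subst has_sum_reindex_bij_betw[OF bij_int_decode])
  thus ?thesis by (rule has_sum_imp_sums)
qed

text \<open>Locally uniform convergence of holomorphic terms passes to derivatives, so a majorant of
  the terms themselves is enough. Summability of the derivatives at \<open>x\<close> converts the
  differentiated series back into an unordered sum.\<close>

lemma has_field_derivative_infsum_int:
  fixes f :: "int \<Rightarrow> complex \<Rightarrow> complex"
  assumes S: "open S" "x \<in> S"
    and h: "h summable_on UNIV" "\<And>n y. y \<in> S \<Longrightarrow> norm (f n y) \<le> h n"
    and f': "\<And>n y. y \<in> S \<Longrightarrow> (f n has_field_derivative f' n y) (at y)"
    and sf': "(\<lambda>n. norm (f' n x)) summable_on UNIV"
  shows "((\<lambda>y. \<Sum>\<^sub>\<infinity>n. f n y) has_field_derivative (\<Sum>\<^sub>\<infinity>n. f' n x)) (at x)"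
proof -
  have h0: "h n \<ge> 0" for n using h(2)[OF S(2), of n] norm_ge_zero order_trans by blast
  have sh: "summable (\<lambda>k. h (int_decode k))"
    using h(1) by (intro summable_on_imp_summable) (simp add: summable_on_reindex_bij_betw[OF bij_int_decode])
  have sf: "(\<lambda>n. norm (f n y)) summable_on UNIV" if "y \<in> S" for y
    by (rule Infinite_Sum.abs_summable_on_comparison_test'[OF h(1)]) (use h(2) that in auto)
  have "\<exists>g g'. \<forall>x \<in> S. ((\<lambda>k. f (int_decode k) x) sums g x) \<and> ((\<lambda>k. f' (int_decode k) x) sums g' x)
           \<and> (g has_field_derivative g' x) (at x)"
  proof (rule series_and_derivative_comparison_complex[OF S(1)])
    show "\<exists>d ha. 0 < d \<and> summable ha \<and> range ha \<subseteq> \<real>\<^sub>\<ge>\<^sub>0 \<and>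
            (\<forall>\<^sub>F n in sequentially. \<forall>y\<in>ball x d \<inter> S. cmod (f (int_decode n) y) \<le> cmod (ha n))" for x
    proof (intro exI[of _ "1::real"] exI[of _ "\<lambda>k. complex_of_real (h (int_decode k))"] conjI)
      show "summable (\<lambda>k. complex_of_real (h (int_decode k)))" using sh by (rule summable_of_real)
      show "range (\<lambda>k. complex_of_real (h (int_decode k))) \<subseteq> \<real>\<^sub>\<ge>\<^sub>0" using h0 by auto
      show "\<forall>\<^sub>F n in sequentially. \<forall>y\<in>ball x 1 \<inter> S.
              cmod (f (int_decode n) y) \<le> cmod (complex_of_real (h (int_decode n)))"
        using h(2) h0 by (simp add: abs_of_nonneg)
    qed simp
  qed (use f' in auto)
  then obtain g g' where g: "\<And>x. x \<in> S \<Longrightarrow> (\<lambda>k. f (int_decode k) x) sums g x"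
     "\<And>x. x \<in> S \<Longrightarrow> (\<lambda>k. f' (int_decode k) x) sums g' x"
     "\<And>x. x \<in> S \<Longrightarrow> (g has_field_derivative g' x) (at x)" by blast
  have gy: "g y = (\<Sum>\<^sub>\<infinity>n. f n y)" if "y \<in> S" for y
    using infsum_int_conv_suminf[OF sf[OF that]] g(1)[OF that] sums_unique2 by blast
  have g'x: "g' x = (\<Sum>\<^sub>\<infinity>n. f' n x)"
    using infsum_int_conv_suminf[OF sf'] g(2)[OF S(2)] sums_unique2 by blast
  show ?thesis
    using has_field_derivative_transform_within_open[OF g(3)[OF S(2)] S(1) S(2) gy] by (simp only: g'x)
qed

text \<open>One exponential exp x absorbs x^k and a second one is spent on the decay exp(-x);
  completing the square in -\<alpha> x^2 + (R + 2) x bounds the rest.\<close>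

lemma power_mult_gaussian_le:
  fixes x :: real
  assumes "\<alpha> > 0" "x \<ge> 0" "R \<ge> 0"
  shows "x ^ k * exp (- \<alpha> * x\<^sup>2 + R * x) \<le> fact k * exp ((R + 2)\<^sup>2 / (4 * \<alpha>)) * exp (- x)"
proof -
  have "x ^ k / fact k \<le> exp x"
  proof -
    have "(\<Sum>n\<in>{k}. x ^ n /\<^sub>R fact n) \<le> (\<Sum>n. x ^ n /\<^sub>R fact n)"
      by (rule sum_le_suminf) (use assms in \<open>auto intro: summable_exp\<close>)
    thus ?thesis by (simp add: exp_def field_simps)
  qed
  hence "x ^ k \<le> fact k * exp x" by (simp add: field_simps)
  hence "x ^ k * exp (- \<alpha> * x\<^sup>2 + R * x) \<le> fact k * exp x * exp (- \<alpha> * x\<^sup>2 + R * x)"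
    by (rule mult_right_mono) simp
  also have "\<dots> = fact k * (exp (- \<alpha> * x\<^sup>2 + (R + 2) * x) * exp (- x))"
    by (simp add: algebra_simps flip: exp_add)
  also have "- \<alpha> * x\<^sup>2 + (R + 2) * x \<le> (R + 2)\<^sup>2 / (4 * \<alpha>)"
  proof -
    have "(2 * \<alpha> * x - (R + 2))\<^sup>2 \<ge> 0" by simp
    thus ?thesis using assms(1) by (simp add: field_simps power2_eq_square)
  qed
  finally show ?thesis by (simp add: mult_right_mono mult.assoc)
qed

text \<open>Up to the choice of \<open>c\<close>, \<open>\<mu>\<close> and \<open>\<kappa>\<close>, all theta series below and their derivatives have this shape.\<close>
definition gauss_term :: "(int \<Rightarrow> complex) \<Rightarrow> real \<Rightarrow> real \<Rightarrow> nat \<Rightarrow> complex \<Rightarrow> complex \<Rightarrow> int \<Rightarrow> complex" where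
  "gauss_term c \<mu> \<kappa> k w \<tau> n =
     c n * of_real (of_int n + \<mu>) ^ k *
       exp (of_real pi * \<i> * of_real \<kappa> * \<tau> * (of_real (of_int n + \<mu>))\<^sup>2 + of_real (of_int n + \<mu>) * w)"

definition gauss_sum :: "(int \<Rightarrow> complex) \<Rightarrow> real \<Rightarrow> real \<Rightarrow> nat \<Rightarrow> complex \<Rightarrow> complex \<Rightarrow> complex" where
  "gauss_sum c \<mu> \<kappa> k w \<tau> = (\<Sum>\<^sub>\<infinity>n. gauss_term c \<mu> \<kappa> k w \<tau> n)"

text \<open>The bound depends on \<tau> and w only through \<open>y\<close> and \<open>R\<close>,
  hence serves as a common majorant on neighbourhoods in either variable.\<close>

lemma norm_gauss_term_le:
  assumes c: "norm (c n) \<le> 1" and \<kappa>: "\<kappa> > 0" and y: "y > 0" "Im \<tau> \<ge> y" and R: "R \<ge> 0" "\<bar>Re w\<bar> \<le> R"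
  shows "norm (gauss_term c \<mu> \<kappa> k w \<tau> n) \<le>
     fact k * exp ((R + 2)\<^sup>2 / (4 * (pi * \<kappa> * y))) * exp \<bar>\<mu>\<bar> * exp (- \<bar>real_of_int n\<bar>)"
proof -
  define x where "x = real_of_int n + \<mu>"
  have "norm (gauss_term c \<mu> \<kappa> k w \<tau> n) = norm (c n) * \<bar>x\<bar> ^ k * exp (- pi * \<kappa> * Im \<tau> * x\<^sup>2 + x * Re w)"
    by (simp add: gauss_term_def norm_mult norm_power x_def power2_eq_square algebra_simps flip: of_real_mult of_real_add)
  also have "\<dots> \<le> 1 * \<bar>x\<bar> ^ k * exp (- (pi * \<kappa> * y) * \<bar>x\<bar>\<^sup>2 + R * \<bar>x\<bar>)"
  proof (intro mult_mono)
    have "pi * \<kappa> * y * x\<^sup>2 \<le> pi * \<kappa> * Im \<tau> * x\<^sup>2"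
      using \<kappa> y by (intro mult_right_mono mult_left_mono) auto
    moreover have "x * Re w \<le> R * \<bar>x\<bar>"
    proof -
      have "x * Re w \<le> \<bar>x\<bar> * \<bar>Re w\<bar>" by (metis abs_ge_self abs_mult)
      also have "\<dots> \<le> \<bar>x\<bar> * R" using R by (intro mult_left_mono) auto
      finally show ?thesis by (simp add: mult.commute)
    qed
    ultimately show "exp (- pi * \<kappa> * Im \<tau> * x\<^sup>2 + x * Re w) \<le> exp (- (pi * \<kappa> * y) * \<bar>x\<bar>\<^sup>2 + R * \<bar>x\<bar>)"
      by (simp only: exp_le_cancel_iff mult_minus_left power2_abs)
  qed (use c in auto)
  also have "\<dots> \<le> fact k * exp ((R + 2)\<^sup>2 / (4 * (pi * \<kappa> * y))) * exp (- \<bar>x\<bar>)"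
    using power_mult_gaussian_le[of "pi * \<kappa> * y" "\<bar>x\<bar>" R k] \<kappa> y R by simp
  also have "\<dots> \<le> fact k * exp ((R + 2)\<^sup>2 / (4 * (pi * \<kappa> * y))) * (exp \<bar>\<mu>\<bar> * exp (- \<bar>real_of_int n\<bar>))"
    by (intro mult_left_mono) (auto simp: x_def simp flip: exp_add)
  finally show ?thesis by (simp add: mult.assoc)
qed

lemma summable_on_gauss_majorant:
  "(\<lambda>n::int. K * exp (- \<bar>real_of_int n\<bar>)) summable_on UNIV"
  by (intro summable_on_cmult_right summable_on_exp_neg_abs)

lemma gauss_term_abs_summable:
  assumes "\<And>n. norm (c n) \<le> 1" "\<kappa> > 0" "Im \<tau> > 0"
  shows "(\<lambda>n. norm (gauss_term c \<mu> \<kappa> k w \<tau> n)) summable_on UNIV"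
  by (rule Infinite_Sum.abs_summable_on_comparison_test'[OF summable_on_gauss_majorant])
     (rule norm_gauss_term_le[of c _ \<kappa> "Im \<tau>" \<tau> "\<bar>Re w\<bar>" w \<mu> k], use assms in auto)

lemma gauss_sum_deriv_w:
  assumes c: "\<And>n. norm (c n) \<le> 1" and \<kappa>: "\<kappa> > 0" and \<tau>: "Im \<tau> > 0"
  shows "((\<lambda>w. gauss_sum c \<mu> \<kappa> k w \<tau>) has_field_derivative gauss_sum c \<mu> \<kappa> (Suc k) w \<tau>) (at w)"
  unfolding gauss_sum_def
proof (rule has_field_derivative_infsum_int[where S = "ball w 1"])
  show "norm (gauss_term c \<mu> \<kappa> k v \<tau> n) \<le>
    fact k * exp ((\<bar>Re w\<bar> + 1 + 2)\<^sup>2 / (4 * (pi * \<kappa> * Im \<tau>))) * exp \<bar>\<mu>\<bar> * exp (- \<bar>real_of_int n\<bar>)"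
    if "v \<in> ball w 1" for v n
  proof (rule norm_gauss_term_le)
    have "\<bar>Re w - Re v\<bar> \<le> norm (w - v)" by (metis abs_Re_le_cmod minus_complex.sel(1))
    thus "\<bar>Re v\<bar> \<le> \<bar>Re w\<bar> + 1" using that by (auto simp: dist_norm)
  qed (use assms in auto)
  show "((\<lambda>w. gauss_term c \<mu> \<kappa> k w \<tau> n) has_field_derivative gauss_term c \<mu> \<kappa> (Suc k) v \<tau> n) (at v)" for v n
    unfolding gauss_term_def by (auto intro!: derivative_eq_intros simp: algebra_simps)
qed (use assms in \<open>auto intro!: summable_on_gauss_majorant gauss_term_abs_summable\<close>)

text \<open>The heat equation: differentiating the exponential in \<tau> brings down two more
  factors n + \<mu>, just as two derivatives in w do.\<close>

lemma gauss_sum_deriv_tau: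
  assumes c: "\<And>n. norm (c n) \<le> 1" and \<kappa>: "\<kappa> > 0" and \<tau>: "Im \<tau> > 0"
  shows "((\<lambda>\<tau>. gauss_sum c \<mu> \<kappa> k w \<tau>) has_field_derivative
     of_real pi * \<i> * of_real \<kappa> * gauss_sum c \<mu> \<kappa> (k + 2) w \<tau>) (at \<tau>)"
proof -
  have "((\<lambda>\<tau>. \<Sum>\<^sub>\<infinity>n. gauss_term c \<mu> \<kappa> k w \<tau> n) has_field_derivative
     (\<Sum>\<^sub>\<infinity>n. of_real pi * \<i> * of_real \<kappa> * gauss_term c \<mu> \<kappa> (k + 2) w \<tau> n)) (at \<tau>)"
  proof (rule has_field_derivative_infsum_int[where S = "ball \<tau> (Im \<tau> / 2)"])
    show "norm (gauss_term c \<mu> \<kappa> k w v n) \<le>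
      fact k * exp ((\<bar>Re w\<bar> + 2)\<^sup>2 / (4 * (pi * \<kappa> * (Im \<tau> / 2)))) * exp \<bar>\<mu>\<bar> * exp (- \<bar>real_of_int n\<bar>)"
      if "v \<in> ball \<tau> (Im \<tau> / 2)" for v n
    proof (rule norm_gauss_term_le)
      have "\<bar>Im \<tau> - Im v\<bar> \<le> norm (\<tau> - v)" by (metis abs_Im_le_cmod minus_complex.sel(2))
      thus "Im \<tau> / 2 \<le> Im v" using that by (auto simp: dist_norm)
    qed (use assms in auto)
    show "((\<lambda>\<tau>. gauss_term c \<mu> \<kappa> k w \<tau> n) has_field_derivative 
        of_real pi * \<i> * of_real \<kappa> * gauss_term c \<mu> \<kappa> (k + 2) w v n) (at v)" for v n
      unfolding gauss_term_def
      by (auto intro!: derivative_eq_intros simp: algebra_simps power_add power2_eq_square)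
    have "(\<lambda>n. norm (complex_of_real pi * \<i> * complex_of_real \<kappa>) * norm (gauss_term c \<mu> \<kappa> (k + 2) w \<tau> n)) summable_on UNIV"
      using assms by (intro summable_on_cmult_right gauss_term_abs_summable)
    thus "(\<lambda>n. norm (of_real pi * \<i> * of_real \<kappa> * gauss_term c \<mu> \<kappa> (k + 2) w \<tau> n)) summable_on UNIV"
      by (simp add: norm_mult mult.assoc)
  qed (use assms in \<open>auto intro!: summable_on_gauss_majorant\<close>)
  thus ?thesis unfolding gauss_sum_def by (simp add: infsum_cmult_right' mult.assoc)
qed

section \<open>The cube of the theta function\<close>

lemma norm_summable_times:
  fixes f :: "'a \<Rightarrow> complex" and g :: "'b \<Rightarrow> complex"
  assumes "(\<lambda>x. norm (f x)) summable_on UNIV" "(\<lambda>x. norm (g x)) summable_on UNIV"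
  shows "(\<lambda>p. norm (case p of (x, y) \<Rightarrow> f x * g y)) summable_on UNIV"
proof -
  have "Infinite_Sum.abs_summable_on (\<lambda>(x, y). f x * g y) (Sigma UNIV (\<lambda>_. UNIV))"
    unfolding Infinite_Sum.abs_summable_on_Sigma_iff using assms
    by (auto simp: norm_mult infsum_cmult_right' infsum_nonneg
             intro!: summable_on_cmult_right summable_on_cmult_left)
  thus ?thesis by simp
qed

lemma infsum_times:
  fixes f :: "'a \<Rightarrow> complex" and g :: "'b \<Rightarrow> complex"
  assumes "(\<lambda>x. norm (f x)) summable_on UNIV" "(\<lambda>x. norm (g x)) summable_on UNIV"
  shows "infsum f UNIV * infsum g UNIV = (\<Sum>\<^sub>\<infinity>(x, y)\<in>UNIV. f x * g y)"
proof -
  have "(\<lambda>(x, y). f x * g y) summable_on (Sigma UNIV (\<lambda>_. UNIV))"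
    using abs_summable_summable[OF norm_summable_times[OF assms]] by simp
  from infsum_Sigma'_banach[OF this] show ?thesis
    by (simp add: infsum_cmult_right' infsum_cmult_left')
qed

definition sg :: "int \<Rightarrow> complex" where "sg n = (if even n then 1 else -1)"

text \<open>Up to a constant factor this is the classical odd theta function in the variable z with
  w = 2 i z, differentiated k times in w. The next two series collect the terms of its cube with
  index sum divisible by 3 and not divisible by 3; the shift -3/2 is the sum of three shifts
  -1/2.\<close>

definition theta :: "nat \<Rightarrow> complex \<Rightarrow> complex \<Rightarrow> complex" where
  "theta = gauss_sum sg (-1/2) 1"

definition theta3 :: "nat \<Rightarrow> complex \<Rightarrow> complex \<Rightarrow> complex" where
  "theta3 = gauss_sum (\<lambda>n. if 3 dvd n then sg n else 0) (-3/2) (1/3)"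

definition theta3' :: "nat \<Rightarrow> complex \<Rightarrow> complex \<Rightarrow> complex" where
  "theta3' = gauss_sum (\<lambda>n. if 3 dvd n then 0 else sg n) (-3/2) (1/3)"

lemma norm_sg [simp]: "norm (sg n) = 1"
  by (simp add: sg_def)

lemma sg_add: "sg (m + n) = sg m * sg n"
  by (simp add: sg_def)

text \<open>
  For \<open>i + j + k = N\<close> one has $(i - 1/2)^2 + (j - 1/2)^2 + (k - 1/2)^2 = (N - 3/2)^2/3 + e$ with \<open>e\<close> the sum of the
  squared distances of \<open>i\<close>, \<open>j\<close>, \<open>k\<close> to \<open>N/3\<close>; a translation of \<open>(i, j, k)\<close> shows that the theta series with
  exponents \<open>e\<close> only depends on \<open>N\<close> modulo 3.
\<close>
definition coset_exponent :: "int \<Rightarrow> int \<times> int \<Rightarrow> real" where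
  "coset_exponent N = (\<lambda>(i, j). (of_int i - of_int N / 3)\<^sup>2 + (of_int j - of_int N / 3)\<^sup>2
      + (of_int N - of_int i - of_int j - of_int N / 3)\<^sup>2)"

text \<open>For N = 1 this is c(q) of the Borweins, with exp(2 \<pi> i \<tau> / 3) as the chosen
  cube root of q.\<close>

definition coset_theta :: "int \<Rightarrow> complex \<Rightarrow> complex" where
  "coset_theta N \<tau> = (\<Sum>\<^sub>\<infinity>p. exp (of_real pi * \<i> * \<tau> * of_real (coset_exponent N p)))"

lemma coset_theta_0: "coset_theta 0 \<tau> = cubic_a (exp (2 * of_real pi * \<i> * \<tau>))"
proof -
  have "exp (of_real pi * \<i> * \<tau> * of_real (coset_exponent 0 (m, n))) =
        exp (2 * of_real pi * \<i> * \<tau>) powi (m\<^sup>2 + m * n + n\<^sup>2)" for m n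
    by (simp add: coset_exponent_def exp_power_int power2_eq_square algebra_simps)
  thus ?thesis by (auto simp: coset_theta_def cubic_a_def intro!: infsum_cong)
qed

lemma coset_theta_shift: "coset_theta (N + 3 * M) \<tau> = coset_theta N \<tau>"
  unfolding coset_theta_def
proof (rule infsum_reindex_bij_witness[of _ "\<lambda>(i, j). (i + M, j + M)" "\<lambda>(i, j). (i - M, j - M)"])
  fix p :: "int \<times> int"
  show "exp (of_real pi * \<i> * \<tau> * of_real (coset_exponent N ((\<lambda>(i, j). (i - M, j - M)) p))) =
        exp (of_real pi * \<i> * \<tau> * of_real (coset_exponent (N + 3 * M) p))"
    by (cases p) (simp add: coset_exponent_def algebra_simps add_divide_distrib)
qed auto

lemma coset_theta_minus: "coset_theta (- N) \<tau> = coset_theta N \<tau>"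
  unfolding coset_theta_def
proof (rule infsum_reindex_bij_witness[of _ "\<lambda>(i, j). (-i, -j)" "\<lambda>(i, j). (-i, -j)"])
  fix p :: "int \<times> int"
  show "exp (of_real pi * \<i> * \<tau> * of_real (coset_exponent N ((\<lambda>(i, j). (- i, - j)) p))) =
        exp (of_real pi * \<i> * \<tau> * of_real (coset_exponent (- N) p))"
    by (cases p) (simp add: coset_exponent_def power2_eq_square algebra_simps)
qed auto

text \<open>Translation reduces N modulo 3, and the reflection N to -N identifies the residues 1 and
  2.\<close>

lemma coset_theta_eq: "coset_theta N \<tau> = coset_theta (if 3 dvd N then 0 else 1) \<tau>"
proof -
  have *: "coset_theta N \<tau> = coset_theta (N mod 3) \<tau>"
    using coset_theta_shift[of "N mod 3" "N div 3" \<tau>] by simp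
  have "coset_theta 2 \<tau> = coset_theta 1 \<tau>"
    using coset_theta_shift[of "-1" 1 \<tau>] coset_theta_minus[of 1 \<tau>] by simp
  moreover have "N mod 3 = 0 \<or> N mod 3 = 1 \<or> N mod 3 = 2" by presburger
  ultimately show ?thesis using * by (auto simp: dvd_eq_mod_eq_0)
qed

lemma theta_cubed:
  assumes \<tau>: "Im \<tau> > 0"
  shows "theta 0 w \<tau> ^ 3 =
    cubic_a (exp (2 * of_real pi * \<i> * \<tau>)) * theta3 0 w \<tau> + coset_theta 1 \<tau> * theta3' 0 w \<tau>"
proof -
  let ?t = "gauss_term sg (-1/2) 1 0 w \<tau>"
  let ?g = "gauss_term sg (-3/2) (1/3) 0 w \<tau>"
  let ?e = "\<lambda>N p. exp (of_real pi * \<i> * \<tau> * of_real (coset_exponent N p))"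
  have st: "(\<lambda>n. norm (?t n)) summable_on UNIV"
    by (rule gauss_term_abs_summable) (use \<tau> in auto)
  note s2 = norm_summable_times[OF st st]
  note s3 = norm_summable_times[OF s2 st]
  \<comment> \<open>Triples (i, j, k) are regrouped by their sum N = i + j + k, with (i, j) as
    coordinates on the triples of fixed sum.\<close>
  let ?h = "\<lambda>(N, (i, j)). ((i, j), N - i - j) :: (int \<times> int) \<times> int"
  have bij: "bij_betw ?h UNIV UNIV"
    by (rule bij_betwI[of _ _ _ "\<lambda>((i, j), k). (i + j + k, (i, j))"]) auto
  have trm: "(case ?h x of (x, y) \<Rightarrow> (case x of (x, y) \<Rightarrow> ?t x * ?t y) * ?t y) =
          (case x of (N, p) \<Rightarrow> ?g N * ?e N p)" for x
  proof -
    obtain N i j where [simp]: "x = (N, (i, j))" by (metis prod.exhaust)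
    have sgs: "sg i * sg j * sg (N - i - j) = sg N"
      by (simp flip: sg_add)
    define P where "P = of_real pi * \<i> * \<tau>"
    define X where "X n = P * (of_real (of_int n + - 1 / 2))\<^sup>2 + of_real (of_int n + - 1 / 2) * w" for n
    have "X i + X j + X (N - i - j) = (P * of_real (1 / 3) * (of_real (of_int N + - 3 / 2))\<^sup>2 +
        of_real (of_int N + - 3 / 2) * w) + P * of_real (coset_exponent N (i, j))"
      by (simp add: X_def coset_exponent_def power2_eq_square field_simps)
    hence exps: "exp (X i) * exp (X j) * exp (X (N - i - j)) = exp (P * of_real (1 / 3) *
       (of_real (of_int N + - 3 / 2))\<^sup>2 + of_real (of_int N + - 3 / 2) * w) * exp (P * of_real (coset_exponent N (i, j)))"
      by (simp only: exp_add[symmetric])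
    have t: "?t n = sg n * exp (X n)" for n
      by (simp add: gauss_term_def X_def P_def)
    have g: "?g N = sg N * exp (P * of_real (1 / 3) *
       (of_real (of_int N + - 3 / 2))\<^sup>2 + of_real (of_int N + - 3 / 2) * w)"
      by (simp add: gauss_term_def P_def algebra_simps)
    have "?t i * ?t j * ?t (N - i - j) = (sg i * sg j * sg (N - i - j)) * (exp (X i) * exp (X j) * exp (X (N - i - j)))"
      unfolding t by (simp only: ac_simps)
    also have "\<dots> = ?g N * ?e N (i, j)"
      unfolding sgs exps g P_def by (simp only: mult.assoc)
    finally show ?thesis by simp
  qed
  have "theta 0 w \<tau> ^ 3 = infsum ?t UNIV * infsum ?t UNIV * infsum ?t UNIV"
    by (simp add: theta_def gauss_sum_def power3_eq_cube)
  also have "\<dots> = (\<Sum>\<^sub>\<infinity>(x, y)\<in>UNIV. (case x of (x, y) \<Rightarrow> ?t x * ?t y) * ?t y)"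
    using infsum_times[OF st st] infsum_times[OF s2 st] by simp
  also have "\<dots> = (\<Sum>\<^sub>\<infinity>(N, p)\<in>UNIV. ?g N * ?e N p)"
    by (rule trans[OF infsum_reindex_bij_betw[OF bij, symmetric]], rule infsum_cong) (rule trm)
  also have "\<dots> = (\<Sum>\<^sub>\<infinity>N. \<Sum>\<^sub>\<infinity>p. ?g N * ?e N p)"
  proof -
    have "(\<lambda>x. case x of (x, y) \<Rightarrow> (case x of (x, y) \<Rightarrow> ?t x * ?t y) * ?t y) summable_on UNIV"
      by (rule abs_summable_summable[OF s3])
    hence "(\<lambda>x. case ?h x of (x, y) \<Rightarrow> (case x of (x, y) \<Rightarrow> ?t x * ?t y) * ?t y) summable_on UNIV"
      by (rule iffD2[OF summable_on_reindex_bij_betw[OF bij]])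
    hence "(\<lambda>(N, p). ?g N * ?e N p) summable_on (Sigma UNIV (\<lambda>_. UNIV))"
      unfolding trm by simp
    from infsum_Sigma'_banach[OF this] show ?thesis by simp
  qed
  also have "\<dots> = (\<Sum>\<^sub>\<infinity>N. ?g N * coset_theta (if 3 dvd N then 0 else 1) \<tau>)"
    by (simp only: infsum_cmult_right' coset_theta_def[symmetric] flip: coset_theta_eq)
  also have "\<dots> = (\<Sum>\<^sub>\<infinity>N. coset_theta 0 \<tau> * gauss_term (\<lambda>n. if 3 dvd n then sg n else 0) (-3/2) (1/3) 0 w \<tau> N
     + coset_theta 1 \<tau> * gauss_term (\<lambda>n. if 3 dvd n then 0 else sg n) (-3/2) (1/3) 0 w \<tau> N)"
    by (rule infsum_cong) (simp add: gauss_term_def)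
  also have "\<dots> = coset_theta 0 \<tau> * theta3 0 w \<tau> + coset_theta 1 \<tau> * theta3' 0 w \<tau>"
  proof (subst infsum_add)
    show "(\<lambda>N. coset_theta 0 \<tau> * gauss_term (\<lambda>n. if 3 dvd n then sg n else 0) (-3/2) (1/3) 0 w \<tau> N) summable_on UNIV"
      "(\<lambda>N. coset_theta 1 \<tau> * gauss_term (\<lambda>n. if 3 dvd n then 0 else sg n) (-3/2) (1/3) 0 w \<tau> N) summable_on UNIV"
      by (rule summable_on_cmult_right, rule abs_summable_summable, rule gauss_term_abs_summable; use \<tau> in simp)+
  qed (simp add: theta3_def theta3'_def gauss_sum_def infsum_cmult_right')
  finally show ?thesis by (simp add: coset_theta_0)
qed

text \<open>Since m = -2 \<mu>, the substitution n to m - n reverses the sign of n + \<mu>; the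
  coefficients contribute one further sign.\<close>

lemma gauss_sum_reflect:
  assumes "\<And>n. c (m - n) = - c n" "of_int m + 2 * \<mu> = 0"
  shows "gauss_sum c \<mu> \<kappa> k (- w) \<tau> = - ((- 1) ^ k) * gauss_sum c \<mu> \<kappa> k w \<tau>"
proof -
  have [simp]: "of_int (m - n) + \<mu> = - (of_int n + \<mu>)" for n using assms(2) by simp
  have "gauss_sum c \<mu> \<kappa> k (- w) \<tau> = (\<Sum>\<^sub>\<infinity>n. gauss_term c \<mu> \<kappa> k (- w) \<tau> (m - n))"
    unfolding gauss_sum_def
    by (rule infsum_reindex_bij_witness[of _ "\<lambda>n. m - n" "\<lambda>n. m - n"]) auto
  also have "(\<lambda>n. gauss_term c \<mu> \<kappa> k (- w) \<tau> (m - n)) = (\<lambda>n. - ((- 1) ^ k) * gauss_term c \<mu> \<kappa> k w \<tau> n)"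
  proof
    fix n
    show "gauss_term c \<mu> \<kappa> k (- w) \<tau> (m - n) = - ((- 1) ^ k) * gauss_term c \<mu> \<kappa> k w \<tau> n"
    unfolding gauss_term_def assms(1) \<open>of_int (m - n) + \<mu> = - (of_int n + \<mu>)\<close> of_real_minus
    by (subst power_minus) (simp add: power2_eq_square algebra_simps)
  qed
  finally show ?thesis by (simp only: infsum_cmult_right' gauss_sum_def)
qed

lemma gauss_sum_reflect_0:
  assumes "\<And>n. c (m - n) = - c n" "of_int m + 2 * \<mu> = 0" "even k"
  shows "gauss_sum c \<mu> \<kappa> k 0 \<tau> = 0"
  using gauss_sum_reflect[where c = c and m = m and \<mu> = \<mu> and w = 0, OF assms(1,2), of \<kappa> k \<tau>] assms(3) by simp

lemma sg_reflect: "odd m \<Longrightarrow> sg (m - n) = - sg n"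
  by (auto simp: sg_def)

lemma dvd_3_reflect: "(3::int) dvd 3 - n \<longleftrightarrow> 3 dvd n"
  by presburger

lemma theta_even_0: "even k \<Longrightarrow> theta k 0 \<tau> = 0"
  unfolding theta_def by (rule gauss_sum_reflect_0[of _ 1]) (auto simp: sg_reflect)

lemma theta3_even_0: "even k \<Longrightarrow> theta3 k 0 \<tau> = 0"
  unfolding theta3_def by (rule gauss_sum_reflect_0[of _ 3]) (auto simp: sg_reflect dvd_3_reflect)

abbreviation w3 :: complex where "w3 \<equiv> 2 * of_real pi * \<i> / 3"

text \<open>For n = 3 m the exponent (n - 3/2) w3 equals 2 \<pi> i m - \<pi> i, so every term
  changes sign. Consequently the even derivatives vanish at \<open>w3\<close> as well as at
  0.\<close>

lemma theta3_torsion: "theta3 k w3 \<tau> = - theta3 k 0 \<tau>"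
proof -
  have "gauss_term (\<lambda>n. if 3 dvd n then sg n else 0) (-3/2) (1/3) k w3 \<tau> n =
     - gauss_term (\<lambda>n. if 3 dvd n then sg n else 0) (-3/2) (1/3) k 0 \<tau> n" for n
  proof (cases "3 dvd n")
    case True
    then obtain m where m: "n = 3 * m" by blast
    have "of_real (of_int n + - 3/2) * w3 = 2 * of_int m * of_real pi * \<i> - of_real pi * \<i>"
      by (simp add: m field_simps)
    hence "exp (of_real (of_int n + - 3/2) * w3) = - 1"
      using exp_integer_2pi[of "of_int m"] by (simp only: exp_diff) simp
    thus ?thesis by (simp add: gauss_term_def exp_add)
  qed (simp add: gauss_term_def)
  thus ?thesis by (simp add: theta3_def gauss_sum_def infsum_uminus)
qed

text \<open>Only n = 3 m contributes, and n - 3/2 = 3 (m - 1/2): the square turns \<kappa> = 1/3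
  into a scaling of \<tau> by 3, and the single factor n - 3/2 produces the 3.\<close>

lemma theta3_1_eq: "theta3 1 0 \<tau> = 3 * theta 1 0 (3 * \<tau>)"
proof -
  have "theta3 1 0 \<tau> = (\<Sum>\<^sub>\<infinity>n\<in>range (\<lambda>m. 3 * m).
          gauss_term (\<lambda>n. if 3 dvd n then sg n else 0) (-3/2) (1/3) 1 0 \<tau> n)"
    unfolding theta3_def gauss_sum_def
    by (rule infsum_cong_neutral) (auto simp: gauss_term_def)
  also have "\<dots> = (\<Sum>\<^sub>\<infinity>m. gauss_term (\<lambda>n. if 3 dvd n then sg n else 0) (-3/2) (1/3) 1 0 \<tau> (3 * m))"
    by (subst infsum_reindex) (auto simp: inj_on_def o_def)
  also have "\<dots> = (\<Sum>\<^sub>\<infinity>m. 3 * gauss_term sg (-1/2) 1 1 0 (3 * \<tau>) m)"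
  proof (rule infsum_cong)
    fix m :: int
    have "of_real (of_int (3 * m) + -3/2) = (3 * of_real (of_int m + -1/2) :: complex)"
      by simp
    thus "gauss_term (\<lambda>n. if 3 dvd n then sg n else 0) (-3/2) (1/3) 1 0 \<tau> (3 * m) =
        3 * gauss_term sg (-1/2) 1 1 0 (3 * \<tau>) m"
      by (simp add: gauss_term_def sg_def power2_eq_square algebra_simps)
  qed
  finally show ?thesis
    by (simp add: infsum_cmult_right' theta_def gauss_sum_def)
qed

text \<open>The first derivative is even in w, so twice its value at \<open>w3\<close> is the sum of
  the values at \<open>w3\<close> and \<open>- w3\<close>. For n not divisible by 3 the two
  exponentials are exp(\<pi> i / 3) and its inverse, with sum 2 cos(\<pi>/3) = 1.\<close>

lemma theta3'_1_torsion:
  assumes "Im \<tau> > 0"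
  shows "2 * theta3' 1 w3 \<tau> = theta3' 1 0 \<tau>"
proof -
  let ?c = "\<lambda>n::int. if 3 dvd n then 0 else sg n"
  let ?g = "\<lambda>w. gauss_term ?c (-3/2) (1/3) 1 w \<tau>"
  have s: "?g w summable_on UNIV" for w
    by (rule abs_summable_summable, rule gauss_term_abs_summable) (use assms in auto)
  have "theta3' 1 (- w3) \<tau> = - ((-1) ^ 1) * theta3' 1 w3 \<tau>"
    unfolding theta3'_def
    by (rule gauss_sum_reflect[where m = 3]) (auto simp: sg_reflect dvd_3_reflect)
  hence "2 * theta3' 1 w3 \<tau> = theta3' 1 w3 \<tau> + theta3' 1 (- w3) \<tau>" by simp
  also have "\<dots> = (\<Sum>\<^sub>\<infinity>n. ?g w3 n + ?g (- w3) n)"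
    unfolding theta3'_def gauss_sum_def by (rule infsum_add[symmetric]) (rule s)+
  also have "\<dots> = (\<Sum>\<^sub>\<infinity>n. ?g 0 n)"
  proof (rule infsum_cong)
    fix n :: int
    show "?g w3 n + ?g (- w3) n = ?g 0 n"
    proof (cases "3 dvd n")
      case False
      have third: "exp (of_real pi * \<i> / 3) + exp (- (of_real pi * \<i> / 3)) = 1"
        using cos_60 by (simp add: complex_eq_iff Re_exp Im_exp)
      have "exp (of_real (of_int n + -3/2) * w3) + exp (of_real (of_int n + -3/2) * - w3) = 1"
      proof -
        from False have "n mod 3 = 1 \<or> n mod 3 = 2" by presburger
        moreover have "n = 3 * (n div 3) + n mod 3" by simp
        ultimately obtain m where m: "n = 3 * m + 1 \<or> n = 3 * m + 2" by metis
        have e: "exp (2 * of_int k * of_real pi * \<i>) = 1" for k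
          using exp_integer_2pi[of "of_int k"] by simp
        from m show ?thesis
        proof
          assume n: "n = 3 * m + 1"
          have *: "of_real (of_int n + -3/2) * w3 = 2 * of_int m * of_real pi * \<i> + - (of_real pi * \<i> / 3)"
               "of_real (of_int n + -3/2) * - w3 = 2 * of_int (-m) * of_real pi * \<i> + of_real pi * \<i> / 3"
            by (simp_all add: n field_simps)
          show ?thesis unfolding * exp_add e using third by (simp add: add.commute)
        next
          assume n: "n = 3 * m + 2"
          have *: "of_real (of_int n + -3/2) * w3 = 2 * of_int m * of_real pi * \<i> + of_real pi * \<i> / 3"
               "of_real (of_int n + -3/2) * - w3 = 2 * of_int (-m) * of_real pi * \<i> + - (of_real pi * \<i> / 3)"
            by (simp_all add: n field_simps)
          show ?thesis unfolding * exp_add e using third by (simp add: add.commute)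
        qed
      qed
      moreover have "?g w n = sg n * of_real (of_int n + -3/2) *
          exp (of_real pi * \<i> * of_real (1/3) * \<tau> * (of_real (of_int n + -3/2))\<^sup>2) * exp (of_real (of_int n + -3/2) * w)" for w
        using False by (simp add: gauss_term_def exp_add)
      ultimately show ?thesis by (simp only: flip: distrib_left) simp
    qed (simp add: gauss_term_def)
  qed
  finally show ?thesis by (simp add: theta3'_def gauss_sum_def)
qed

section \<open>Convergence and regularity of the infinite products\<close>

lemma convergent_prod_one_minus:
  fixes f :: "nat \<Rightarrow> complex"
  assumes "summable (\<lambda>n. norm (f n))"
  shows "convergent_prod (\<lambda>n. 1 - f n)"
  by (rule abs_convergent_prod_imp_convergent_prod)
     (use assms in \<open>simp add: abs_convergent_prod_conv_summable\<close>)

lemma uniform_limit_prod_one_minus: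
  fixes f :: "nat \<Rightarrow> complex \<Rightarrow> complex"
  assumes "compact A" "\<And>n. continuous_on A (f n)" "\<And>n x. x \<in> A \<Longrightarrow> norm (f n x) \<le> M n" "summable M"
  shows "uniform_limit A (\<lambda>N x. \<Prod>n<N. 1 - f n x) (\<lambda>x. \<Prod>n. 1 - f n x) sequentially"
proof -
  have "uniformly_convergent_on A (\<lambda>N x. \<Prod>n<N. 1 + - f n x)"
    by (intro Infinite_Products.uniformly_convergent_on_prod Weierstrass_m_test'[of _ _ M])
       (use assms in \<open>auto intro!: continuous_intros\<close>)
  hence "uniform_limit A (\<lambda>N x. \<Prod>n<N. 1 - f n x) (\<lambda>x. lim (\<lambda>N. \<Prod>n<N. 1 - f n x)) sequentially"
    by (simp add: uniformly_convergent_uniform_limit_iff)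
  moreover have "lim (\<lambda>N. \<Prod>n<N. 1 - f n x) = (\<Prod>n. 1 - f n x)" if "x \<in> A" for x
  proof -
    have "summable (\<lambda>n. norm (f n x))"
      by (rule summable_comparison_test'[OF assms(4)]) (use assms(3)[OF that] in auto)
    thus ?thesis
      by (intro limI has_prod_imp_tendsto' convergent_prod_has_prod convergent_prod_one_minus)
  qed
  ultimately show ?thesis by (simp add: uniform_limit_iff)
qed

text \<open>The infinite \<open>q\<close>-Pochhammer symbol $(qx; q)_\infty$.\<close>
definition qpoch :: "complex \<Rightarrow> complex \<Rightarrow> complex" where
  "qpoch x q = (\<Prod>n. 1 - x * q ^ Suc n)"

lemma summable_qpoch:
  assumes "norm (q :: complex) < 1"
  shows "summable (\<lambda>n. norm (x * q ^ Suc n))"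
  using assms by (auto simp: norm_mult norm_power intro!: summable_mult summable_geometric)

lemma qpoch_has_prod: "norm q < 1 \<Longrightarrow> (\<lambda>n. 1 - x * q ^ Suc n) has_prod qpoch x q"
  unfolding qpoch_def by (intro convergent_prod_has_prod convergent_prod_one_minus summable_qpoch)

lemma qpoch_tendsto: "norm q < 1 \<Longrightarrow> (\<lambda>N. \<Prod>n<N. 1 - x * q ^ Suc n) \<longlonglongrightarrow> qpoch x q"
  by (intro has_prod_imp_tendsto' qpoch_has_prod)

lemma qpoch_factor_nz:
  assumes "norm (q :: complex) < 1"
  shows "1 - q ^ Suc n \<noteq> 0"
proof
  assume "1 - q ^ Suc n = 0"
  hence "norm (q ^ Suc n) = 1" by simp
  moreover have "norm (q ^ Suc n) < 1"
    using assms by (simp add: norm_power power_less_one_iff del: power_Suc)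
  ultimately show False by simp
qed

lemma qpoch_1_nz: "norm q < 1 \<Longrightarrow> qpoch 1 q \<noteq> 0"
  unfolding qpoch_def
  by (intro prodinf_nonzero convergent_prod_one_minus summable_qpoch) (use qpoch_factor_nz[of q] in auto)

lemma qpoch_0 [simp]: "qpoch x 0 = 1"
  by (simp add: qpoch_def)

text \<open>Continuity at 1 is what the limit of theta(w)/w for w tending to 0 requires in the
  product formula.\<close>

lemma continuous_qpoch:
  assumes q: "norm q < 1"
  shows "continuous (at 1) (\<lambda>x. qpoch x q)"
proof -
  have "uniform_limit (cball 1 1) (\<lambda>N x. \<Prod>n<N. 1 - x * q ^ Suc n) (\<lambda>x. \<Prod>n. 1 - x * q ^ Suc n) sequentially"
  proof (rule uniform_limit_prod_one_minus[where M = "\<lambda>n. norm (2 * q ^ Suc n)"])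
    show "norm (x * q ^ Suc n) \<le> norm (2 * q ^ Suc n)" if "x \<in> cball 1 1" for x n
    proof -
      have "norm x \<le> 2" using that norm_triangle_ineq2[of x 1] by (auto simp: dist_norm norm_minus_commute)
      thus ?thesis by (auto simp: norm_mult intro!: mult_right_mono)
    qed
  qed (use summable_qpoch[OF q, of 2] in \<open>auto intro!: continuous_intros\<close>)
  hence "continuous_on (cball 1 1) (\<lambda>x. qpoch x q)"
    unfolding qpoch_def
    by (rule uniform_limit_theorem[rotated]) (auto intro!: always_eventually continuous_intros)
  thus ?thesis
    by (rule continuous_on_interior) auto
qed

lemma holomorphic_qpoch: "qpoch 1 holomorphic_on ball 0 1"
proof (rule holomorphic_uniform_sequence)
  show "(\<lambda>q. \<Prod>n<N. 1 - 1 * q ^ Suc n) holomorphic_on ball 0 1" for N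
    by (intro holomorphic_intros)
  fix z :: complex assume z: "z \<in> ball 0 1"
  define d where "d = (1 - norm z) / 2"
  have d: "d > 0" using z by (auto simp: d_def)
  have sub: "norm x \<le> norm z + d" if "x \<in> cball z d" for x
    using that norm_triangle_ineq2[of x z] by (auto simp: dist_norm norm_minus_commute)
  have lt: "norm z + d < 1" using z by (auto simp: d_def field_simps)
  have "uniform_limit (cball z d) (\<lambda>N x. \<Prod>n<N. 1 - 1 * x ^ Suc n) (\<lambda>x. \<Prod>n. 1 - 1 * x ^ Suc n) sequentially"
  proof (rule uniform_limit_prod_one_minus[where M = "\<lambda>n. (norm z + d) ^ Suc n"])
    show "norm (1 * x ^ Suc n) \<le> (norm z + d) ^ Suc n" if "x \<in> cball z d" for x n
      using sub[OF that] by (simp only: mult_1 norm_power) (rule power_mono, auto)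
    show "summable (\<lambda>n. (norm z + d) ^ Suc n)"
      using lt d by (auto intro!: summable_mult summable_geometric)
  qed (auto intro!: continuous_intros)
  moreover have "cball z d \<subseteq> ball 0 1"
    using sub lt by fastforce
  ultimately show "\<exists>d>0. cball z d \<subseteq> ball 0 1 \<and>
      uniform_limit (cball z d) (\<lambda>N x. \<Prod>n<N. 1 - 1 * x ^ Suc n) (qpoch 1) sequentially"
    using d by (auto simp: qpoch_def[abs_def])
qed auto

section \<open>The triple product\<close>

definition qfact :: "complex \<Rightarrow> nat \<Rightarrow> complex" where
  "qfact q n = (\<Prod>k<n. 1 - q ^ Suc k)"

definition qbinom :: "complex \<Rightarrow> nat \<Rightarrow> nat \<Rightarrow> complex" where
  "qbinom q N j = (if j \<le> N then qfact q N / (qfact q j * qfact q (N - j)) else 0)"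

lemma qfact_0 [simp]: "qfact q 0 = 1"
  and qfact_Suc: "qfact q (Suc n) = qfact q n * (1 - q ^ Suc n)"
  by (simp_all add: qfact_def)

lemma qfact_nz: "norm q < 1 \<Longrightarrow> qfact q n \<noteq> 0"
  using qpoch_factor_nz[of q] by (simp add: qfact_def)

text \<open>The q-Pascal rule has the coefficient q^(N-j); multiplying by q^j removes the
  subtraction. In the q-binomial theorem this q^j comes from the increment j of the binomial
  exponent.\<close>

lemma qbinom_Suc_Suc:
  assumes q: "norm q < 1" and j: "j \<le> N"
  shows "q ^ j * qbinom q (Suc N) (Suc j) = q ^ j * qbinom q N (Suc j) + q ^ N * qbinom q N j"
proof (cases "j = N")
  case True
  thus ?thesis using qfact_nz[OF q] by (simp add: qbinom_def)
next
  case False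
  define d where "d = N - Suc j"
  have N: "N = Suc (j + d)" using j False by (simp add: d_def)
  define x y z where "x = qfact q j" and "y = qfact q d" and "z = qfact q N"
  have nz: "x \<noteq> 0" "y \<noteq> 0" "z \<noteq> 0" "1 - q ^ Suc j \<noteq> 0" "1 - q ^ Suc d \<noteq> 0"
    using qfact_nz[OF q] qpoch_factor_nz[OF q] by (auto simp: x_def y_def z_def simp del: power_Suc)
  have 1: "qbinom q (Suc N) (Suc j) = z * (1 - q ^ Suc N) / (x * (1 - q ^ Suc j) * (y * (1 - q ^ Suc d)))"
    using N by (simp add: qbinom_def x_def y_def z_def qfact_Suc del: power_Suc)
  have 2: "qbinom q N (Suc j) = z / (x * (1 - q ^ Suc j) * y)"
    using N by (simp add: qbinom_def x_def y_def z_def qfact_Suc del: power_Suc)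
  have 3: "qbinom q N j = z / (x * (y * (1 - q ^ Suc d)))"
  proof -
    have "N - j = Suc d" using N by simp
    thus ?thesis using N by (simp add: qbinom_def x_def y_def z_def qfact_Suc del: power_Suc)
  qed
  have 4: "q ^ N = q ^ j * q ^ Suc d" "q ^ Suc N = q ^ Suc j * q ^ Suc d"
    by (simp_all add: N power_add)
  define a b where "a = q ^ Suc j" and "b = q ^ Suc d"
  show ?thesis using nz unfolding 1 2 3 4 a_def[symmetric] b_def[symmetric]
    by (simp add: divide_simps) (simp add: algebra_simps)
qed

lemma qbinomial_theorem:
  assumes q: "norm q < 1"
  shows "(\<Prod>k<N. 1 + y * q ^ k) = (\<Sum>j\<le>N. q ^ (j choose 2) * qbinom q N j * y ^ j)"
proof (induction N)
  case (Suc N)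
  let ?c = "\<lambda>N j. q ^ (j choose 2) * qbinom q N j"
  have step: "?c (Suc N) (Suc j) = ?c N (Suc j) + q ^ N * ?c N j" if "j \<le> N" for j
  proof -
    have "Suc j choose 2 = j + (j choose 2)" by (simp add: numeral_2_eq_2)
    moreover have "q ^ (j choose 2) * (q ^ j * qbinom q (Suc N) (Suc j)) =
        q ^ (j choose 2) * (q ^ j * qbinom q N (Suc j) + q ^ N * qbinom q N j)"
      by (simp only: qbinom_Suc_Suc[OF q that])
    ultimately show ?thesis by (simp add: power_add algebra_simps)
  qed
  let ?S = "\<Sum>j\<le>N. ?c N j * y ^ j"
  have shift: "(\<Sum>j\<le>Suc N. f j) = f 0 + (\<Sum>j\<le>N. f (Suc j))" for f :: "nat \<Rightarrow> complex"
    by (rule sum.atMost_Suc_shift)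
  have top: "?S = (\<Sum>j\<le>Suc N. ?c N j * y ^ j)"
    by (simp add: qbinom_def)
  have "(\<Prod>k<Suc N. 1 + y * q ^ k) = (1 + y * q ^ N) * ?S"
    unfolding prod.lessThan_Suc Suc.IH by (rule mult.commute)
  also have "\<dots> = ?S + q ^ N * y * ?S"
    by (simp only: distrib_right mult_1 mult.commute)
  also have "?S + q ^ N * y * ?S = ?c N 0 * y ^ 0 + (\<Sum>j\<le>N. ?c N (Suc j) * y ^ Suc j) + q ^ N * y * ?S"
    by (subst (1) top) (simp only: shift)
  also have "q ^ N * y * ?S = (\<Sum>j\<le>N. q ^ N * ?c N j * y ^ Suc j)"
    unfolding sum_distrib_left power_Suc by (intro sum.cong refl) (simp only: ac_simps)
  also have "?c N 0 * y ^ 0 + (\<Sum>j\<le>N. ?c N (Suc j) * y ^ Suc j) + (\<Sum>j\<le>N. q ^ N * ?c N j * y ^ Suc j)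
      = ?c N 0 * y ^ 0 + (\<Sum>j\<le>N. ?c (Suc N) (Suc j) * y ^ Suc j)"
    unfolding add.assoc sum.distrib[symmetric]
    by (intro arg_cong2[where f = "(+)"] refl sum.cong) (simp only: step atMost_iff distrib_right)
  also have "?c N 0 = ?c (Suc N) 0"
    using qfact_nz[OF q] by (simp add: qbinom_def)
  also have "?c (Suc N) 0 * y ^ 0 + (\<Sum>j\<le>N. ?c (Suc N) (Suc j) * y ^ Suc j) = (\<Sum>j\<le>Suc N. ?c (Suc N) j * y ^ j)"
    by (rule shift[symmetric])
  finally show ?case .
qed (simp add: qbinom_def numeral_2_eq_2)

text \<open>With Q = exp(2 \<pi> i \<tau>), each factor 1 - e^w Q^(-k) is -e^w Q^(-k) (1 - e^(-w)
  Q^k). The extracted monomials multiply up to the inverse of the prefactor, which converts negative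
  powers of Q into positive ones.\<close>

lemma gauss_prefactor:
  "sg (int n) * exp (of_real pi * \<i> * \<tau> * of_nat (n * Suc n) - of_nat n * w) *
     (\<Prod>k<n. 1 - exp (w - 2 * of_real pi * \<i> * \<tau> * of_nat (Suc k))) =
   (\<Prod>k<n. 1 - exp (- w) * exp (2 * of_real pi * \<i> * \<tau>) ^ Suc k)"
proof (induction n)
  case (Suc n)
  let ?E = "\<lambda>n. exp (of_real pi * \<i> * \<tau> * of_nat (n * Suc n) - of_nat n * w)"
  let ?x = "2 * of_real pi * \<i> * \<tau> * of_nat (Suc n)"
  have E: "?E (Suc n) = ?E n * exp (?x - w)"
    unfolding exp_add[symmetric] by (rule arg_cong[of _ _ exp]) (simp add: algebra_simps)
  have e1: "exp (?x - w) * (1 - exp (w - ?x)) = - (1 - exp (?x - w))"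
    by (simp add: right_diff_distrib flip: exp_add)
  have e2: "exp (?x - w) = exp (- w) * exp (2 * of_real pi * \<i> * \<tau>) ^ Suc n"
    by (simp only: exp_of_nat_mult[symmetric] exp_add[symmetric]) (simp add: algebra_simps)
  have e: "exp (?x - w) * (1 - exp (w - ?x)) = - (1 - exp (- w) * exp (2 * of_real pi * \<i> * \<tau>) ^ Suc n)"
    by (rule trans[OF e1]) (simp only: e2)
  have s: "sg (int (Suc n)) = - sg (int n)" by (simp add: sg_def)
  let ?P = "\<Prod>k<n. 1 - exp (w - 2 * of_real pi * \<i> * \<tau> * of_nat (Suc k))"
  have "sg (int (Suc n)) * ?E (Suc n) * (\<Prod>k<Suc n. 1 - exp (w - 2 * of_real pi * \<i> * \<tau> * of_nat (Suc k))) =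
     - (sg (int n) * ?E n * ?P) * (exp (?x - w) * (1 - exp (w - ?x)))"
    unfolding s E prod.lessThan_Suc by (simp only: ac_simps mult_minus_left mult_minus_right)
  also have "\<dots> = (\<Prod>k<Suc n. 1 - exp (- w) * exp (2 * of_real pi * \<i> * \<tau>) ^ Suc k)"
    unfolding Suc.IH e prod.lessThan_Suc by (simp only: minus_mult_minus)
  finally show ?case .
qed (simp add: sg_def)

text \<open>The finite form of the triple product is the q-binomial theorem of order 2 n, centred at
  its middle term.\<close>

lemma finite_triple_product:
  assumes \<tau>: "Im \<tau> > 0"
  defines "q \<equiv> exp (2 * of_real pi * \<i> * \<tau>)"
  shows "(\<Sum>j\<le>2 * n. qbinom q (2 * n) j * gauss_term sg (-1/2) 1 0 w \<tau> (int j - int n)) =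
     exp (of_real pi * \<i> * \<tau> / 4 - w / 2) * (\<Prod>k<n. 1 - exp w * q ^ k) * (\<Prod>k<n. 1 - exp (- w) * q ^ Suc k)"
proof -
  have q: "norm q < 1" using \<tau> by (simp add: q_def)
  \<comment> \<open>With this \<open>y\<close> the factors 1 + y q^k, k < 2 n, run through 1 - e^w
    q^j for j from -n to n - 1.\<close>
  define y where "y = - exp (w - 2 * of_real pi * \<i> * \<tau> * of_nat n)"
  define K where "K = exp (of_real pi * \<i> * \<tau> / 4 - w / 2) *
     (sg (int n) * exp (of_real pi * \<i> * \<tau> * of_nat (n * Suc n) - of_nat n * w))"
  have g: "gauss_term sg (-1/2) 1 0 w \<tau> (int j - int n) = K * q ^ (j choose 2) * y ^ j" for j
  proof -
    have c2: "2 * of_nat (j choose 2) = (of_nat j * (of_nat j - 1) :: complex)"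
      by (induction j) (simp_all add: numeral_2_eq_2 algebra_simps)
    have y: "y ^ j = sg (int j) * exp (of_nat j * (w - 2 * of_real pi * \<i> * \<tau> * of_nat n))"
      unfolding y_def by (subst power_minus) (simp add: sg_def exp_of_nat_mult)
    have "sg (int j - int n) = sg (int j) * sg (int n)" by (simp add: sg_def)
    hence "gauss_term sg (-1/2) 1 0 w \<tau> (int j - int n) = sg (int j) * sg (int n) *
       exp (of_real pi * \<i> * \<tau> * (of_nat j - of_nat n - 1/2)\<^sup>2 + (of_nat j - of_nat n - 1/2) * w)"
      by (simp add: gauss_term_def)
    also have "of_real pi * \<i> * \<tau> * (of_nat j - of_nat n - 1/2)\<^sup>2 + (of_nat j - of_nat n - 1/2) * w =
       (of_real pi * \<i> * \<tau> / 4 - w / 2) + (of_real pi * \<i> * \<tau> * of_nat (n * Suc n) - of_nat n * w)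
        + of_real pi * \<i> * \<tau> * (2 * of_nat (j choose 2))
        + of_nat j * (w - 2 * of_real pi * \<i> * \<tau> * of_nat n)"
      unfolding c2 by (simp add: power2_eq_square field_simps)
    also have "of_real pi * \<i> * \<tau> * (2 * of_nat (j choose 2)) = of_nat (j choose 2) * (2 * of_real pi * \<i> * \<tau>)"
      by simp
    finally show ?thesis
      unfolding K_def y q_def exp_add exp_of_nat_mult by (simp only: ac_simps)
  qed
  have half1: "(\<Prod>k<n. 1 + y * q ^ k) = (\<Prod>k<n. 1 - exp (w - 2 * of_real pi * \<i> * \<tau> * of_nat (Suc k)))"
  proof (subst prod.nat_diff_reindex[symmetric], rule prod.cong)
    fix k assume "k \<in> {..<n}"
    hence k: "of_nat n = (of_nat (n - Suc k) + of_nat (Suc k) :: complex)" 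
      by (subst of_nat_add[symmetric]) simp
    show "1 + y * q ^ (n - Suc k) = 1 - exp (w - 2 * of_real pi * \<i> * \<tau> * of_nat (Suc k))"
      unfolding y_def q_def exp_of_nat_mult[symmetric] k
      by (simp add: algebra_simps del: of_nat_Suc flip: exp_add)
  qed simp
  have half2: "(\<Prod>k<n. 1 + y * q ^ (n + k)) = (\<Prod>k<n. 1 - exp w * q ^ k)"
  proof (rule prod.cong)
    fix k
    have "exp (w - 2 * of_real pi * \<i> * \<tau> * of_nat n) * q ^ (n + k) = exp w * q ^ k"
      unfolding power_add q_def exp_of_nat_mult[symmetric] exp_add[symmetric] by (simp add: algebra_simps)
    thus "1 + y * q ^ (n + k) = 1 - exp w * q ^ k" by (simp add: y_def)
  qed simp
  have "(\<Sum>j\<le>2 * n. qbinom q (2 * n) j * gauss_term sg (-1/2) 1 0 w \<tau> (int j - int n)) =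
      K * (\<Sum>j\<le>2 * n. q ^ (j choose 2) * qbinom q (2 * n) j * y ^ j)"
    unfolding g sum_distrib_left by (intro sum.cong refl) (simp only: ac_simps)
  also have "\<dots> = K * (\<Prod>k<n + n. 1 + y * q ^ k)"
    by (simp add: qbinomial_theorem[OF q] mult_2)
  also have "(\<Prod>k<n + n. 1 + y * q ^ k) = (\<Prod>k<n. 1 + y * q ^ k) * (\<Prod>k<n. 1 + y * q ^ (n + k))"
  proof -
    have "{..<n + n} = {..<n} \<union> {n..<n + n}" by auto
    moreover have "(\<Prod>k\<in>{n..<n + n}. 1 + y * q ^ k) = (\<Prod>k<n. 1 + y * q ^ (n + k))"
      using prod.shift_bounds_nat_ivl[of "\<lambda>k. 1 + y * q ^ k" 0 n n] by (simp add: lessThan_atLeast0 add.commute)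
    ultimately show ?thesis by (simp add: prod.union_disjoint ivl_disj_int)
  qed
  also have "K * \<dots> = exp (of_real pi * \<i> * \<tau> / 4 - w / 2) * (\<Prod>k<n. 1 - exp w * q ^ k) * (\<Prod>k<n. 1 - exp (- w) * q ^ Suc k)"
    by (subst half1, subst half2, unfold K_def q_def gauss_prefactor[symmetric]) (simp only: ac_simps)
  finally show ?thesis .
qed

lemma qfact_tendsto: "norm q < 1 \<Longrightarrow> qfact q \<longlonglongrightarrow> qpoch 1 q"
  using qpoch_tendsto[of q 1] by (simp add: qfact_def[abs_def])

text \<open>The products \<open>qfact q n\<close> converge to a nonzero limit, so they and their
  inverses are bounded. Uniformity in both \<open>N\<close> and \<open>j\<close> is what the
  dominated limit of the finite triple product needs.\<close>

lemma qbinom_bounded: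
  assumes q: "norm q < 1"
  obtains K where "\<And>N j. norm (qbinom q N j) \<le> K" "K \<ge> 0"
proof -
  have "Bseq (qfact q)"
    using qfact_tendsto[OF q] by (intro convergent_imp_Bseq convergentI)
  then obtain A where A: "A > 0" "\<And>n. norm (qfact q n) \<le> A" by (auto simp: Bseq_def)
  have "(\<lambda>n. inverse (qfact q n)) \<longlonglongrightarrow> inverse (qpoch 1 q)"
    by (intro tendsto_inverse qfact_tendsto q qpoch_1_nz)
  hence "Bseq (\<lambda>n. inverse (qfact q n))"
    by (intro convergent_imp_Bseq convergentI)
  then obtain B where B: "B > 0" "\<And>n. norm (inverse (qfact q n)) \<le> B" by (auto simp: Bseq_def)
  have "norm (qbinom q N j) \<le> A * (B * B)" for N j
  proof (cases "j \<le> N")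
    case True
    have "norm (qbinom q N j) = norm (qfact q N) * (norm (inverse (qfact q j)) * norm (inverse (qfact q (N - j))))"
      using True by (simp add: qbinom_def norm_mult norm_divide norm_inverse field_simps)
    also have "\<dots> \<le> A * (B * B)"
      using A B by (intro mult_mono) auto
    finally show ?thesis .
  qed (use A B in \<open>auto simp: qbinom_def\<close>)
  thus ?thesis using that[of "A * (B * B)"] A B by simp
qed

lemma qbinom_tendsto:
  assumes q: "norm q < 1"
  shows "(\<lambda>n. qbinom q (2 * n) (nat (m + int n))) \<longlonglongrightarrow> 1 / qpoch 1 q"
proof -
  have F: "filterlim (\<lambda>n. nat (k + int n)) at_top sequentially" for k
    unfolding filterlim_at_top eventually_sequentially
  proof
    fix Z show "\<exists>N. \<forall>n\<ge>N. Z \<le> nat (k + int n)"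
      by (rule exI[of _ "Z + nat (-k)"]) auto
  qed
  have F2: "filterlim (\<lambda>n. 2 * n) at_top (sequentially :: nat filter)"
    by (intro mult_nat_left_at_top) auto
  note L = filterlim_compose[OF qfact_tendsto[OF q]]
  have "(\<lambda>n. qfact q (2 * n) / (qfact q (nat (m + int n)) * qfact q (nat (- m + int n)))) \<longlonglongrightarrow>
      qpoch 1 q / (qpoch 1 q * qpoch 1 q)"
    by (intro tendsto_divide tendsto_mult L F F2) (use qpoch_1_nz[OF q] in auto)
  moreover have "\<forall>\<^sub>F n in sequentially. qbinom q (2 * n) (nat (m + int n)) =
     qfact q (2 * n) / (qfact q (nat (m + int n)) * qfact q (nat (- m + int n)))"
    using eventually_ge_at_top[of "nat \<bar>m\<bar>"]
  proof eventually_elim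
    case (elim n)
    have "2 * n - nat (m + int n) = nat (- m + int n)" "nat (m + int n) \<le> 2 * n" using elim by auto
    thus ?case by (simp add: qbinom_def)
  qed
  ultimately show ?thesis using qpoch_1_nz[OF q] by (simp add: tendsto_cong)
qed

text \<open>Tannery's theorem: for a fixed position relative to the centre the Gaussian binomials
  tend to 1 over the Euler product, and their uniform bound times the Gaussian terms is a summable
  majorant. \<open>T\<close> extends the finite sums by zero to all integers.\<close>

lemma triple_product_sum:
  assumes \<tau>: "Im \<tau> > 0"
  defines "q \<equiv> exp (2 * of_real pi * \<i> * \<tau>)"
  shows "(\<lambda>n. \<Sum>j\<le>2 * n. qbinom q (2 * n) j * gauss_term sg (-1/2) 1 0 w \<tau> (int j - int n))
     \<longlonglongrightarrow> theta 0 w \<tau> / qpoch 1 q"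
proof -
  have q: "norm q < 1" using \<tau> by (simp add: q_def)
  obtain K where K: "\<And>N j. norm (qbinom q N j) \<le> K" "K \<ge> 0" using qbinom_bounded[OF q] by blast
  let ?g = "gauss_term sg (-1/2) 1 0 w \<tau>"
  define T where "T n m = (if \<bar>m\<bar> \<le> int n then qbinom q (2 * n) (nat (m + int n)) * ?g m else 0)" for n m
  have sg: "(\<lambda>n. norm (?g n)) summable_on UNIV"
    by (rule gauss_term_abs_summable) (use \<tau> in auto)
  have T_le: "norm (T n m) \<le> K * norm (?g m)" for n m
    using K by (auto simp: T_def norm_mult intro!: mult_right_mono)
  have sK: "(\<lambda>m. K * norm (?g m)) summable_on UNIV"
    by (intro summable_on_cmult_right sg)
  have sT: "(\<lambda>m. norm (T n m)) summable_on UNIV" for n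
    by (rule Infinite_Sum.abs_summable_on_comparison_test'[OF sK]) (rule T_le)
  have Tsum: "(\<Sum>j\<le>2 * n. qbinom q (2 * n) j * ?g (int j - int n)) = (\<Sum>k. T n (int_decode k))" for n
  proof -
    have "(\<Sum>j\<le>2 * n. qbinom q (2 * n) j * ?g (int j - int n)) = (\<Sum>m\<in>{-int n..int n}. T n m)"
      by (rule sum.reindex_bij_witness[of _ "\<lambda>m. nat (m + int n)" "\<lambda>j. int j - int n"]) (auto simp: T_def)
    also have "\<dots> = infsum (T n) {-int n..int n}" by simp
    also have "\<dots> = infsum (T n) UNIV"
      by (rule infsum_cong_neutral) (auto simp: T_def)
    also have "\<dots> = (\<Sum>k. T n (int_decode k))"
      using infsum_int_conv_suminf[OF sT] by (rule sums_unique)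
    finally show ?thesis .
  qed
  have "((\<lambda>n. \<Sum>k. T n (int_decode k)) \<longlongrightarrow> (\<Sum>k. ?g (int_decode k) * (1 / qpoch 1 q))) sequentially"
  proof (rule tannerys_theorem[THEN conjunct2, THEN conjunct2])
    show "(\<lambda>n. T n (int_decode k)) \<longlonglongrightarrow> ?g (int_decode k) * (1 / qpoch 1 q)" for k
    proof -
      have "(\<lambda>n. ?g (int_decode k) * qbinom q (2 * n) (nat (int_decode k + int n))) \<longlonglongrightarrow> ?g (int_decode k) * (1 / qpoch 1 q)"
        by (intro tendsto_mult tendsto_const qbinom_tendsto q)
      moreover have "\<forall>\<^sub>F n in sequentially. T n (int_decode k) = ?g (int_decode k) * qbinom q (2 * n) (nat (int_decode k + int n))"
        using eventually_ge_at_top[of "nat \<bar>int_decode k\<bar>"] by eventually_elim (auto simp: T_def)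
      ultimately show ?thesis by (simp add: tendsto_cong)
    qed
    show "\<forall>\<^sub>F (k, n) in at_top \<times>\<^sub>F sequentially. norm (T n (int_decode k)) \<le> K * norm (?g (int_decode k))"
      using T_le by (intro always_eventually) auto
    show "summable (\<lambda>k. K * norm (?g (int_decode k)))"
      using sK by (intro summable_on_imp_summable)
        (rule iffD2[OF summable_on_reindex_bij_betw[OF bij_int_decode, of "\<lambda>m. K * norm (?g m)"]])
  qed simp
  also have "(\<Sum>k. ?g (int_decode k) * (1 / qpoch 1 q)) = theta 0 w \<tau> / qpoch 1 q"
  proof -
    have "(\<lambda>k. ?g (int_decode k)) sums theta 0 w \<tau>"
      unfolding theta_def gauss_sum_def by (rule infsum_int_conv_suminf[OF sg])
    from sums_mult2[OF this, of "1 / qpoch 1 q"] show ?thesis by (simp add: sums_iff)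
  qed
  finally show ?thesis by (simp only: Tsum)
qed

theorem jacobi_triple_product:
  assumes \<tau>: "Im \<tau> > 0"
  defines "q \<equiv> exp (2 * of_real pi * \<i> * \<tau>)"
  shows "theta 0 w \<tau> = exp (of_real pi * \<i> * \<tau> / 4) * (exp (- w / 2) - exp (w / 2)) *
     (qpoch 1 q * qpoch (exp w) q * qpoch (exp (- w)) q)"
proof -
  have q: "norm q < 1" using \<tau> by (simp add: q_def)
  let ?F = "\<lambda>n. \<Sum>j\<le>2 * n. qbinom q (2 * n) j * gauss_term sg (-1/2) 1 0 w \<tau> (int j - int n)"
  \<comment> \<open>Splitting off the factor k = 0 exposes the zero at w = 0: with exp(-w/2) it
    becomes exp(-w/2) - exp(w/2). The passage to \<open>Suc n\<close> guarantees that this factor is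
    present.\<close>
  have "(\<Prod>k<Suc n. 1 - exp w * q ^ k) = (1 - exp w) * (\<Prod>k<n. 1 - exp w * q ^ Suc k)" for n
    by (subst prod.lessThan_Suc_shift) simp
  hence "?F (Suc n) = exp (of_real pi * \<i> * \<tau> / 4 - w / 2) * ((1 - exp w) * (\<Prod>k<n. 1 - exp w * q ^ Suc k)) *
      (\<Prod>k<Suc n. 1 - exp (- w) * q ^ Suc k)" for n
    unfolding q_def finite_triple_product[OF \<tau>] by simp
  moreover have "(\<lambda>n. exp (of_real pi * \<i> * \<tau> / 4 - w / 2) * ((1 - exp w) * (\<Prod>k<n. 1 - exp w * q ^ Suc k)) *
      (\<Prod>k<Suc n. 1 - exp (- w) * q ^ Suc k)) \<longlonglongrightarrow>
     exp (of_real pi * \<i> * \<tau> / 4 - w / 2) * ((1 - exp w) * qpoch (exp w) q) * qpoch (exp (- w)) q"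
    by (intro tendsto_mult tendsto_const qpoch_tendsto[OF q] LIMSEQ_Suc)
  ultimately have "(\<lambda>n. ?F (Suc n)) \<longlonglongrightarrow>
     exp (of_real pi * \<i> * \<tau> / 4 - w / 2) * ((1 - exp w) * qpoch (exp w) q) * qpoch (exp (- w)) q"
    by presburger
  moreover have "(\<lambda>n. ?F (Suc n)) \<longlonglongrightarrow> theta 0 w \<tau> / qpoch 1 q"
    unfolding q_def by (rule LIMSEQ_Suc[OF triple_product_sum[OF \<tau>]])
  ultimately have "theta 0 w \<tau> / qpoch 1 q =
     exp (of_real pi * \<i> * \<tau> / 4 - w / 2) * ((1 - exp w) * qpoch (exp w) q) * qpoch (exp (- w)) q"
    using LIMSEQ_unique by blast
  moreover define X where "X = exp (of_real pi * \<i> * \<tau> / 4 - w / 2)"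
  have X: "X * (1 - exp w) =
      exp (of_real pi * \<i> * \<tau> / 4) * (exp (- w / 2) - exp (w / 2))"
    by (simp add: X_def right_diff_distrib field_simps flip: exp_add)
  ultimately have "theta 0 w \<tau> = X * ((1 - exp w) * qpoch (exp w) q) * qpoch (exp (- w)) q * qpoch 1 q"
    by (simp only: nonzero_divide_eq_eq[OF qpoch_1_nz[OF q]] X_def)
  also have "\<dots> = X * (1 - exp w) * (qpoch 1 q * qpoch (exp w) q * qpoch (exp (- w)) q)"
    by (simp only: ac_simps)
  finally show ?thesis by (simp only: X)
qed

lemma dedekind_eta_eq: "dedekind_eta \<tau> = exp (of_real pi * \<i> * \<tau> / 12) * qpoch 1 (exp (2 * of_real pi * \<i> * \<tau>))"
  unfolding dedekind_eta_def qpoch_def exp_of_nat_mult[symmetric] by (simp add: algebra_simps)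

text \<open>Factorwise this is (1 - x)(1 - \<omega> x)(1 - \<omega>^2 x) = 1 - x^3 for the primitive
  cube root of unity \<omega> = exp \<open>w3\<close>.\<close>

lemma qpoch_cube_roots:
  assumes q: "norm q < 1"
  shows "qpoch 1 q * qpoch (exp w3) q * qpoch (exp (- w3)) q = qpoch 1 (q ^ 3)"
proof -
  have e: "exp w3 = Complex (-1/2) (sqrt 3 / 2)" "exp (- w3) = Complex (-1/2) (- sqrt 3 / 2)"
    using cos_120 sin_120 by (simp_all add: complex_eq_iff Re_exp Im_exp)
  have "(1 - x) * (1 - exp w3 * x) * (1 - exp (- w3) * x) = 1 - x ^ 3" for x
  proof -
    have "exp w3 + exp (- w3) = - 1" "exp w3 * exp (- w3) = 1"
      by (simp_all add: e complex_eq_iff flip: exp_add)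
    thus ?thesis by algebra
  qed
  hence "(1 - 1 * q ^ Suc n) * (1 - exp w3 * q ^ Suc n) * (1 - exp (- w3) * q ^ Suc n) = 1 - 1 * (q ^ 3) ^ Suc n" for n
    by (simp add: power_mult[symmetric] mult.commute del: power_Suc)
  moreover have "(\<lambda>n. (1 - 1 * q ^ Suc n) * (1 - exp w3 * q ^ Suc n) * (1 - exp (- w3) * q ^ Suc n)) has_prod
      (qpoch 1 q * qpoch (exp w3) q * qpoch (exp (- w3)) q)"
    by (intro has_prod_mult qpoch_has_prod q)
  ultimately have "(\<lambda>n. 1 - 1 * (q ^ 3) ^ Suc n) has_prod (qpoch 1 q * qpoch (exp w3) q * qpoch (exp (- w3)) q)"
    by presburger
  moreover have "norm (q ^ 3) < 1" using q by (simp add: norm_power power_less_one_iff)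
  ultimately show ?thesis using qpoch_has_prod has_prod_unique2 by blast
qed

text \<open>At \<open>w3\<close> the outer difference in the triple product is -2 i sin(\<pi>/3),
  the three infinite products combine by the cube roots of unity, and exp(\<pi> i \<tau> / 4) is the
  exponential prefactor of \<eta>(3\<tau>).\<close>

lemma theta_0_torsion:
  assumes \<tau>: "Im \<tau> > 0"
  shows "theta 0 w3 \<tau> = - \<i> * sqrt 3 * dedekind_eta (3 * \<tau>)"
proof -
  have "exp (- w3 / 2) - exp (w3 / 2) = - \<i> * sqrt 3"
    using sin_60 cos_60 by (simp add: complex_eq_iff Re_exp Im_exp)
  moreover have "exp (2 * of_real pi * \<i> * (3 * \<tau>)) = exp (2 * of_real pi * \<i> * \<tau>) ^ 3"
    by (simp add: algebra_simps flip: exp_of_nat_mult)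
  ultimately show ?thesis
    using \<tau> unfolding jacobi_triple_product[OF \<tau>]
    by (subst qpoch_cube_roots) (simp_all add: dedekind_eta_eq mult_ac)
qed

text \<open>As theta vanishes at w = 0, its derivative is the limit of theta(w)/w, which the triple
  product evaluates: the simple zero yields -1 and the infinite products become the cube of the
  Euler product.\<close>

lemma theta_1_0:
  assumes \<tau>: "Im \<tau> > 0"
  shows "theta 1 0 \<tau> = - (dedekind_eta \<tau> ^ 3)"
proof -
  define q where "q = exp (2 * of_real pi * \<i> * \<tau>)"
  have q: "norm q < 1" using \<tau> by (simp add: q_def)
  let ?E = "exp (of_real pi * \<i> * \<tau> / 4)"
  let ?A = "\<lambda>w. exp (- w / 2) - exp (w / 2) :: complex"
  let ?B = "\<lambda>w. qpoch 1 q * qpoch (exp w) q * qpoch (exp (- w)) q"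
  have "((\<lambda>w. theta 0 w \<tau>) has_field_derivative theta 1 0 \<tau>) (at 0)"
    unfolding theta_def One_nat_def by (rule gauss_sum_deriv_w) (use \<tau> in auto)
  hence "(\<lambda>w. (theta 0 w \<tau> - theta 0 0 \<tau>) / (w - 0)) \<midarrow>0\<rightarrow> theta 1 0 \<tau>"
    by (simp add: has_field_derivative_iff)
  hence 1: "(\<lambda>w. ?E * (?A w / w) * ?B w) \<midarrow>0\<rightarrow> theta 1 0 \<tau>"
    by (simp add: theta_even_0) (simp add: jacobi_triple_product[OF \<tau>] q_def)
  have "(?A has_field_derivative -1) (at 0)"
    by (auto intro!: derivative_eq_intros)
  hence "(\<lambda>w. ?A w / w) \<midarrow>0\<rightarrow> -1"
    by (simp add: has_field_derivative_iff)
  moreover have "isCont (\<lambda>w. qpoch (exp w) q) 0" "isCont (\<lambda>w. qpoch (exp (- w)) q) 0"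
    using isCont_o2[of 0 exp "\<lambda>x. qpoch x q"] isCont_o2[of 0 "\<lambda>w. exp (- w)" "\<lambda>x. qpoch x q"] continuous_qpoch[OF q]
    by (auto intro!: continuous_intros)
  hence "(\<lambda>w. qpoch (exp w) q) \<midarrow>0\<rightarrow> qpoch 1 q" "(\<lambda>w. qpoch (exp (- w)) q) \<midarrow>0\<rightarrow> qpoch 1 q"
    by (auto simp: isCont_def)
  ultimately have "(\<lambda>w. ?E * (?A w / w) * ?B w) \<midarrow>0\<rightarrow> ?E * (-1) * (qpoch 1 q * qpoch 1 q * qpoch 1 q)"
    by (intro tendsto_mult tendsto_const)
  hence "theta 1 0 \<tau> = ?E * (-1) * (qpoch 1 q * qpoch 1 q * qpoch 1 q)"
    using 1 LIM_unique by blast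
  moreover have "?E = exp (of_real pi * \<i> * \<tau> / 12) ^ 3"
    by (simp add: mult_ac flip: exp_of_nat_mult)
  ultimately show ?thesis
    by (simp add: dedekind_eta_eq q_def power_mult_distrib power3_eq_cube)
qed

lemma theta3_1_0: "Im \<tau> > 0 \<Longrightarrow> theta3 1 0 \<tau> = - 3 * dedekind_eta (3 * \<tau>) ^ 3"
  using theta_1_0[of "3 * \<tau>"] by (subst theta3_1_eq) simp

section \<open>The differential system of level 3\<close>

text \<open>The derivation $q\, d/dq$ in terms of \<open>\<tau>\<close>, where $q = e^{2 \pi i \tau}$.\<close>
definition has_qderiv :: "(complex \<Rightarrow> complex) \<Rightarrow> complex \<Rightarrow> complex \<Rightarrow> bool" where
  "has_qderiv f d \<tau> \<longleftrightarrow> (f has_field_derivative 2 * of_real pi * \<i> * d) (at \<tau>)"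

lemma has_qderiv_unique: "has_qderiv f d \<tau> \<Longrightarrow> has_qderiv f d' \<tau> \<Longrightarrow> d = d'"
  unfolding has_qderiv_def by (drule (1) DERIV_unique) simp

lemma has_qderiv_const: "has_qderiv (\<lambda>_. c) 0 \<tau>"
  unfolding has_qderiv_def by (auto intro!: derivative_eq_intros)

lemma has_qderiv_add: "has_qderiv f a \<tau> \<Longrightarrow> has_qderiv g b \<tau> \<Longrightarrow> has_qderiv (\<lambda>x. f x + g x) (a + b) \<tau>"
  unfolding has_qderiv_def by (rule DERIV_cong[OF DERIV_add], assumption+) (simp add: distrib_left)

lemma has_qderiv_diff: "has_qderiv f a \<tau> \<Longrightarrow> has_qderiv g b \<tau> \<Longrightarrow> has_qderiv (\<lambda>x. f x - g x) (a - b) \<tau>"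
  unfolding has_qderiv_def by (rule DERIV_cong[OF DERIV_diff], assumption+) (simp add: right_diff_distrib)

lemma has_qderiv_mult:
  "has_qderiv f a \<tau> \<Longrightarrow> has_qderiv g b \<tau> \<Longrightarrow> has_qderiv (\<lambda>x. f x * g x) (a * g \<tau> + f \<tau> * b) \<tau>"
  unfolding has_qderiv_def by (rule DERIV_cong[OF DERIV_mult], assumption+) (simp add: distrib_left mult_ac)

lemma has_qderiv_cmult: "has_qderiv f a \<tau> \<Longrightarrow> has_qderiv (\<lambda>x. c * f x) (c * a) \<tau>"
  using has_qderiv_mult[OF has_qderiv_const, of f a \<tau> c] by simp

lemma has_qderiv_power: "has_qderiv f a \<tau> \<Longrightarrow> has_qderiv (\<lambda>x. f x ^ n) (of_nat n * f \<tau> ^ (n - 1) * a) \<tau>"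
  unfolding has_qderiv_def by (rule DERIV_cong[OF DERIV_power], assumption) (simp add: mult_ac)

lemma has_qderiv_divide:
  "has_qderiv f a \<tau> \<Longrightarrow> has_qderiv g b \<tau> \<Longrightarrow> g \<tau> \<noteq> 0 \<Longrightarrow>
     has_qderiv (\<lambda>x. f x / g x) ((a * g \<tau> - f \<tau> * b) / (g \<tau>)\<^sup>2) \<tau>"
  unfolding has_qderiv_def
  by (rule DERIV_cong[OF DERIV_divide], assumption+) (simp add: power2_eq_square right_diff_distrib mult_ac)

lemma has_qderiv_scale: "has_qderiv f a (c * \<tau>) \<Longrightarrow> has_qderiv (\<lambda>x. f (c * x)) (c * a) \<tau>"
  unfolding has_qderiv_def
  using DERIV_chain2[of f "2 * of_real pi * \<i> * a" "\<lambda>x. c * x" \<tau> c UNIV, OF _ DERIV_cmult_Id]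
  by (simp add: mult_ac)

lemma has_qderiv_cong:
  assumes "has_qderiv f a \<tau>" "Im \<tau> > 0" "\<And>x. Im x > 0 \<Longrightarrow> f x = g x"
  shows "has_qderiv g a \<tau>"
  unfolding has_qderiv_def
proof (rule has_field_derivative_transform_within_open[where S = "{x. Im x > 0}"])
  show "(f has_field_derivative 2 * of_real pi * \<i> * a) (at \<tau>)"
    using assms(1) by (simp only: has_qderiv_def)
qed (use assms(2,3) in \<open>auto simp: open_halfspace_Im_gt\<close>)

lemma theta_qderiv: "Im \<tau> > 0 \<Longrightarrow> has_qderiv (theta k w) (theta (k + 2) w \<tau> / 2) \<tau>"
  unfolding has_qderiv_def theta_def
  using gauss_sum_deriv_tau[of sg 1 \<tau> "-1/2" k w] by (simp add: mult_ac)

lemma theta3_qderiv: "Im \<tau> > 0 \<Longrightarrow> has_qderiv (theta3 k w) (theta3 (k + 2) w \<tau> / 6) \<tau>"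
  unfolding has_qderiv_def theta3_def
  using gauss_sum_deriv_tau[of "\<lambda>n. if 3 dvd n then sg n else 0" "1/3" \<tau> "-3/2" k w] by (simp add: mult_ac)

lemma theta3'_qderiv: "Im \<tau> > 0 \<Longrightarrow> has_qderiv (theta3' k w) (theta3' (k + 2) w \<tau> / 6) \<tau>"
  unfolding has_qderiv_def theta3'_def
  using gauss_sum_deriv_tau[of "\<lambda>n. if 3 dvd n then 0 else sg n" "1/3" \<tau> "-3/2" k w] by (simp add: mult_ac)

lemma theta_deriv: "Im \<tau> > 0 \<Longrightarrow> ((\<lambda>w. theta k w \<tau>) has_field_derivative theta (Suc k) w \<tau>) (at w)"
  unfolding theta_def by (rule gauss_sum_deriv_w) auto

lemma theta3_deriv: "Im \<tau> > 0 \<Longrightarrow> ((\<lambda>w. theta3 k w \<tau>) has_field_derivative theta3 (Suc k) w \<tau>) (at w)"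
  unfolding theta3_def by (rule gauss_sum_deriv_w) auto

lemma theta3'_deriv: "Im \<tau> > 0 \<Longrightarrow> ((\<lambda>w. theta3' k w \<tau>) has_field_derivative theta3' (Suc k) w \<tau>) (at w)"
  unfolding theta3'_def by (rule gauss_sum_deriv_w) auto

definition cubic_a_tau :: "complex \<Rightarrow> complex" where
  "cubic_a_tau \<tau> = cubic_a (exp (2 * of_real pi * \<i> * \<tau>))"

text \<open>The identity r = t^3 holds for all w, so it may be differentiated repeatedly; the
  coefficients are those of the Leibniz rule for a cube.\<close>

lemma cube_derivs:
  fixes t r :: "nat \<Rightarrow> complex \<Rightarrow> complex"
  assumes t: "\<And>k w. (t k has_field_derivative t (Suc k) w) (at w)"
    and r: "\<And>k w. (r k has_field_derivative r (Suc k) w) (at w)"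
    and 0: "\<And>w. r 0 w = t 0 w ^ 3"
  shows "r 1 w = 3 * t 0 w ^ 2 * t 1 w"
    and "r 2 w = 6 * t 0 w * t 1 w ^ 2 + 3 * t 0 w ^ 2 * t 2 w"
    and "r 3 w = 6 * t 1 w ^ 3 + 18 * t 0 w * t 1 w * t 2 w + 3 * t 0 w ^ 2 * t 3 w"
    and "r 4 w = 36 * t 1 w ^ 2 * t 2 w + 18 * t 0 w * t 2 w ^ 2 + 24 * t 0 w * t 1 w * t 3 w + 3 * t 0 w ^ 2 * t 4 w"
    and "r 5 w = 90 * t 1 w * t 2 w ^ 2 + 60 * t 1 w ^ 2 * t 3 w + 60 * t 0 w * t 2 w * t 3 w
           + 30 * t 0 w * t 1 w * t 4 w + 3 * t 0 w ^ 2 * t 5 w"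
proof -
  have next_deriv: "r (Suc k) w = P' w" if "\<And>w. r k w = P w" "\<And>w. (P has_field_derivative P' w) (at w)" for k P P' w
  proof -
    have "r k = P" using that(1) by (rule ext)
    thus ?thesis using r[of k w] that(2)[of w] by (auto intro: DERIV_unique)
  qed
  have t': "(t 0 has_field_derivative t 1 w) (at w)" "(t 1 has_field_derivative t 2 w) (at w)"
    "(t 2 has_field_derivative t 3 w) (at w)" "(t 3 has_field_derivative t 4 w) (at w)"
    "(t 4 has_field_derivative t 5 w) (at w)" for w
    using t[of 0 w] t[of 1 w] t[of 2 w] t[of 3 w] t[of 4 w] by (simp_all add: eval_nat_numeral)
  have Suc: "Suc 0 = 1" "Suc 1 = 2" "Suc 2 = 3" "Suc 3 = 4" "Suc 4 = 5" by simp_all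
  note ring = power2_eq_square power3_eq_cube algebra_simps
  have 1: "r 1 w = 3 * t 0 w ^ 2 * t 1 w" for w
    by (rule next_deriv[OF 0, unfolded Suc]) (auto intro!: derivative_eq_intros t' simp: ring simp del: One_nat_def)
  have 2: "r 2 w = 6 * t 0 w * t 1 w ^ 2 + 3 * t 0 w ^ 2 * t 2 w" for w
    by (rule next_deriv[OF 1, unfolded Suc]) (auto intro!: derivative_eq_intros t' simp: ring simp del: One_nat_def)
  have 3: "r 3 w = 6 * t 1 w ^ 3 + 18 * t 0 w * t 1 w * t 2 w + 3 * t 0 w ^ 2 * t 3 w" for w
    by (rule next_deriv[OF 2, unfolded Suc]) (auto intro!: derivative_eq_intros t' simp: ring simp del: One_nat_def)
  have 4: "r 4 w = 36 * t 1 w ^ 2 * t 2 w + 18 * t 0 w * t 2 w ^ 2 + 24 * t 0 w * t 1 w * t 3 w + 3 * t 0 w ^ 2 * t 4 w" for w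
    by (rule next_deriv[OF 3, unfolded Suc]) (auto intro!: derivative_eq_intros t' simp: ring simp del: One_nat_def)
  have 5: "r 5 w = 90 * t 1 w * t 2 w ^ 2 + 60 * t 1 w ^ 2 * t 3 w + 60 * t 0 w * t 2 w * t 3 w
           + 30 * t 0 w * t 1 w * t 4 w + 3 * t 0 w ^ 2 * t 5 w" for w
    by (rule next_deriv[OF 4, unfolded Suc]) (auto intro!: derivative_eq_intros t' simp: ring simp del: One_nat_def)
  show "r 1 w = 3 * t 0 w ^ 2 * t 1 w"
    and "r 2 w = 6 * t 0 w * t 1 w ^ 2 + 3 * t 0 w ^ 2 * t 2 w"
    and "r 3 w = 6 * t 1 w ^ 3 + 18 * t 0 w * t 1 w * t 2 w + 3 * t 0 w ^ 2 * t 3 w"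
    and "r 4 w = 36 * t 1 w ^ 2 * t 2 w + 18 * t 0 w * t 2 w ^ 2 + 24 * t 0 w * t 1 w * t 3 w + 3 * t 0 w ^ 2 * t 4 w"
    and "r 5 w = 90 * t 1 w * t 2 w ^ 2 + 60 * t 1 w ^ 2 * t 3 w + 60 * t 0 w * t 2 w * t 3 w
           + 30 * t 0 w * t 1 w * t 4 w + 3 * t 0 w ^ 2 * t 5 w"
    by (rule 1 2 3 4 5)+
qed

text \<open>By parity only odd orders carry information at 0, whereas at \<open>w3\<close> the even
  orders remove the series multiplied by \<open>A\<close>. In order 1 at \<open>w3\<close> both
  series survive; halving of \<open>theta3' 1\<close> at \<open>w3\<close> and the order 1 relation
  at 0 eliminate \<open>c\<close>, whence the factor -3/2.\<close>

lemma theta_cubed_taylor: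
  fixes \<tau> :: complex
  assumes \<tau>: "Im \<tau> > 0"
  defines "A \<equiv> cubic_a_tau \<tau>" and "c \<equiv> coset_theta 1 \<tau>"
  shows "A * theta3 1 0 \<tau> + c * theta3' 1 0 \<tau> = 0"
    and "A * theta3 3 0 \<tau> + c * theta3' 3 0 \<tau> = 6 * theta 1 0 \<tau> ^ 3"
    and "A * theta3 5 0 \<tau> + c * theta3' 5 0 \<tau> = 60 * theta 1 0 \<tau> ^ 2 * theta 3 0 \<tau>"
    and "c * theta3' 0 w3 \<tau> = theta 0 w3 \<tau> ^ 3"
    and "- (3 / 2) * A * theta3 1 0 \<tau> = 3 * theta 0 w3 \<tau> ^ 2 * theta 1 w3 \<tau>"
    and "c * theta3' 2 w3 \<tau> = 6 * theta 0 w3 \<tau> * theta 1 w3 \<tau> ^ 2 + 3 * theta 0 w3 \<tau> ^ 2 * theta 2 w3 \<tau>"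
    and "c * theta3' 4 w3 \<tau> = 36 * theta 1 w3 \<tau> ^ 2 * theta 2 w3 \<tau> + 18 * theta 0 w3 \<tau> * theta 2 w3 \<tau> ^ 2
           + 24 * theta 0 w3 \<tau> * theta 1 w3 \<tau> * theta 3 w3 \<tau> + 3 * theta 0 w3 \<tau> ^ 2 * theta 4 w3 \<tau>"
proof -
  define t where "t k w = theta k w \<tau>" for k w
  define r where "r k w = A * theta3 k w \<tau> + c * theta3' k w \<tau>" for k w
  have dt: "(t k has_field_derivative t (Suc k) w) (at w)" for k w
    unfolding t_def by (rule theta_deriv[OF \<tau>])
  have dr: "(r k has_field_derivative r (Suc k) w) (at w)" for k w
    unfolding r_def by (auto intro!: derivative_eq_intros theta3_deriv theta3'_deriv \<tau>)
  have 0: "r 0 w = t 0 w ^ 3" for w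
    unfolding r_def t_def A_def c_def cubic_a_tau_def theta_cubed[OF \<tau>] by simp
  note D = cube_derivs[of t r, OF dt dr 0, unfolded t_def r_def]
  have e: "theta 0 0 \<tau> = 0" "theta 2 0 \<tau> = 0" "theta 4 0 \<tau> = 0"
    "theta3 0 w3 \<tau> = 0" "theta3 2 w3 \<tau> = 0" "theta3 4 w3 \<tau> = 0" "theta3 1 w3 \<tau> = - theta3 1 0 \<tau>"
    unfolding theta3_torsion by (simp_all add: theta_even_0 theta3_even_0)
  have x: "theta3' 1 w3 \<tau> = theta3' 1 0 \<tau> / 2"
    using theta3'_1_torsion[OF \<tau>] by (simp add: mult.commute)
  show 1: "A * theta3 1 0 \<tau> + c * theta3' 1 0 \<tau> = 0"
    using D(1)[of 0] by (simp only: e) simp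
  show "A * theta3 3 0 \<tau> + c * theta3' 3 0 \<tau> = 6 * theta 1 0 \<tau> ^ 3"
    using D(3)[of 0] by (simp only: e) simp
  show "A * theta3 5 0 \<tau> + c * theta3' 5 0 \<tau> = 60 * theta 1 0 \<tau> ^ 2 * theta 3 0 \<tau>"
    using D(5)[of 0] by (simp only: e) simp
  show "c * theta3' 0 w3 \<tau> = theta 0 w3 \<tau> ^ 3"
    using 0[of w3, unfolded t_def r_def] by (simp only: e) simp
  have "- A * theta3 1 0 \<tau> + c * theta3' 1 0 \<tau> / 2 = 3 * theta 0 w3 \<tau> ^ 2 * theta 1 w3 \<tau>"
    using D(1)[of w3] by (simp only: e x) simp
  thus "- (3 / 2) * A * theta3 1 0 \<tau> = 3 * theta 0 w3 \<tau> ^ 2 * theta 1 w3 \<tau>"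
    using 1 by algebra
  show "c * theta3' 2 w3 \<tau> = 6 * theta 0 w3 \<tau> * theta 1 w3 \<tau> ^ 2 + 3 * theta 0 w3 \<tau> ^ 2 * theta 2 w3 \<tau>"
    using D(2)[of w3] by (simp only: e) simp
  show "c * theta3' 4 w3 \<tau> = 36 * theta 1 w3 \<tau> ^ 2 * theta 2 w3 \<tau> + 18 * theta 0 w3 \<tau> * theta 2 w3 \<tau> ^ 2
           + 24 * theta 0 w3 \<tau> * theta 1 w3 \<tau> * theta 3 w3 \<tau> + 3 * theta 0 w3 \<tau> ^ 2 * theta 4 w3 \<tau>"
    using D(4)[of w3] by (simp only: e) simp
qed

section \<open>Logarithmic derivatives of the eta function\<close>

lemma norm_nome_less_1: "Im \<tau> > 0 \<Longrightarrow> norm (exp (2 * of_real pi * \<i> * \<tau>)) < 1"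
  by simp

lemma dedekind_eta_nz: "Im \<tau> > 0 \<Longrightarrow> dedekind_eta \<tau> \<noteq> 0"
  unfolding dedekind_eta_eq using qpoch_1_nz[OF norm_nome_less_1] by simp

text \<open>By the heat equation and the theta values at 0 and \<open>w3\<close>, this and the next
  quantity are D log \<eta>(\<tau>) and D log \<eta>(3\<tau>), classically E_2(q)/24 and E_2(q^3)/8.
  The encoding by theta derivatives is the one that the Taylor relations use.\<close>

definition eta_logderiv :: "complex \<Rightarrow> complex" where
  "eta_logderiv \<tau> = theta 3 0 \<tau> / (6 * theta 1 0 \<tau>)"

definition eta3_logderiv :: "complex \<Rightarrow> complex" where
  "eta3_logderiv \<tau> = theta 2 w3 \<tau> / (2 * theta 0 w3 \<tau>)"

text \<open>The theta derivative at 0 gives only the cube of \<eta>; differentiability of \<eta>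
  itself comes from holomorphy of the product.\<close>

lemma dedekind_eta_differentiable:
  assumes \<tau>: "Im \<tau> > 0"
  obtains d where "has_qderiv dedekind_eta d \<tau>"
proof -
  let ?q = "exp (2 * of_real pi * \<i> * \<tau>)"
  have "?q \<in> ball 0 1" using norm_nome_less_1[OF \<tau>] by simp
  hence "qpoch 1 field_differentiable at ?q"
    using holomorphic_qpoch holomorphic_on_imp_differentiable_at by blast
  then obtain e where e: "(qpoch 1 has_field_derivative e) (at ?q)"
    by (auto simp: field_differentiable_def)
  have "((\<lambda>\<tau>. qpoch 1 (exp (2 * of_real pi * \<i> * \<tau>))) has_field_derivative e * (?q * (2 * of_real pi * \<i>))) (at \<tau>)"
    by (rule DERIV_chain2[where f = "qpoch 1" and g = "\<lambda>\<tau>. exp (2 * of_real pi * \<i> * \<tau>)", OF e]) (auto intro!: derivative_eq_intros)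
  hence "\<exists>d. (dedekind_eta has_field_derivative d) (at \<tau>)"
    unfolding dedekind_eta_eq[abs_def] by (intro exI) (auto intro!: derivative_eq_intros)
  then obtain d where "(dedekind_eta has_field_derivative d) (at \<tau>)" ..
  hence "has_qderiv dedekind_eta (d / (2 * of_real pi * \<i>)) \<tau>"
    by (simp add: has_qderiv_def)
  thus ?thesis by (rule that)
qed

lemma eta_qderiv:
  assumes \<tau>: "Im \<tau> > 0"
  shows "has_qderiv dedekind_eta (eta_logderiv \<tau> * dedekind_eta \<tau>) \<tau>"
proof -
  obtain d where d: "has_qderiv dedekind_eta d \<tau>"
    using dedekind_eta_differentiable[OF \<tau>] .
  have "has_qderiv (\<lambda>x. (-1) * dedekind_eta x ^ 3) ((-1) * (of_nat 3 * dedekind_eta \<tau> ^ (3 - 1) * d)) \<tau>"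
    by (intro has_qderiv_cmult has_qderiv_power d)
  moreover have "has_qderiv (\<lambda>x. (-1) * dedekind_eta x ^ 3) (theta (1 + 2) 0 \<tau> / 2) \<tau>"
    by (rule has_qderiv_cong[OF theta_qderiv[OF \<tau>] \<tau>]) (simp only: theta_1_0, simp)
  ultimately have "theta (1 + 2) 0 \<tau> / 2 = (-1) * (of_nat 3 * dedekind_eta \<tau> ^ (3 - 1) * d)"
    by (rule has_qderiv_unique[rotated])
  moreover have "1 + 2 = (3::nat)" by simp
  ultimately have "theta 3 0 \<tau> / 2 = (-1) * (of_nat 3 * dedekind_eta \<tau> ^ (3 - 1) * d)" by metis
  hence "theta 3 0 \<tau> = - 6 * dedekind_eta \<tau> ^ 2 * d" by simp
  hence "eta_logderiv \<tau> * dedekind_eta \<tau> = d"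
    using dedekind_eta_nz[OF \<tau>] unfolding eta_logderiv_def theta_1_0[OF \<tau>]
    by (simp add: divide_simps power2_eq_square power3_eq_cube)
  with d show ?thesis by simp
qed

lemma eta3_qderiv:
  assumes \<tau>: "Im \<tau> > 0"
  shows "has_qderiv (\<lambda>x. dedekind_eta (3 * x)) (eta3_logderiv \<tau> * dedekind_eta (3 * \<tau>)) \<tau>"
    and "eta3_logderiv \<tau> = 3 * eta_logderiv (3 * \<tau>)"
proof -
  let ?d = "3 * (eta_logderiv (3 * \<tau>) * dedekind_eta (3 * \<tau>))"
  have d: "has_qderiv (\<lambda>x. dedekind_eta (3 * x)) ?d \<tau>"
    by (rule has_qderiv_scale, rule eta_qderiv) (use \<tau> in simp)
  have "has_qderiv (\<lambda>x. (- \<i> * sqrt 3) * dedekind_eta (3 * x)) ((- \<i> * sqrt 3) * ?d) \<tau>"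
    by (intro has_qderiv_cmult d)
  moreover have "has_qderiv (\<lambda>x. (- \<i> * sqrt 3) * dedekind_eta (3 * x)) (theta (0 + 2) w3 \<tau> / 2) \<tau>"
    by (rule has_qderiv_cong[OF theta_qderiv[OF \<tau>] \<tau>]) (simp only: theta_0_torsion)
  ultimately have "theta (0 + 2) w3 \<tau> / 2 = (- \<i> * sqrt 3) * ?d"
    by (rule has_qderiv_unique[rotated])
  moreover have "0 + 2 = (2::nat)" by simp
  ultimately have "theta 2 w3 \<tau> / 2 = (- \<i> * sqrt 3) * ?d" by metis
  hence e: "theta 2 w3 \<tau> = 2 * ((- \<i> * sqrt 3) * ?d)" by simp
  have nz: "dedekind_eta (3 * \<tau>) \<noteq> 0" using dedekind_eta_nz[of "3 * \<tau>"] \<tau> by simp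
  have k: "- \<i> * sqrt 3 \<noteq> 0" by simp
  show *: "eta3_logderiv \<tau> = 3 * eta_logderiv (3 * \<tau>)"
    using nz k unfolding eta3_logderiv_def theta_0_torsion[OF \<tau>] e by (simp add: divide_simps)
  show "has_qderiv (\<lambda>x. dedekind_eta (3 * x)) (eta3_logderiv \<tau> * dedekind_eta (3 * \<tau>)) \<tau>"
    using d by (simp only: * mult.assoc)
qed

text \<open>Applying D to a Taylor relation raises its orders by 2 through the heat equation, and
  the Taylor relation of the higher order then eliminates the new theta values. Orders 0 and 2 at
  \<open>w3\<close> give D c, orders 1 and 3 at 0 give D a, orders 3 and 5 at 0 give
  \<open>r3 - r1\<close>, and orders 2 and 4 at \<open>w3\<close> give D r3.\<close>

theorem level3_system:
  assumes \<tau>: "Im \<tau> > 0"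
  defines "a \<equiv> cubic_a_tau \<tau>" and "r1 \<equiv> eta_logderiv \<tau>" and "r3 \<equiv> eta3_logderiv \<tau>"
    and "b3 \<equiv> dedekind_eta \<tau> ^ 9 / dedekind_eta (3 * \<tau>) ^ 3"
  defines "a' \<equiv> a * (2 * r3 + a\<^sup>2 / 12) - b3 / 3"
  shows "r3 - r1 = a\<^sup>2 / 12"
    and "has_qderiv cubic_a_tau a' \<tau>"
    and "has_qderiv eta3_logderiv (2 * r3\<^sup>2 - a\<^sup>2 * r3 / 6 + a * a' / 12 - a ^ 4 / 96) \<tau>"
proof -
  define k where "k = (- \<i> * sqrt 3 :: complex)"
  have k2: "k\<^sup>2 = - 3" by (simp add: k_def power_mult_distrib flip: of_real_power)
  have k0: "k \<noteq> 0" by (simp add: k_def)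
  define n where "n = dedekind_eta \<tau>"
  define h where "h = dedekind_eta (3 * \<tau>)"
  have nz: "n \<noteq> 0" "h \<noteq> 0" using dedekind_eta_nz[of \<tau>] dedekind_eta_nz[of "3 * \<tau>"] \<tau> by (auto simp: n_def h_def)
  define g where "g = theta 0 w3 \<tau>"
  define f where "f = theta 1 w3 \<tau>"
  define g2 where "g2 = theta 2 w3 \<tau>"
  define f3 where "f3 = theta 3 w3 \<tau>"
  define g4 where "g4 = theta 4 w3 \<tau>"
  define j where "j = theta 1 0 \<tau>"
  define j3 where "j3 = theta 3 0 \<tau>"
  have g: "g = k * h" unfolding g_def h_def k_def theta_0_torsion[OF \<tau>] ..
  have j: "j = - (n ^ 3)" unfolding j_def n_def theta_1_0[OF \<tau>] ..
  have gnz: "g \<noteq> 0" "j \<noteq> 0" using nz k0 by (auto simp: g j)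
  have g2: "g2 = 2 * r3 * g" using gnz by (simp add: r3_def eta3_logderiv_def g2_def g_def)
  have j3: "j3 = 6 * r1 * j" using gnz by (simp add: r1_def eta_logderiv_def j3_def j_def)
  define t where "t = theta3 1 0 \<tau>"
  define t3 where "t3 = theta3 3 0 \<tau>"
  define t5 where "t5 = theta3 5 0 \<tau>"
  define x where "x = theta3' 1 0 \<tau>"
  define x3 where "x3 = theta3' 3 0 \<tau>"
  define x5 where "x5 = theta3' 5 0 \<tau>"
  define y where "y = theta3' 0 w3 \<tau>"
  define y2 where "y2 = theta3' 2 w3 \<tau>"
  define y4 where "y4 = theta3' 4 w3 \<tau>"
  define c where "c = coset_theta 1 \<tau>"
  have t: "t = - 3 * h ^ 3" unfolding t_def h_def theta3_1_0[OF \<tau>] ..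
  note T = theta_cubed_taylor[OF \<tau>, folded a_def c_def g_def f_def g2_def f3_def g4_def j_def j3_def
      t_def t3_def t5_def x_def x3_def x5_def y_def y2_def y4_def]
  have ynz: "y \<noteq> 0" "c \<noteq> 0" using T(4) gnz by auto
  have ev: "1 + 2 = (3::nat)" "3 + 2 = (5::nat)" "0 + 2 = (2::nat)" "2 + 2 = (4::nat)" by simp_all
  note dth = theta_qderiv[OF \<tau>] and dt = theta3_qderiv[OF \<tau>] and dx = theta3'_qderiv[OF \<tau>]
  have D: "has_qderiv (theta 0 w3) (g2 / 2) \<tau>" "has_qderiv (theta 1 w3) (f3 / 2) \<tau>" "has_qderiv (theta 2 w3) (g4 / 2) \<tau>"
    "has_qderiv (theta 1 0) (j3 / 2) \<tau>" "has_qderiv (theta3 1 0) (t3 / 6) \<tau>" "has_qderiv (theta3 3 0) (t5 / 6) \<tau>"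
    "has_qderiv (theta3' 1 0) (x3 / 6) \<tau>" "has_qderiv (theta3' 3 0) (x5 / 6) \<tau>"
    "has_qderiv (theta3' 0 w3) (y2 / 6) \<tau>" "has_qderiv (theta3' 2 w3) (y4 / 6) \<tau>"
    using dth[of 0 w3] dth[of 1 w3] dth[of 2 w3] dth[of 1 0] dt[of 1 0] dt[of 3 0] dx[of 1 0] dx[of 3 0] dx[of 0 w3] dx[of 2 w3]
    by (simp_all only: ev g2_def f3_def g4_def j3_def t3_def t5_def x3_def x5_def y2_def y4_def)
  have Dh: "has_qderiv (\<lambda>x. dedekind_eta (3 * x)) (r3 * h) \<tau>"
    unfolding r3_def h_def by (rule eta3_qderiv[OF \<tau>])
  have cancel: "A * H = (-2) * T" if "- (3 / 2) * A * (- 3 * H ^ 3) = 3 * (- 3 * H ^ 2) * T" "H \<noteq> 0" for A H T :: complex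
  proof -
    have "9 * H ^ 2 * (A * H - (-2) * T) = 0"
      using that(1) by algebra
    thus ?thesis using that(2) by (simp add: eq_neg_iff_add_eq_0)
  qed
  \<comment> \<open>Order 1 at \<open>w3\<close> expresses a(q), and order 0 expresses c(q), as
    quotients of functions already known to be differentiable in \<tau>; this is the source of
    \<open>Da\<close> and \<open>Dc\<close>.\<close>
  have f_eq: "theta 1 w3 z = - (1/2) * (cubic_a_tau z * dedekind_eta (3 * z))" 
    and a_eq: "cubic_a_tau z = (-2) * (theta 1 w3 z / dedekind_eta (3 * z))"
    and c_eq: "coset_theta 1 z = theta 0 w3 z ^ 3 / theta3' 0 w3 z" if z: "Im z > 0" for z
  proof -
    have h0: "dedekind_eta (3 * z) \<noteq> 0" "theta 0 w3 z \<noteq> 0"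
      using dedekind_eta_nz[of "3 * z"] z by (auto simp: theta_0_torsion)
    have sq: "theta 0 w3 z ^ 2 = - 3 * dedekind_eta (3 * z) ^ 2"
      unfolding theta_0_torsion[OF z] by (simp add: power_mult_distrib flip: of_real_power)
    have "- (3 / 2) * cubic_a_tau z * (- 3 * dedekind_eta (3 * z) ^ 3) = 3 * (- 3 * dedekind_eta (3 * z) ^ 2) * theta 1 w3 z"
      by (rule theta_cubed_taylor(5)[OF z, unfolded theta3_1_0[OF z] sq])
    from cancel[OF this h0(1)]
    have *: "cubic_a_tau z * dedekind_eta (3 * z) = (-2) * theta 1 w3 z" .
    show "theta 1 w3 z = - (1/2) * (cubic_a_tau z * dedekind_eta (3 * z))" unfolding * by simp
    show "cubic_a_tau z = (-2) * (theta 1 w3 z / dedekind_eta (3 * z))" using * h0 by (simp add: field_simps)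
    have "theta3' 0 w3 z \<noteq> 0" using theta_cubed_taylor(4)[OF z] h0 by auto
    thus "coset_theta 1 z = theta 0 w3 z ^ 3 / theta3' 0 w3 z"
      using theta_cubed_taylor(4)[OF z] by (simp add: field_simps)
  qed
  have h0: "dedekind_eta (3 * \<tau>) \<noteq> 0" "theta3' 0 w3 \<tau> \<noteq> 0" using nz ynz by (simp_all add: h_def y_def)
  obtain da where Da: "has_qderiv cubic_a_tau da \<tau>"
    using has_qderiv_cong[OF has_qderiv_cmult[OF has_qderiv_divide[OF D(2) Dh h0(1)]] \<tau> a_eq[symmetric]] by blast
  obtain dc where Dc: "has_qderiv (coset_theta 1) dc \<tau>"
    using has_qderiv_cong[OF has_qderiv_divide[OF has_qderiv_power[OF D(1)] D(9) h0(2)] \<tau> c_eq[symmetric]] by blast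
  have f: "f = - (1/2) * (a * h)" using f_eq[OF \<tau>] by (simp only: f_def a_def h_def)
  have f3: "f3 / 2 = - (1/2) * (da * h + a * (r3 * h))"
    by (rule has_qderiv_unique[OF D(2) has_qderiv_cong[OF has_qderiv_cmult[OF has_qderiv_mult[OF Da Dh]] \<tau>], folded a_def h_def])
       (rule f_eq[symmetric])
  have E1: "(da * t + a * (t3 / 6)) + (dc * x + c * (x3 / 6)) = 0"
    by (rule has_qderiv_unique[OF has_qderiv_cong[OF has_qderiv_add[OF has_qderiv_mult[OF Da D(5)] has_qderiv_mult[OF Dc D(7)]] \<tau>]
          has_qderiv_const, folded a_def c_def t_def x_def]) (rule theta_cubed_taylor(1))
  have E3: "(da * t3 + a * (t5 / 6)) + (dc * x3 + c * (x5 / 6)) = 6 * (of_nat 3 * j ^ (3 - 1) * (j3 / 2))"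
    by (rule has_qderiv_unique[OF has_qderiv_cong[OF has_qderiv_add[OF has_qderiv_mult[OF Da D(6)] has_qderiv_mult[OF Dc D(8)]] \<tau>]
          has_qderiv_cmult[OF has_qderiv_power[OF D(4)]], folded a_def c_def t3_def x3_def j_def]) (rule theta_cubed_taylor(2))
  have O0: "dc * y + c * (y2 / 6) = of_nat 3 * g ^ (3 - 1) * (g2 / 2)"
    by (rule has_qderiv_unique[OF has_qderiv_cong[OF has_qderiv_mult[OF Dc D(9)] \<tau>] has_qderiv_power[OF D(1)],
          folded c_def y_def g_def]) (rule theta_cubed_taylor(4))
  have O2: "dc * y2 + c * (y4 / 6) = (6 * (g2 / 2) * f ^ 2 + 6 * g * (of_nat 2 * f ^ (2 - 1) * (f3 / 2))) +
     (3 * (of_nat 2 * g ^ (2 - 1) * (g2 / 2)) * g2 + 3 * g ^ 2 * (g4 / 2))"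
    by (rule has_qderiv_unique[OF has_qderiv_cong[OF has_qderiv_mult[OF Dc D(10)] \<tau>]
          has_qderiv_add[OF has_qderiv_mult[OF has_qderiv_cmult[OF D(1), of 6] has_qderiv_power[OF D(2), of 2]]
             has_qderiv_mult[OF has_qderiv_cmult[OF has_qderiv_power[OF D(1), of 2], of 3] D(3)]],
          folded c_def y2_def g_def f_def g2_def]) (rule theta_cubed_taylor(6))
  have dc: "dc = c * (2 * r3 + a\<^sup>2 / 12)"
  proof -
    have "dc * g ^ 3 = dc * (c * y)" by (simp only: T(4))
    also have "\<dots> = c * (of_nat 3 * g ^ (3 - 1) * (g2 / 2)) - c * (c * y2) / 6"
      unfolding O0[symmetric] by (simp add: algebra_simps)
    also have "\<dots> = c * (g\<^sup>2 * g2 - g * f\<^sup>2)"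
      unfolding T(6) by (simp add: field_simps power2_eq_square)
    also have "f\<^sup>2 = - (a\<^sup>2 / 12) * g\<^sup>2"
      unfolding f g power_mult_distrib k2 by (simp add: power2_eq_square)
    also have "c * (g\<^sup>2 * g2 - g * (- (a\<^sup>2 / 12) * g\<^sup>2)) = c * (2 * r3 + a\<^sup>2 / 12) * g ^ 3"
      unfolding g2 by (simp add: algebra_simps power2_eq_square power3_eq_cube)
    finally show ?thesis using gnz by simp
  qed
  \<comment> \<open>The logarithmic derivative D c / c just found.\<close>
  define \<gamma> where "\<gamma> = 2 * r3 + a\<^sup>2 / 12"
  have P1: "(da - \<gamma> * a) * t = - (j ^ 3)"
  proof -
    have "c * x = - (a * t)" using T(1) by (simp add: eq_neg_iff_add_eq_0 add.commute)
    moreover have "da * t + \<gamma> * (c * x) + (a * t3 + c * x3) / 6 = 0"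
      using E1 unfolding dc \<gamma>_def[symmetric] by (simp add: algebra_simps add_divide_distrib)
    ultimately show ?thesis unfolding T(2) by (simp add: algebra_simps)
  qed
  have da: "da = a'"
  proof -
    have "(da - \<gamma> * a) * (3 * h ^ 3) = - (n ^ 9)"
      using P1 unfolding t j by (simp add: power_mult[symmetric] algebra_simps)
    moreover have "b3 * h ^ 3 = n ^ 9" using nz by (simp add: b3_def n_def[symmetric] h_def[symmetric])
    ultimately have "(3 * (da - \<gamma> * a) + b3) * h ^ 3 = 0" by (simp add: algebra_simps)
    hence "3 * (da - \<gamma> * a) + b3 = 0" using nz by simp
    hence "da - \<gamma> * a = - b3 / 3" by algebra
    thus ?thesis by (simp add: a'_def \<gamma>_def algebra_simps)
  qed
  \<comment> \<open>Differentiating \<open>theta3 1 0\<close> = -3 \<eta>(3\<tau>)^3 gives D t = 3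
    r3 t, whereas the heat equation with \<kappa> = 1/3 gives D t = t3/6.\<close>
  have t3: "t3 = 18 * r3 * t"
  proof -
    have "has_qderiv (theta3 1 0) ((-3) * (of_nat 3 * h ^ (3 - 1) * (r3 * h))) \<tau>"
      by (rule has_qderiv_cong[OF has_qderiv_cmult[OF has_qderiv_power[OF Dh]] \<tau>, folded h_def]) (simp only: theta3_1_0)
    from has_qderiv_unique[OF D(5) this] show ?thesis
      unfolding t by (simp add: power2_eq_square power3_eq_cube field_simps)
  qed
  have \<gamma>: "\<gamma> = 3 * r3 - r1"
  proof -
    have "da * t3 + \<gamma> * (c * x3) + (a * t5 + c * x5) / 6 = 9 * j\<^sup>2 * j3"
      using E3 unfolding dc \<gamma>_def[symmetric] by (simp add: algebra_simps add_divide_distrib)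
    hence "da * t3 + \<gamma> * (6 * j ^ 3 - a * t3) + 10 * j\<^sup>2 * j3 = 9 * j\<^sup>2 * j3"
      unfolding T(3) T(2)[symmetric] by (simp add: algebra_simps)
    hence "18 * r3 * ((da - \<gamma> * a) * t) + \<gamma> * (6 * j ^ 3) + 6 * r1 * j ^ 3 = 0"
      unfolding t3 j3 by (simp add: algebra_simps power2_eq_square power3_eq_cube)
    hence "6 * j ^ 3 * (\<gamma> - 3 * r3 + r1) = 0"
      unfolding P1 by (simp add: algebra_simps)
    hence "\<gamma> - 3 * r3 + r1 = 0" using gnz unfolding mult_eq_0_iff by simp
    thus ?thesis by (simp add: algebra_simps)
  qed
  show "r3 - r1 = a\<^sup>2 / 12" using \<gamma> by (simp add: \<gamma>_def)
  show "has_qderiv cubic_a_tau a' \<tau>" using Da by (simp only: da)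
  have Dr: "has_qderiv eta3_logderiv ((g4 / 2 * (2 * g) - g2 * (2 * (g2 / 2))) / (2 * g)\<^sup>2) \<tau>"
    unfolding eta3_logderiv_def[abs_def]
    using has_qderiv_divide[OF D(3) has_qderiv_cmult[OF D(1), of 2]] gnz by (simp only: g_def g2_def) simp
  define s where "s = (g4 / 2 * (2 * g) - g2 * (2 * (g2 / 2))) / (2 * g)\<^sup>2"
  \<comment> \<open>Two applications of the heat equation give g4 = 4 D(D g), and D(D g)/g = D r3 +
    r3^2 because D g = r3 g; here \<open>s\<close> is D r3.\<close>
  have g4: "g4 = 4 * (s + r3\<^sup>2) * g"
    using gnz unfolding s_def g2 by (simp add: field_simps power2_eq_square)
  have "s = 2 * r3\<^sup>2 - a\<^sup>2 * r3 / 6 + a * a' / 12 - a ^ 4 / 96"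
  proof -
    have f3': "f3 = - (da * h + a * (r3 * h))"
    proof -
      have "f3 = 2 * (f3 / 2)" by simp
      also have "\<dots> = - (da * h + a * (r3 * h))" unfolding f3 by (simp only: mult_minus_left mult_minus_right mult.assoc[symmetric]) simp
      finally show ?thesis .
    qed
    have "\<gamma> * (c * y2) + (c * y4) / 6 = 3 * g2 * f\<^sup>2 + 6 * g * f * f3 + 3 * g * g2\<^sup>2 + 3 / 2 * g\<^sup>2 * g4"
      using O2 unfolding dc \<gamma>_def[symmetric] by (simp add: algebra_simps power2_eq_square)
    hence "6 * \<gamma> * (6 * g * f\<^sup>2 + 3 * g\<^sup>2 * g2) + (36 * f\<^sup>2 * g2 + 18 * g * g2\<^sup>2 + 24 * g * f * f3 + 3 * g\<^sup>2 * g4)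
       - 6 * (3 * g2 * f\<^sup>2 + 6 * g * f * f3 + 3 * g * g2\<^sup>2 + 3 / 2 * g\<^sup>2 * g4) = 0"
      unfolding T(6) T(7) by (simp add: field_simps)
    also have "6 * \<gamma> * (6 * g * f\<^sup>2 + 3 * g\<^sup>2 * g2) + (36 * f\<^sup>2 * g2 + 18 * g * g2\<^sup>2 + 24 * g * f * f3 + 3 * g\<^sup>2 * g4)
       - 6 * (3 * g2 * f\<^sup>2 + 6 * g * f * f3 + 3 * g * g2\<^sup>2 + 3 / 2 * g\<^sup>2 * g4)
       = 36 * \<gamma> * g * f\<^sup>2 + 18 * \<gamma> * g\<^sup>2 * g2 + 18 * f\<^sup>2 * g2 - 12 * g * f * f3 - 6 * g\<^sup>2 * g4"
      by (simp add: algebra_simps)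
    also have "\<dots> = k * h ^ 3 * (9 * \<gamma> * a\<^sup>2 + 36 * k\<^sup>2 * \<gamma> * r3 + 9 * a\<^sup>2 * r3 - 6 * a * (da + a * r3) - 24 * k\<^sup>2 * (s + r3\<^sup>2))"
      unfolding f f3' g4 g2 unfolding g by (simp add: algebra_simps power2_eq_square power3_eq_cube)
    finally have "9 * \<gamma> * a\<^sup>2 + 36 * k\<^sup>2 * \<gamma> * r3 + 9 * a\<^sup>2 * r3 - 6 * a * (da + a * r3) - 24 * k\<^sup>2 * (s + r3\<^sup>2) = 0"
      using k0 nz by simp
    also have "9 * \<gamma> * a\<^sup>2 + 36 * k\<^sup>2 * \<gamma> * r3 + 9 * a\<^sup>2 * r3 - 6 * a * (da + a * r3) - 24 * k\<^sup>2 * (s + r3\<^sup>2)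
        = 72 * (s - (2 * r3\<^sup>2 - a\<^sup>2 * r3 / 6 + a * a' / 12 - a ^ 4 / 96))"
      unfolding k2 \<gamma>_def da by (simp add: field_simps power2_eq_square power4_eq_xxxx)
    finally show ?thesis unfolding mult_eq_0_iff by simp
  qed
  thus "has_qderiv eta3_logderiv (2 * r3\<^sup>2 - a\<^sup>2 * r3 / 6 + a * a' / 12 - a ^ 4 / 96) \<tau>"
    using Dr by (simp only: s_def[symmetric])
qed

section \<open>Uniqueness of solutions of the modular relations\<close>

text \<open>The Euler operator, which is q d/dq on expansions in q; the name does not refer to theta
  functions.\<close>

abbreviation fps_theta :: "complex fps \<Rightarrow> complex fps" where
  "fps_theta f \<equiv> fps_X * fps_deriv f"

lemma fps_theta_X_power_mult: "fps_theta (fps_X ^ n * f) = fps_X ^ n * (of_nat n * f + fps_theta f)"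
  by (induction n) (simp_all add: algebra_simps)

lemma fps_theta_nth_0: "fps_nth (fps_theta f) 0 = 0"
  by simp

text \<open>
  The differential and algebraic relations between the normalised level 3 quantities and their
  images under \<open>q \<mapsto> q\<^sup>l\<close>.  Here \<open>m\<close> is the logarithmic derivative of \<open>H\<close>.
\<close>
definition modular_relations :: "nat \<Rightarrow> complex fps \<Rightarrow> complex fps \<Rightarrow> complex fps \<Rightarrow> complex fps \<Rightarrow>
    complex fps \<Rightarrow> complex fps \<Rightarrow> complex fps \<Rightarrow> bool" where
  "modular_relations l H m v d s z k \<longleftrightarrow>
     3 * fps_theta v = m * of_nat (l + 1) * (v - k) \<and>
     3 * v * fps_theta d = m * of_nat (l + 1) * (3 * s * v + 2 * d * v - (d * k - z)) \<and>
     18 * v * fps_theta s = m * of_nat (l + 1) * (- 2 * d * v + (d * k - z)) \<and>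
     k * (d\<^sup>2 + 4 * of_nat l * v\<^sup>2) = 2 * of_nat l * (v ^ 3 + 1 - 729 * H ^ (l + 1)) - d * z \<and>
     (d\<^sup>2 + 4 * of_nat l * v\<^sup>2) * (v - k)\<^sup>2 - (d * v + z)\<^sup>2 = 2916 * of_nat l * H ^ (l + 1) * v"

text \<open>
  If two solutions agree modulo \<open>X\<^sup>n\<close>, the next coefficients of their differences satisfy a homogeneous linear
  system whose determinant is a nonzero multiple of \<open>n - 1\<close>; this is why \<open>fps_nth v 1\<close> has to be prescribed.
\<close>
lemma modular_relations_unique_step:
  fixes H m v d s z k v' d' s' z' k' :: "complex fps"
  assumes rel: "modular_relations l H m v d s z k" "modular_relations l H m v' d' s' z' k'"
    and l: "l \<ge> 2" and H: "H = fps_X * h" and m: "fps_nth m 0 = 1"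
    and init: "fps_nth v' 0 = 1" "fps_nth d' 0 = of_nat l - 1" "fps_nth s' 0 = 0" "fps_nth z' 0 = 1 - of_nat l" "fps_nth k' 0 = 1"
    and p: "v' - k' = fps_X * p" "fps_nth p 0 = 27 / (of_nat l + 1)"
    and g: "d' * v' + z' = fps_X * g" "fps_nth g 0 = - 27"
    and n: "n \<ge> 1" and v1: "fps_nth v 1 = fps_nth v' 1"
    and e: "v = v' + fps_X ^ n * ev" "d = d' + fps_X ^ n * ed" "s = s' + fps_X ^ n * es"
      "z = z' + fps_X ^ n * ez" "k = k' + fps_X ^ n * ek"
  shows "fps_nth ev 0 = 0 \<and> fps_nth ed 0 = 0 \<and> fps_nth es 0 = 0 \<and> fps_nth ez 0 = 0 \<and> fps_nth ek 0 = 0"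
proof -
  define x where "x = (fps_X ^ n :: complex fps)"
  have x: "x \<noteq> 0" "fps_nth x 0 = 0" using n by (auto simp: x_def fps_power_zeroth)
  define L where "L = (of_nat l :: complex fps)"
  define L0 where "L0 = (of_nat l :: complex)"
  have L: "fps_nth L 0 = L0" by (simp add: L_def L0_def fps_of_nat)
  have l1: "of_nat (l + 1) = L + 1" by (simp add: L_def)
  note R1 = rel(1)[unfolded modular_relations_def l1 L_def[symmetric]]
  note R2 = rel(2)[unfolded modular_relations_def l1 L_def[symmetric]]
  note rel1 = R1[THEN conjunct1] R1[THEN conjunct2, THEN conjunct1] R1[THEN conjunct2, THEN conjunct2, THEN conjunct1]
    R1[THEN conjunct2, THEN conjunct2, THEN conjunct2, THEN conjunct1] R1[THEN conjunct2, THEN conjunct2, THEN conjunct2, THEN conjunct2]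
  note rel2 = R2[THEN conjunct1] R2[THEN conjunct2, THEN conjunct1] R2[THEN conjunct2, THEN conjunct2, THEN conjunct1]
    R2[THEN conjunct2, THEN conjunct2, THEN conjunct2, THEN conjunct1] R2[THEN conjunct2, THEN conjunct2, THEN conjunct2, THEN conjunct2]
  note e' = e[folded x_def]
  have init': "fps_nth v 0 = 1" "fps_nth d 0 = L0 - 1" "fps_nth s 0 = 0" "fps_nth z 0 = 1 - L0" "fps_nth k 0 = 1"
    using init x by (simp_all add: e' L0_def)
  note nth = init init' L m x(2) fps_mult_nth_0 fps_add_nth fps_sub_nth fps_theta_nth_0
  have num: "fps_nth (numeral w) 0 = (numeral w :: complex)" for w
    by (simp add: fps_numeral_nth_0)
  define a where "a = fps_nth ev 0"
  define b where "b = fps_nth ed 0"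
  define c where "c = fps_nth es 0"
  define f where "f = fps_nth ez 0"
  define y where "y = fps_nth ek 0"
  note vars = a_def[symmetric] b_def[symmetric] c_def[symmetric] f_def[symmetric] y_def[symmetric]
  have Dx: "fps_theta (x * F) = x * (of_nat n * F + fps_theta F)" for F
    unfolding x_def by (rule fps_theta_X_power_mult)
  have nn: "fps_nth (of_nat n) 0 = (of_nat n :: complex)" by (simp add: fps_of_nat)
  have Dadd: "fps_theta (F + G) = fps_theta F + fps_theta G" for F G
    by (simp add: distrib_left)
  \<comment> \<open>Each relation is written for both solutions, subtracted and divided by
    \<open>x\<close>. The constant coefficients of the results form the linear system for
    \<open>a\<close>, \<open>b\<close>, \<open>c\<close>, \<open>f\<close>,
    \<open>y\<close>.\<close>
  have cancel: "P = Q" if "A = B" "A' = B'" "x * P - x * Q = (A - B) - (A' - B')" for P Q A B A' B'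
    using that x by simp
  have Dv: "fps_theta v = fps_theta v' + x * (of_nat n * ev + fps_theta ev)"
    "fps_theta d = fps_theta d' + x * (of_nat n * ed + fps_theta ed)"
    "fps_theta s = fps_theta s' + x * (of_nat n * es + fps_theta es)"
    unfolding e' Dadd Dx by (rule refl)+
  note ring = algebra_simps power2_eq_square power3_eq_cube
  have eq1: "3 * (of_nat n * a) = (L0 + 1) * (a - y)"
  proof -
    have "3 * (of_nat n * ev + fps_theta ev) = m * (L + 1) * (ev - ek)"
      by (rule cancel[OF rel1(1) rel2(1)], unfold Dv, unfold e') (simp add: ring)
    from arg_cong[OF this, of "\<lambda>F. fps_nth F 0"] show ?thesis
      by (simp add: nth num nn vars)
  qed
  have eq2: "of_nat n * b * 3 = (L0 + 1) * (3 * c + 2 * b + 2 * (L0 - 1) * a - b - (L0 - 1) * y + f)"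
  proof -
    have "3 * v * (of_nat n * ed + fps_theta ed) + 3 * ev * fps_theta d' =
       m * (L + 1) * (3 * es * v + 3 * s' * ev + 2 * ed * v + 2 * d' * ev - ed * k - d' * ek + ez)"
      by (rule cancel[OF rel1(2) rel2(2)], unfold Dv, unfold e') (simp add: ring)
    from arg_cong[OF this, of "\<lambda>F. fps_nth F 0"] show ?thesis
      by (simp add: nth num nn vars L0_def algebra_simps)
  qed
  have eq3: "18 * (of_nat n * c) = (L0 + 1) * (- 2 * b - 2 * (L0 - 1) * a + b + (L0 - 1) * y - f)"
  proof -
    have "18 * v * (of_nat n * es + fps_theta es) + 18 * ev * fps_theta s' =
       m * (L + 1) * (- 2 * ed * v - 2 * d' * ev + ed * k + d' * ek - ez)"
      by (rule cancel[OF rel1(3) rel2(3)], unfold Dv, unfold e') (simp add: ring)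
    from arg_cong[OF this, of "\<lambda>F. fps_nth F 0"] show ?thesis
      by (simp add: nth num nn vars L0_def algebra_simps)
  qed
  have eq4: "y * (L0 + 1)\<^sup>2 + 2 * L0 * a + (L0 - 1) * (b + f) = 0"
  proof -
    have "ek * (d\<^sup>2 + 4 * L * v\<^sup>2) + k' * (ed * (d + d') + 4 * L * ev * (v + v'))
       = 2 * L * ev * (v\<^sup>2 + v * v' + v'\<^sup>2) - ed * z - d' * ez"
      by (rule cancel[OF rel1(4) rel2(4)], unfold e') (simp add: ring)
    from arg_cong[OF this, of "\<lambda>F. fps_nth F 0"] show ?thesis
      by (simp add: nth num nn vars L0_def power2_eq_square algebra_simps)
  qed
  have L0: "L0 \<noteq> 0" "L0 \<noteq> 1" "L0 + 1 \<noteq> 0"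
    using l by (auto simp: L0_def) (metis of_nat_0 of_nat_Suc of_nat_eq_iff add.commute nat.distinct(1))+
  \<comment> \<open>For n = 1 this is the prescribed coefficient of v. For n > 1 the fifth relation
    is used: v - k and d v + z are divisible by X, so the difference of its two copies is divisible
    by X^(n+1), one factor more than usual, with quotient \<open>B\<close>. The term with H^(l+1)
    still carries X^l after the division, so it is absent from the constant coefficient.\<close>
  have a: "a = 0"
  proof (cases "n = 1")
    case True
    have "fps_nth v 1 = fps_nth v' 1 + a"
      unfolding e True by (simp add: a_def)
    thus ?thesis using v1 by simp
  next
    case False
    define x' where "x' = (fps_X ^ (n - 1) :: complex fps)"
    have xx: "x = fps_X * x'" using n by (simp add: x_def x'_def power_eq_if)
    have x'0: "fps_nth x' 0 = 0" using n False by (simp add: x'_def fps_power_zeroth)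
    define G where "G = ed * v + d' * ev + ez"
    have G: "d * v + z = fps_X * g + x * G"
      unfolding g(1)[symmetric] G_def e' by (simp add: ring)
    have vk: "v - k = fps_X * p + x * (ev - ek)"
      unfolding p(1)[symmetric] e' by (simp add: ring)
    define Q where "Q = d'\<^sup>2 + 4 * L * v'\<^sup>2"
    define N where "N = ed * (d + d') + 4 * L * ev * (v + v')"
    have M: "d\<^sup>2 + 4 * L * v\<^sup>2 = Q + x * N"
      unfolding Q_def N_def e' by (simp add: ring)
    define B where "B = N * (fps_X * p ^ 2 + 2 * x * p * (ev - ek) + x * x' * (ev - ek)\<^sup>2)
       + Q * (ev - ek) * (2 * p + x' * (ev - ek)) - G * (2 * g + x' * G)"
    have "fps_X * B = 2916 * L * H ^ (l + 1) * ev"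
      by (rule cancel[OF rel1(5)[unfolded M vk G] rel2(5)[folded Q_def, unfolded p(1) g(1)]],
          unfold B_def xx, unfold e'(1) xx) (simp add: ring)
    also have "\<dots> = fps_X * (2916 * L * fps_X ^ l * h ^ (l + 1) * ev)"
      by (simp add: H power_mult_distrib algebra_simps)
    finally have "B = 2916 * L * fps_X ^ l * h ^ (l + 1) * ev"
      by simp
    from arg_cong[OF this, of "\<lambda>F. fps_nth F 0"]
    have "((L0 - 1)\<^sup>2 + 4 * L0) * (a - y) * (2 * (27 / (L0 + 1))) - (b + (L0 - 1) * a + f) * (2 * (- 27)) = 0"
      using l by (simp add: nth num nn vars L0_def[symmetric] Q_def G_def B_def p(2) g(2) x'0 fps_power_zeroth power2_eq_square)
    also have "((L0 - 1)\<^sup>2 + 4 * L0) * (a - y) * (2 * (27 / (L0 + 1))) = 54 * ((L0 + 1) * (a - y))"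
    proof -
      have "(L0 - 1)\<^sup>2 + 4 * L0 = (L0 + 1) * (L0 + 1)" by (simp add: ring)
      thus ?thesis using L0 by simp
    qed
    finally have "54 * ((L0 + 1) * (a - y) + (b + (L0 - 1) * a + f)) = 0"
      by (simp add: algebra_simps)
    hence "(L0 + 1) * (a - y) + (b + (L0 - 1) * a + f) = 0" unfolding mult_eq_0_iff by simp
    \<comment> \<open>This combination of the first, fourth and fifth equations eliminates
      \<open>y\<close> and \<open>b + f\<close>. What is left contains the factor 1 - n, nonzero in
      this case.\<close>
    moreover have "(6 * L0) * (1 - of_nat n) * a = (L0 - 1) * ((L0 + 1) * (a - y) + (b + (L0 - 1) * a + f)) * (-1)
      + (y * (L0 + 1)\<^sup>2 + 2 * L0 * a + (L0 - 1) * (b + f)) - 2 * L0 * (3 * (of_nat n * a) - (L0 + 1) * (a - y))"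
      by (simp add: ring)
    ultimately have "(6 * L0) * (1 - of_nat n) * a = 0"
      using eq1 eq4 by simp
    thus ?thesis using L0 False by simp
  qed
  have y: "y = 0" using eq1 a L0 by simp
  have bf: "b + f = 0" using eq4 a y L0 by simp
  have c: "c = 0"
  proof -
    have "18 * (of_nat n * c) = (L0 + 1) * (- (b + f))" using eq3 a y by (simp add: algebra_simps)
    thus ?thesis using bf n by simp
  qed
  have b: "b = 0"
  proof -
    have "of_nat n * b * 3 = (L0 + 1) * (b + f)" using eq2 a y c by (simp add: algebra_simps)
    thus ?thesis using bf n by simp
  qed
  show ?thesis using a b c y bf by (simp add: a_def b_def c_def f_def y_def)
qed

section \<open>Passage to the variable q\<close>

abbreviation nome :: "complex \<Rightarrow> complex" where
  "nome \<tau> \<equiv> exp (2 * of_real pi * \<i> * \<tau>)"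

lemma nome_surj:
  assumes "norm q < 1" "q \<noteq> 0"
  obtains \<tau> where "Im \<tau> > 0" "q = nome \<tau>"
proof
  show "q = nome (Ln q / (2 * of_real pi * \<i>))" using assms by simp
  have "Im (Ln q / (2 * of_real pi * \<i>)) = - ln (norm q) / (2 * pi)"
    using assms(2) by (simp add: Im_divide power2_eq_square field_simps)
  moreover have "ln (norm q) < 0" using assms by simp
  ultimately show "Im (Ln q / (2 * of_real pi * \<i>)) > 0" by (simp add: divide_neg_pos)
qed

lemma has_qderiv_nome_imp:
  assumes "has_qderiv (\<lambda>\<tau>. F (nome \<tau>)) d \<tau>"
  shows "(F has_field_derivative d / nome \<tau>) (at (nome \<tau>))"
proof -
  define q where "q = nome \<tau>"
  define c where "c = 2 * of_real pi * \<i>"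
  have c: "c \<noteq> 0" by (simp add: c_def)
  have q: "q \<noteq> 0" by (simp add: q_def)
  \<comment> \<open>A local inverse of \<open>nome\<close> with value \<tau> at q. Dividing by q
    before taking the principal logarithm places the base point at 1, away from the branch
    cut.\<close>
  define L where "L z = \<tau> + Ln (z / q) / c" for z
  have Lq: "L q = \<tau>" using q by (simp add: L_def)
  have dL: "(L has_field_derivative 1 / (c * q)) (at q)"
    unfolding L_def using q c by (auto intro!: derivative_eq_intros simp: field_simps)
  have deriv: "((\<lambda>z. F (nome (L z))) has_field_derivative (c * d) * (1 / (c * q))) (at q)"
    using assms unfolding has_qderiv_def c_def[symmetric]
    by (intro DERIV_chain2[where f = "\<lambda>\<tau>. F (exp (c * \<tau>))" and g = L, OF _ dL]) (simp add: Lq)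
  have "F (nome (L z)) = F z" if "z \<in> - {0}" for z
  proof -
    have "c * L z = c * \<tau> + Ln (z / q)" using c by (simp add: L_def field_simps)
    hence "nome (L z) = nome \<tau> * exp (Ln (z / q))" by (simp add: c_def exp_add)
    also have "\<dots> = z" using that q by (simp add: q_def)
    finally show ?thesis by simp
  qed
  note eq = this
  have "(F has_field_derivative (c * d) * (1 / (c * q))) (at q)"
    by (rule has_field_derivative_transform_within_open[OF deriv, where S = "- {0}"]) (use q eq in auto)
  thus ?thesis using c by (simp add: q_def)
qed

text \<open>\<open>eta_ratio q\<close> is $q^{-1/12} \eta(3\tau)/\eta(\tau)$, and \<open>cubic_b\<close> is the function $b(q) = \eta(\tau)^3/\eta(3\tau)$ of the Borweins.\<close>
definition eta_ratio :: "complex \<Rightarrow> complex" where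
  "eta_ratio q = qpoch 1 (q ^ 3) / qpoch 1 q"

definition cubic_b :: "complex \<Rightarrow> complex" where
  "cubic_b q = qpoch 1 q ^ 3 / qpoch 1 (q ^ 3)"

definition cubic_rho :: "complex \<Rightarrow> complex" where
  "cubic_rho q = q * deriv cubic_b q / cubic_b q"

lemma power_in_unit_ball: "norm (q::complex) < 1 \<Longrightarrow> n > 0 \<Longrightarrow> norm (q ^ n) < 1"
  by (simp add: norm_power power_less_one_iff)

lemma qpoch_power_nz: "norm q < 1 \<Longrightarrow> n > 0 \<Longrightarrow> qpoch 1 (q ^ n) \<noteq> 0"
  using qpoch_1_nz[of "q ^ n"] power_in_unit_ball[of q n] by simp

lemma holomorphic_compose_power:
  assumes "f holomorphic_on ball 0 1" "n > 0"
  shows "(\<lambda>q. f (q ^ n)) holomorphic_on ball (0::complex) 1"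
proof -
  have "f \<circ> (\<lambda>q. q ^ n) holomorphic_on ball 0 1"
    by (rule holomorphic_on_compose_gen[OF _ assms(1)]) (use power_in_unit_ball assms(2) in \<open>auto intro!: holomorphic_intros\<close>)
  thus ?thesis by (simp add: o_def)
qed

lemma holomorphic_eta_ratio: "eta_ratio holomorphic_on ball 0 1"
  unfolding eta_ratio_def[abs_def]
  by (intro holomorphic_intros holomorphic_compose_power holomorphic_qpoch) (auto simp: qpoch_1_nz)

lemma holomorphic_cubic_b: "cubic_b holomorphic_on ball 0 1"
  unfolding cubic_b_def[abs_def]
  by (intro holomorphic_intros holomorphic_compose_power holomorphic_qpoch) (auto simp: qpoch_power_nz)

lemma cubic_b_nz: "norm q < 1 \<Longrightarrow> cubic_b q \<noteq> 0"
  by (simp add: cubic_b_def qpoch_1_nz qpoch_power_nz)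

lemma holomorphic_cubic_rho: "cubic_rho holomorphic_on ball 0 1"
  unfolding cubic_rho_def[abs_def]
  by (intro holomorphic_intros holomorphic_deriv holomorphic_cubic_b open_ball) (auto simp: cubic_b_nz)

lemma nome_3: "nome (3 * \<tau>) = nome \<tau> ^ 3"
  by (simp add: algebra_simps flip: exp_of_nat_mult)

lemma cubic_b_nome: "cubic_b (nome \<tau>) = dedekind_eta \<tau> ^ 3 / dedekind_eta (3 * \<tau>)"
proof -
  have "exp (of_real pi * \<i> * \<tau> / 12) ^ 3 = exp (of_real pi * \<i> * (3 * \<tau>) / 12)"
    by (simp add: algebra_simps flip: exp_of_nat_mult)
  thus ?thesis unfolding dedekind_eta_eq nome_3 cubic_b_def by (simp add: power_mult_distrib)
qed

lemma eta_ratio_nome: "eta_ratio (nome \<tau>) = dedekind_eta (3 * \<tau>) / dedekind_eta \<tau> * exp (- (of_real pi * \<i> / 6) * \<tau>)"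
proof -
  have "exp (of_real pi * \<i> * (3 * \<tau>) / 12) * exp (- (of_real pi * \<i> / 6) * \<tau>) = exp (of_real pi * \<i> * \<tau> / 12)"
    by (simp add: field_simps flip: exp_add)
  hence "dedekind_eta (3 * \<tau>) * exp (- (of_real pi * \<i> / 6) * \<tau>) = exp (of_real pi * \<i> * \<tau> / 12) * qpoch 1 (nome \<tau> ^ 3)"
    unfolding dedekind_eta_eq[of "3 * \<tau>"] nome_3 by (simp add: mult_ac)
  thus ?thesis unfolding dedekind_eta_eq[of \<tau>] eta_ratio_def by (simp add: divide_simps mult_ac)
qed

text \<open>This is D log(\<eta>(3\<tau>)/\<eta>(\<tau>)) = a^2/12, where the -1 stems from the
  removed factor q^(1/12). At q = 0, which is no value of \<open>nome\<close>, it reduces to a(0) =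
  1.\<close>

lemma eta_ratio_deriv:
  assumes "norm q < 1"
  shows "12 * (q * deriv eta_ratio q) = eta_ratio q * ((cubic_a q)\<^sup>2 - 1)"
proof (cases "q = 0")
  case True
  have "cubic_a 0 = 1"
  proof -
    have "cubic_a 0 = infsum (\<lambda>(m, n). 0 powi (m\<^sup>2 + m * n + n\<^sup>2)) {(0, 0)}"
      unfolding cubic_a_def
    proof (rule infsum_cong_neutral)
      fix p :: "int \<times> int" assume p: "p \<in> UNIV - {(0, 0)}"
      obtain m n where mn: "p = (m, n)" by force
      have "4 * (m\<^sup>2 + m * n + n\<^sup>2) = (2 * m + n)\<^sup>2 + 3 * n\<^sup>2" by (simp add: power2_eq_square algebra_simps)
      moreover have "(2 * m + n)\<^sup>2 + 3 * n\<^sup>2 \<noteq> 0" using p mn by (auto simp: add_nonneg_eq_0_iff)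
      ultimately show "(case p of (m, n) \<Rightarrow> (0::complex) powi (m\<^sup>2 + m * n + n\<^sup>2)) = 0"
        using mn by (simp add: power_int_0_left_if)
    qed auto
    thus ?thesis by simp
  qed
  thus ?thesis using True by simp
next
  case False
  then obtain \<tau> where \<tau>: "Im \<tau> > 0" and q: "q = nome \<tau>" using nome_surj assms by blast
  let ?a = "cubic_a_tau \<tau>"
  have nz: "dedekind_eta \<tau> \<noteq> 0" using dedekind_eta_nz[OF \<tau>] .
  have "has_qderiv (\<lambda>\<tau>. exp (- (of_real pi * \<i> / 6) * \<tau>)) (- (1/12) * exp (- (of_real pi * \<i> / 6) * \<tau>)) \<tau>"
    unfolding has_qderiv_def by (auto intro!: derivative_eq_intros)
  from has_qderiv_mult[OF has_qderiv_divide[OF eta3_qderiv(1)[OF \<tau>] eta_qderiv[OF \<tau>] nz] this]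
  have 1: "has_qderiv (\<lambda>\<tau>. eta_ratio (nome \<tau>)) ((eta3_logderiv \<tau> * dedekind_eta (3 * \<tau>) * dedekind_eta \<tau> -
       dedekind_eta (3 * \<tau>) * (eta_logderiv \<tau> * dedekind_eta \<tau>)) / (dedekind_eta \<tau>)\<^sup>2 * exp (- (of_real pi * \<i> / 6) * \<tau>) +
       dedekind_eta (3 * \<tau>) / dedekind_eta \<tau> * (- (1/12) * exp (- (of_real pi * \<i> / 6) * \<tau>))) \<tau>"
    (is "has_qderiv _ ?d _") unfolding eta_ratio_nome .
  have "?d = eta_ratio (nome \<tau>) * (eta3_logderiv \<tau> - eta_logderiv \<tau> - 1 / 12)"
    unfolding eta_ratio_nome using nz by (simp add: field_simps power2_eq_square)
  also have "\<dots> = eta_ratio q * (?a\<^sup>2 - 1) / 12"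
    unfolding level3_system(1)[OF \<tau>] q by (simp add: field_simps)
  finally have d: "?d = eta_ratio q * (?a\<^sup>2 - 1) / 12" .
  from has_qderiv_nome_imp[OF 1] have "(eta_ratio has_field_derivative ?d / q) (at q)" unfolding q .
  hence "deriv eta_ratio q = ?d / q" by (rule DERIV_imp_deriv)
  thus ?thesis using False unfolding d by (simp add: cubic_a_tau_def q)
qed

text \<open>From b = \<eta>(\<tau>)^3/\<eta>(3\<tau>) the left side is 3 D log \<eta>(\<tau>) - D
  log \<eta>(3\<tau>); the relation between the two logarithmic derivatives removes the
  first.\<close>

lemma cubic_rho_nome:
  assumes \<tau>: "Im \<tau> > 0"
  shows "cubic_rho (nome \<tau>) = 2 * eta3_logderiv \<tau> - (cubic_a_tau \<tau>)\<^sup>2 / 4"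
proof -
  let ?q = "nome \<tau>"
  have nz: "dedekind_eta \<tau> \<noteq> 0" "dedekind_eta (3 * \<tau>) \<noteq> 0" using dedekind_eta_nz[of \<tau>] dedekind_eta_nz[of "3 * \<tau>"] \<tau> by auto
  have "has_qderiv (\<lambda>\<tau>. cubic_b (nome \<tau>)) ((of_nat 3 * dedekind_eta \<tau> ^ (3 - 1) * (eta_logderiv \<tau> * dedekind_eta \<tau>) * dedekind_eta (3 * \<tau>)
      - dedekind_eta \<tau> ^ 3 * (eta3_logderiv \<tau> * dedekind_eta (3 * \<tau>))) / (dedekind_eta (3 * \<tau>))\<^sup>2) \<tau>"
    unfolding cubic_b_nome
    by (rule has_qderiv_divide[OF has_qderiv_power[OF eta_qderiv[OF \<tau>]] eta3_qderiv(1)[OF \<tau>] nz(2)])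
  also have "(of_nat 3 * dedekind_eta \<tau> ^ (3 - 1) * (eta_logderiv \<tau> * dedekind_eta \<tau>) * dedekind_eta (3 * \<tau>)
      - dedekind_eta \<tau> ^ 3 * (eta3_logderiv \<tau> * dedekind_eta (3 * \<tau>))) / (dedekind_eta (3 * \<tau>))\<^sup>2
      = cubic_b ?q * (3 * eta_logderiv \<tau> - eta3_logderiv \<tau>)"
    unfolding cubic_b_nome using nz by (simp add: field_simps power2_eq_square power3_eq_cube)
  finally have "(cubic_b has_field_derivative cubic_b ?q * (3 * eta_logderiv \<tau> - eta3_logderiv \<tau>) / ?q) (at ?q)"
    by (rule has_qderiv_nome_imp)
  hence "deriv cubic_b ?q = cubic_b ?q * (3 * eta_logderiv \<tau> - eta3_logderiv \<tau>) / ?q" by (rule DERIV_imp_deriv)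
  hence "cubic_rho ?q = 3 * eta_logderiv \<tau> - eta3_logderiv \<tau>"
    using cubic_b_nz[of ?q] \<tau> by (simp add: cubic_rho_def)
  also have "eta_logderiv \<tau> = eta3_logderiv \<tau> - (cubic_a_tau \<tau>)\<^sup>2 / 12"
    unfolding level3_system(1)[OF \<tau>, symmetric] by simp
  finally show ?thesis by (simp add: algebra_simps)
qed

lemma cubic_a_deriv_nz:
  assumes "norm q < 1" "q \<noteq> 0"
  shows "(cubic_a has_field_derivative (cubic_a q * cubic_rho q + (cubic_a q ^ 3 - cubic_b q ^ 3) / 3) / q) (at q)"
    and "(cubic_rho has_field_derivative ((cubic_rho q)\<^sup>2 - cubic_a q * (cubic_a q ^ 3 - cubic_b q ^ 3) / 9) / q) (at q)"
proof -
  obtain \<tau> where \<tau>: "Im \<tau> > 0" and q: "q = nome \<tau>" using nome_surj assms by blast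
  define r where "r = eta3_logderiv \<tau>"
  have rho: "cubic_rho q = 2 * r - (cubic_a q)\<^sup>2 / 4"
    unfolding q cubic_rho_nome[OF \<tau>] r_def cubic_a_tau_def ..
  have b3: "dedekind_eta \<tau> ^ 9 / dedekind_eta (3 * \<tau>) ^ 3 = cubic_b q ^ 3"
    unfolding q cubic_b_nome by (simp add: power_divide flip: power_mult)
  note L = level3_system(2,3)[OF \<tau>, unfolded b3 r_def[symmetric]]
  define a' where "a' = cubic_a q * (2 * r + (cubic_a q)\<^sup>2 / 12) - cubic_b q ^ 3 / 3"
  have a: "cubic_a_tau \<tau> = cubic_a q" by (simp add: cubic_a_tau_def q)
  have "has_qderiv (\<lambda>\<tau>. cubic_a (nome \<tau>)) a' \<tau>"
    using L(1) unfolding a a'_def unfolding cubic_a_tau_def[abs_def] .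
  from has_qderiv_nome_imp[OF this] have "(cubic_a has_field_derivative a' / q) (at q)" unfolding q .
  moreover have "a' = cubic_a q * cubic_rho q + (cubic_a q ^ 3 - cubic_b q ^ 3) / 3"
    unfolding a'_def rho by (simp add: field_simps power2_eq_square power3_eq_cube)
  ultimately show "(cubic_a has_field_derivative (cubic_a q * cubic_rho q + (cubic_a q ^ 3 - cubic_b q ^ 3) / 3) / q) (at q)"
    by simp
  have "has_qderiv (\<lambda>\<tau>. 2 * eta3_logderiv \<tau> - (1/4) * cubic_a_tau \<tau> ^ 2)
     (2 * (2 * r\<^sup>2 - (cubic_a q)\<^sup>2 * r / 6 + cubic_a q * a' / 12 - cubic_a q ^ 4 / 96) - (1/4) * (of_nat 2 * cubic_a q ^ (2 - 1) * a')) \<tau>"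
    using has_qderiv_diff[OF has_qderiv_cmult[OF L(2), of 2] has_qderiv_cmult[OF has_qderiv_power[OF L(1), of 2], of "1/4"]]
    unfolding a a'_def .
  hence "has_qderiv (\<lambda>\<tau>. cubic_rho (nome \<tau>)) 
     (2 * (2 * r\<^sup>2 - (cubic_a q)\<^sup>2 * r / 6 + cubic_a q * a' / 12 - cubic_a q ^ 4 / 96) - (1/4) * (of_nat 2 * cubic_a q ^ (2 - 1) * a')) \<tau>"
    (is "has_qderiv _ ?d _") by (rule has_qderiv_cong[OF _ \<tau>]) (simp add: cubic_rho_nome)
  from has_qderiv_nome_imp[OF this] have "(cubic_rho has_field_derivative ?d / q) (at q)" unfolding q .
  moreover have "?d = (cubic_rho q)\<^sup>2 - cubic_a q * (cubic_a q ^ 3 - cubic_b q ^ 3) / 9"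
    unfolding a'_def rho by (simp add: field_simps power2_eq_square power3_eq_cube power4_eq_xxxx)
  ultimately show "(cubic_rho has_field_derivative ((cubic_rho q)\<^sup>2 - cubic_a q * (cubic_a q ^ 3 - cubic_b q ^ 3) / 9) / q) (at q)"
    by simp
qed

section \<open>The expansion of a(q) at the origin\<close>

lemma eisenstein_form_bounds:
  fixes m n :: int
  shows "2 * (m\<^sup>2 + m * n + n\<^sup>2) \<ge> m\<^sup>2 + n\<^sup>2" "m\<^sup>2 + m * n + n\<^sup>2 \<ge> 0" "2 * (m\<^sup>2 + m * n + n\<^sup>2) \<ge> \<bar>m\<bar> + \<bar>n\<bar>"
proof -
  have "(m + n)\<^sup>2 \<ge> 0" by simp
  thus 1: "2 * (m\<^sup>2 + m * n + n\<^sup>2) \<ge> m\<^sup>2 + n\<^sup>2" by (simp add: power2_eq_square algebra_simps)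
  have "m\<^sup>2 \<ge> 0" "n\<^sup>2 \<ge> 0" by simp_all
  hence "0 \<le> 2 * (m\<^sup>2 + m * n + n\<^sup>2)" using 1 order_trans add_nonneg_nonneg by blast
  thus "m\<^sup>2 + m * n + n\<^sup>2 \<ge> 0" by simp
  have "\<bar>k\<bar> \<le> k\<^sup>2" for k :: int
    using self_le_power[of "\<bar>k\<bar>" 2] by (cases "k = 0") auto
  from this[of m] this[of n] 1 show "2 * (m\<^sup>2 + m * n + n\<^sup>2) \<ge> \<bar>m\<bar> + \<bar>n\<bar>" by linarith
qed

lemma eisenstein_form_eq_0_iff: "m\<^sup>2 + m * n + n\<^sup>2 = 0 \<longleftrightarrow> m = 0 \<and> n = (0::int)"
  using eisenstein_form_bounds(3)[of m n] by auto

lemma eisenstein_form_eq_1_iff: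
  "m\<^sup>2 + m * n + n\<^sup>2 = 1 \<longleftrightarrow> (m, n) \<in> {(1, 0), (-1, 0), (0, 1), (0, -1), (1, -1), (-1, 1 :: int)}"
proof
  assume "m\<^sup>2 + m * n + n\<^sup>2 = 1"
  moreover from this have "\<bar>m\<bar> \<le> 2" "\<bar>n\<bar> \<le> 2" using eisenstein_form_bounds(3)[of m n] by auto
  hence "m \<in> {-2, -1, 0, 1, 2}" "n \<in> {-2, -1, 0, 1, 2}" by auto
  ultimately show "(m, n) \<in> {(1, 0), (-1, 0), (0, 1), (0, -1), (1, -1), (-1, 1 :: int)}" by auto
qed auto

text \<open>Since q = 0 is not of the form exp(2 \<pi> i \<tau>), the derivative of a(q) there has
  to come from the double series. The form takes the value 1 at the six units of the Eisenstein
  lattice. For |q| at most exp(-2) the bound 2 Q(m, n) \<ge> |m| + |n| yields the majorant exp(-|m|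
  - |n|).\<close>

lemma cubic_a_approx:
  obtains K where "\<And>q. norm q \<le> exp (- 2) \<Longrightarrow> norm (cubic_a q - 1 - 6 * q) \<le> K * norm q ^ 2"
proof -
  define Q where "Q = (\<lambda>(m, n). m\<^sup>2 + m * n + n\<^sup>2 :: int)"
  define e where "e = (\<lambda>(m::int, n::int). exp (- \<bar>real_of_int m\<bar>) * exp (- \<bar>real_of_int n\<bar>))"
  define S where "S = {(1, 0), (-1, 0), (0, 1), (0, -1), (1, -1), (-1 :: int, 1 :: int)}"
  have se: "e summable_on UNIV"
  proof -
    have "(\<lambda>n::int. norm (complex_of_real (exp (- \<bar>real_of_int n\<bar>)))) summable_on UNIV"
      using summable_on_exp_neg_abs by simp
    from norm_summable_times[OF this this] show ?thesis
      by (simp add: e_def case_prod_unfold norm_mult)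
  qed
  define K where "K = exp 4 * infsum e UNIV"
  have "norm (cubic_a q - 1 - 6 * q) \<le> K * norm q ^ 2" if q: "norm q \<le> exp (- 2)" for q
  proof -
    define f where "f p = q powi Q p" for p
    have Q0: "Q p \<ge> 0" for p using eisenstein_form_bounds(2) by (auto simp: Q_def split: prod.split)
    have f_nat: "f p = q ^ nat (Q p)" for p
      using Q0[of p] by (simp add: f_def power_int_def)
    have le: "norm q ^ nat (Q p) \<le> exp 0 * e p" for p
    proof -
      obtain m n where p: "p = (m, n)" by force
      have "norm q ^ nat (Q p) \<le> exp (- 2) ^ nat (Q p)" by (intro power_mono q) auto
      also have "\<dots> = exp (- 2 * real_of_int (Q p))"
        using Q0[of p] by (simp flip: exp_of_nat_mult)
      also have "\<dots> \<le> exp (- \<bar>real_of_int m\<bar> + - \<bar>real_of_int n\<bar>)"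
      proof -
        have "\<bar>real_of_int m\<bar> + \<bar>real_of_int n\<bar> \<le> 2 * real_of_int (Q p)"
          using eisenstein_form_bounds(3)[of m n] unfolding p Q_def prod.case by linarith
        thus ?thesis by simp
      qed
      finally show ?thesis by (simp add: e_def p flip: exp_add)
    qed
    have le2: "norm (f p) \<le> (exp 4 * norm q ^ 2) * e p" if "p \<notin> insert (0, 0) S" for p
    proof -
      obtain m n where p: "p = (m, n)" by force
      have "Q p \<noteq> 0" "Q p \<noteq> 1" using that eisenstein_form_eq_0_iff[of m n] eisenstein_form_eq_1_iff[of m n]
        unfolding p Q_def S_def by auto
      hence "nat (Q p) = nat (Q p) - 2 + 2" using Q0[of p] by linarith
      hence "norm (f p) = norm q ^ (nat (Q p) - 2) * norm q ^ 2"
        unfolding f_nat norm_power by (metis power_add)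
      also have "norm q ^ (nat (Q p) - 2) \<le> exp (- 2) ^ (nat (Q p) - 2)" by (intro power_mono q) auto
      \<comment> \<open>Pulling out |q|^2 leaves the exponent Q - 2; the factor exp 4 restores the
        full exponent Q, so that the majorant \<open>e\<close> applies.\<close>
      also have "exp (- 2) ^ (nat (Q p) - 2) = exp 4 * exp (- 2 * real_of_int (Q p))"
      proof -
        have "real (nat (Q p) - 2) = real_of_int (Q p) - 2" using \<open>nat (Q p) = nat (Q p) - 2 + 2\<close> Q0[of p] by linarith
        thus ?thesis by (simp add: algebra_simps flip: exp_of_nat_mult exp_add)
      qed
      also have "exp (- 2 * real_of_int (Q p)) \<le> e p"
      proof -
        have "\<bar>real_of_int m\<bar> + \<bar>real_of_int n\<bar> \<le> 2 * real_of_int (Q p)"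
          using eisenstein_form_bounds(3)[of m n] unfolding p Q_def prod.case by linarith
        thus ?thesis by (simp add: e_def p flip: exp_add)
      qed
      finally show ?thesis by (simp add: mult_ac mult_right_mono)
    qed
    have sf: "(\<lambda>p. norm (f p)) summable_on UNIV"
      by (rule Infinite_Sum.abs_summable_on_comparison_test'[OF se]) (use le in \<open>simp add: f_nat norm_power\<close>)
    have sf': "(\<lambda>p. norm (f p)) summable_on A" for A
      by (rule summable_on_subset_banach[OF sf]) auto
    have fin: "finite (insert (0, 0) S)" by (simp add: S_def)
    have "cubic_a q = infsum f UNIV"
      by (simp add: cubic_a_def f_def[abs_def] Q_def case_prod_unfold)
    also have "UNIV = insert (0, 0) S \<union> - insert (0, 0) S" by auto
    also have "infsum f \<dots> = infsum f (insert (0, 0) S) + infsum f (- insert (0, 0) S)"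
      by (rule infsum_Un_disjoint) (use abs_summable_summable[OF sf'] in auto)
    also have "infsum f (insert (0, 0) S) = 1 + 6 * q"
      using fin by (simp add: infsum_finite) (simp add: S_def f_def Q_def)
    finally have "norm (cubic_a q - 1 - 6 * q) = norm (infsum f (- insert (0, 0) S))" by simp
    also have "\<dots> \<le> infsum (\<lambda>p. norm (f p)) (- insert (0, 0) S)"
      by (rule norm_infsum_bound) (use sf' in auto)
    also have "\<dots> \<le> infsum (\<lambda>p. (exp 4 * norm q ^ 2) * e p) UNIV"
      by (rule infsum_mono_neutral) (use sf' le2 se in \<open>auto intro!: summable_on_cmult_right simp: e_def\<close>)
    also have "\<dots> = K * norm q ^ 2"
      by (simp add: infsum_cmult_right' K_def)
    finally show ?thesis .
  qed
  thus ?thesis using that by blast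
qed

lemma cubic_a_0: "cubic_a 0 = 1"
proof -
  obtain K where K: "\<And>q. norm q \<le> exp (- 2) \<Longrightarrow> norm (cubic_a q - 1 - 6 * q) \<le> K * norm q ^ 2"
    by (rule cubic_a_approx) blast
  from K[of 0] show ?thesis by simp
qed

lemma cubic_a_deriv_0: "(cubic_a has_field_derivative 6) (at 0)"
proof -
  obtain K where K: "\<And>q. norm q \<le> exp (- 2) \<Longrightarrow> norm (cubic_a q - 1 - 6 * q) \<le> K * norm q ^ 2"
    by (rule cubic_a_approx) blast
  have "((\<lambda>q. (cubic_a q - 1) / q - 6) \<longlongrightarrow> 0) (at 0)"
  proof (rule Lim_null_comparison)
    have "eventually (\<lambda>q::complex. q \<in> ball 0 (exp (- 2)) - {0}) (at 0)"
      by (rule eventually_at_in_open) auto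
    thus "\<forall>\<^sub>F q in at 0. norm ((cubic_a q - 1) / q - 6) \<le> K * norm q"
    proof eventually_elim
      case (elim q)
      hence "(cubic_a q - 1) / q - 6 = (cubic_a q - 1 - 6 * q) / q" by (simp add: field_simps)
      thus ?case using K[of q] elim by (simp add: norm_divide power2_eq_square divide_le_eq mult.assoc)
    qed
    show "((\<lambda>q. K * norm q) \<longlongrightarrow> 0) (at (0::complex))"
      by (auto intro!: tendsto_eq_intros)
  qed
  hence "((\<lambda>q. (cubic_a q - 1) / q) \<longlongrightarrow> 6) (at 0)" by (simp add: LIM_zero_iff)
  thus ?thesis by (simp add: has_field_derivative_iff cubic_a_0)
qed

lemma holomorphic_cubic_a: "cubic_a holomorphic_on ball 0 1"
proof -
  have "cubic_a field_differentiable at q" if "norm q < 1" for q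
    using cubic_a_deriv_0 cubic_a_deriv_nz(1)[OF that] by (cases "q = 0") (auto simp: field_differentiable_def)
  thus ?thesis by (auto simp: holomorphic_on_def intro: field_differentiable_at_within)
qed

lemma cubic_b_0 [simp]: "cubic_b 0 = 1" and eta_ratio_0 [simp]: "eta_ratio 0 = 1" and cubic_rho_0 [simp]: "cubic_rho 0 = 0"
  by (simp_all add: cubic_b_def eta_ratio_def cubic_rho_def)

lemma cubic_a_deriv:
  assumes "norm q < 1"
  shows "q * deriv cubic_a q = cubic_a q * cubic_rho q + (cubic_a q ^ 3 - cubic_b q ^ 3) / 3"
  using DERIV_imp_deriv[OF cubic_a_deriv_nz(1)[OF assms]] by (cases "q = 0") (simp_all add: cubic_a_0)

lemma cubic_rho_deriv:
  assumes "norm q < 1"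
  shows "q * deriv cubic_rho q = (cubic_rho q)\<^sup>2 - cubic_a q * (cubic_a q ^ 3 - cubic_b q ^ 3) / 9"
  using DERIV_imp_deriv[OF cubic_a_deriv_nz(2)[OF assms]] by (cases "q = 0") (simp_all add: cubic_a_0)

lemma cubic_b_deriv:
  assumes "norm q < 1"
  shows "q * deriv cubic_b q = cubic_b q * cubic_rho q"
  using cubic_b_nz[OF assms] by (simp add: cubic_rho_def)

section \<open>Power series form of the differential system\<close>

definition A_fps where "A_fps = fps_expansion cubic_a 0"
definition B_fps where "B_fps = fps_expansion cubic_b 0"
definition R_fps where "R_fps = fps_expansion cubic_rho 0"
definition E_fps where "E_fps = fps_expansion eta_ratio 0"

lemma has_fps_expansion_of_holomorphic:
  "f holomorphic_on ball 0 1 \<Longrightarrow> f has_fps_expansion fps_expansion f 0"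
  by (rule has_fps_expansion_fps_expansion[of "ball 0 1"]) auto

lemmas expansions [fps_expansion_intros] =
  holomorphic_cubic_a[THEN has_fps_expansion_of_holomorphic, folded A_fps_def]
  holomorphic_cubic_b[THEN has_fps_expansion_of_holomorphic, folded B_fps_def]
  holomorphic_cubic_rho[THEN has_fps_expansion_of_holomorphic, folded R_fps_def]
  holomorphic_eta_ratio[THEN has_fps_expansion_of_holomorphic, folded E_fps_def]

lemma fps_eq_of_unit_disc_eq:
  assumes "f has_fps_expansion F" "g has_fps_expansion G" "\<And>q::complex. norm q < 1 \<Longrightarrow> f q = g q"
  shows "F = G"
proof -
  have "eventually (\<lambda>q. f q = g q) (nhds 0)"
    using eventually_nhds_in_open[of "ball 0 1" "0::complex"] assms(3) by (auto elim!: eventually_mono)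
  hence "g has_fps_expansion F" using assms(1) has_fps_expansion_cong[of f g F F] by simp
  thus ?thesis using assms(2) fps_expansion_unique_complex by blast
qed

lemma fps_init:
  "fps_nth A_fps 0 = 1" "fps_nth A_fps 1 = 6" "fps_nth B_fps 0 = 1" "fps_nth E_fps 0 = 1" "fps_nth R_fps 0 = 0"
  using DERIV_imp_deriv[OF cubic_a_deriv_0]
  by (simp_all add: A_fps_def B_fps_def E_fps_def R_fps_def fps_expansion_def cubic_a_0)

lemma fps_theta_A: "3 * fps_theta A_fps = 3 * (A_fps * R_fps) + (A_fps ^ 3 - B_fps ^ 3)"
  by (rule fps_eq_of_unit_disc_eq[of "\<lambda>q. 3 * (q * deriv cubic_a q)" _ "\<lambda>q. 3 * (cubic_a q * cubic_rho q) + (cubic_a q ^ 3 - cubic_b q ^ 3)"])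
     (auto intro!: fps_expansion_intros simp: cubic_a_deriv distrib_left)

lemma fps_theta_R: "9 * fps_theta R_fps = 9 * R_fps ^ 2 - A_fps * (A_fps ^ 3 - B_fps ^ 3)"
proof -
  have "9 * (x - y / 9) = 9 * x - y" for x y :: complex by simp
  thus ?thesis
  by (intro fps_eq_of_unit_disc_eq[of "\<lambda>q. 9 * (q * deriv cubic_rho q)" _ "\<lambda>q. 9 * cubic_rho q ^ 2 - cubic_a q * (cubic_a q ^ 3 - cubic_b q ^ 3)"])
     (auto intro!: fps_expansion_intros simp: cubic_rho_deriv)
qed

lemma fps_theta_B: "fps_theta B_fps = B_fps * R_fps"
  by (rule fps_eq_of_unit_disc_eq[of "\<lambda>q. q * deriv cubic_b q" _ "\<lambda>q. cubic_b q * cubic_rho q"])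
     (auto intro!: fps_expansion_intros simp: cubic_b_deriv)

lemma fps_theta_E: "12 * fps_theta E_fps = E_fps * (A_fps ^ 2 - 1)"
  by (rule fps_eq_of_unit_disc_eq[of "\<lambda>q. 12 * (q * deriv eta_ratio q)" _ "\<lambda>q. eta_ratio q * (cubic_a q ^ 2 - 1)"])
     (auto intro!: fps_expansion_intros simp: eta_ratio_deriv)

text \<open>The equal constant terms give agreement modulo X, and each step shows that the quotients
  of the differences again vanish at 0. Hence the solutions agree modulo every power of X.\<close>

lemma modular_relations_unique:
  fixes H m v d s z k v' d' s' z' k' :: "complex fps"
  assumes rel: "modular_relations l H m v d s z k" "modular_relations l H m v' d' s' z' k'"
    and l: "l \<ge> 2" and H: "H = fps_X * h" and m: "fps_nth m 0 = 1"
    and init: "fps_nth v 0 = 1" "fps_nth d 0 = of_nat l - 1" "fps_nth s 0 = 0" "fps_nth z 0 = 1 - of_nat l" "fps_nth k 0 = 1"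
    and init': "fps_nth v' 0 = 1" "fps_nth d' 0 = of_nat l - 1" "fps_nth s' 0 = 0" "fps_nth z' 0 = 1 - of_nat l" "fps_nth k' 0 = 1"
    and p: "v' - k' = fps_X * p" "fps_nth p 0 = 27 / (of_nat l + 1)"
    and g: "d' * v' + z' = fps_X * g" "fps_nth g 0 = - 27"
    and v1: "fps_nth v 1 = fps_nth v' 1"
  shows "v = v'" and "d = d'"
proof -
  have divX: "f = fps_X * fps_shift 1 f" if "fps_nth f 0 = 0" for f :: "complex fps"
    using that by (intro fps_ext) (auto simp: fps_X_mult_nth)
  have diffX: "\<exists>e. f = f' + fps_X ^ 1 * e" if "fps_nth f 0 = fps_nth f' 0" for f f' :: "complex fps"
    using divX[of "f - f'"] that by (intro exI[of _ "fps_shift 1 (f - f')"]) (simp add: algebra_simps)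
  let ?P = "\<lambda>n. \<exists>ev ed es ez ek. v = v' + fps_X ^ n * ev \<and> d = d' + fps_X ^ n * ed \<and> s = s' + fps_X ^ n * es \<and>
      z = z' + fps_X ^ n * ez \<and> k = k' + fps_X ^ n * ek"
  have P: "?P (Suc n)" for n
  proof (induction n)
    case 0
    show ?case using diffX[of v v'] diffX[of d d'] diffX[of s s'] diffX[of z z'] diffX[of k k'] init init'
      unfolding One_nat_def by simp
  next
    case (Suc n)
    then obtain ev ed es ez ek where e: "v = v' + fps_X ^ Suc n * ev" "d = d' + fps_X ^ Suc n * ed" "s = s' + fps_X ^ Suc n * es"
      "z = z' + fps_X ^ Suc n * ez" "k = k' + fps_X ^ Suc n * ek" by blast
    have "fps_nth ev 0 = 0 \<and> fps_nth ed 0 = 0 \<and> fps_nth es 0 = 0 \<and> fps_nth ez 0 = 0 \<and> fps_nth ek 0 = 0"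
      by (rule modular_relations_unique_step[OF rel l H m init' p g _ v1 e]) simp
    hence "ev = fps_X * fps_shift 1 ev" "ed = fps_X * fps_shift 1 ed" "es = fps_X * fps_shift 1 es"
      "ez = fps_X * fps_shift 1 ez" "ek = fps_X * fps_shift 1 ek" using divX by blast+
    moreover have "fps_X ^ Suc n * (fps_X * f) = fps_X ^ Suc (Suc n) * (f :: complex fps)" for f
      by (simp add: mult_ac)
    ultimately show ?case using e by metis
  qed
  show "v = v'"
  proof (rule fps_ext)
    fix n
    obtain e where "v = v' + fps_X ^ Suc n * e" using P[of n] by blast
    thus "fps_nth v n = fps_nth v' n" by (simp add: fps_X_power_mult_nth del: power_Suc)
  qed
  show "d = d'"
  proof (rule fps_ext)
    fix n
    obtain e where "d = d' + fps_X ^ Suc n * e" using P[of n] by blast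
    thus "fps_nth d n = fps_nth d' n" by (simp add: fps_X_power_mult_nth del: power_Suc)
  qed
qed

lemma fps_theta_add: "fps_theta (f + g) = fps_theta f + fps_theta g"
  and fps_theta_diff: "fps_theta (f - g) = fps_theta f - fps_theta g"
  and fps_theta_mult: "fps_theta (f * g) = fps_theta f * g + f * fps_theta g"
  by (simp_all add: algebra_simps)

lemma fps_theta_power: "fps_theta (f ^ n) = of_nat n * f ^ (n - 1) * fps_theta f"
  by (induction n) (auto simp: algebra_simps power_eq_if)

lemma fps_theta_nth: "fps_nth (fps_theta f) n = of_nat n * fps_nth f n"
  by (cases n) simp_all

text \<open>This is a^3 = b^3 + c^3, with c^3 written as 27 q E^12 b^3 for the eta quotient E. Both
  sides have the same logarithmic derivative once the factor q is taken into account: the quotient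
  \<open>Y\<close> satisfies D Y = Y, which forces a constant times X.\<close>

lemma A3_minus_B3: "A_fps ^ 3 - B_fps ^ 3 = 27 * (fps_X * E_fps ^ 12 * B_fps ^ 3)"
proof -
  define Z where "Z = A_fps ^ 3 - B_fps ^ 3"
  define W where "W = E_fps ^ 12 * B_fps ^ 3"
  define Y where "Y = Z * inverse W"
  have W0: "fps_nth W 0 = 1" using fps_init by (simp add: W_def fps_power_zeroth)
  have YW: "Y * W = Z"
    using inverse_mult_eq_1[of W] W0 by (simp add: Y_def mult.assoc)
  have tA: "3 * fps_theta A_fps = 3 * (A_fps * R_fps) + Z" unfolding Z_def by (rule fps_theta_A)
  have tZ: "fps_theta Z = Z * (3 * R_fps + A_fps ^ 2)"
  proof -
    have "fps_theta Z = A_fps ^ 2 * (3 * fps_theta A_fps) - 3 * B_fps ^ 2 * fps_theta B_fps"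
      unfolding Z_def fps_theta_diff fps_theta_power by simp
    also have "\<dots> = Z * (3 * R_fps + A_fps ^ 2)"
      unfolding tA fps_theta_B unfolding Z_def by (simp add: algebra_simps power2_eq_square power3_eq_cube)
    finally show ?thesis .
  qed
  have tW: "fps_theta W = W * (A_fps ^ 2 - 1 + 3 * R_fps)"
  proof -
    have "fps_theta W = E_fps ^ 11 * (12 * fps_theta E_fps) * B_fps ^ 3 + E_fps ^ 12 * (3 * B_fps ^ 2 * fps_theta B_fps)"
      unfolding W_def fps_theta_mult fps_theta_power by simp
    also have "\<dots> = W * (A_fps ^ 2 - 1 + 3 * R_fps)"
      unfolding fps_theta_E fps_theta_B W_def by (simp add: algebra_simps eval_nat_numeral)
    finally show ?thesis .
  qed
  have "fps_theta Y * W = Y * W"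
  proof -
    have "fps_theta Y * W = fps_theta Z - Y * fps_theta W"
      unfolding YW[symmetric] fps_theta_mult by simp
    also have "\<dots> = Z * (3 * R_fps + A_fps ^ 2) - (Y * W) * (A_fps ^ 2 - 1 + 3 * R_fps)"
      unfolding tZ tW by (simp only: mult.assoc)
    also have "\<dots> = Y * W"
      unfolding YW by (simp add: algebra_simps)
    finally show ?thesis .
  qed
  hence tY: "fps_theta Y = Y" using W0 by auto
  have Y_nth: "fps_nth Y n = 0" if "n \<noteq> 1" for n
    using arg_cong[OF tY, of "\<lambda>f. fps_nth f n"] that by (simp only: fps_theta_nth) simp
  \<comment> \<open>The constant is found without expanding b: D b = b \<rho> and the equation for D
    \<rho> give b_1 = \<rho>_1 = -Z_1/9. Inserting this into Z_1 = 3 * 6 - 3 b_1 leaves Z_1 =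
    27.\<close>
  have Z1: "fps_nth Z 1 = 3 * fps_nth A_fps 1 - 3 * fps_nth B_fps 1"
    using fps_init by (simp add: Z_def power3_eq_cube fps_mult_nth_1)
  have Z0: "fps_nth Z 0 = 0" using fps_init by (simp add: Z_def fps_power_zeroth)
  have "fps_nth B_fps 1 = fps_nth R_fps 1"
    using arg_cong[OF fps_theta_B, of "\<lambda>f. fps_nth f 1"] fps_init unfolding fps_theta_nth by (simp add: fps_mult_nth_1)
  moreover have "9 * fps_nth R_fps 1 = - fps_nth Z 1"
  proof -
    have "9 * fps_theta R_fps = 9 * R_fps ^ 2 - A_fps * Z" unfolding Z_def by (rule fps_theta_R)
    from arg_cong[OF this, of "\<lambda>f. fps_nth f 1"] show ?thesis
      using fps_init Z0 by (simp add: fps_mult_nth_1 power2_eq_square fps_numeral_nth fps_theta_nth)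
  qed
  ultimately have "fps_nth Z 1 = 27" using Z1 fps_init by simp
  moreover have "fps_nth Z 1 = fps_nth Y 1"
    using W0 Y_nth[of 0] by (simp add: YW[symmetric] fps_mult_nth_1)
  ultimately have Y1: "fps_nth Y 1 = 27" by simp
  have "Y = fps_const 27 * fps_X"
  proof (rule fps_ext)
    fix n show "fps_nth Y n = fps_nth (fps_const 27 * fps_X) n"
      using Y_nth[of n] Y1 by (cases "n = 1") auto
  qed
  hence "Y = 27 * fps_X" by (simp add: numeral_fps_const)
  with YW show ?thesis unfolding Z_def W_def by (simp add: mult_ac)
qed

lemma B_nth_1: "fps_nth B_fps 1 = - 3"
proof -
  have "fps_nth (A_fps ^ 3 - B_fps ^ 3) 1 = 27"
    unfolding A3_minus_B3 using fps_init by (simp add: fps_mult_nth_1 fps_numeral_nth fps_power_zeroth)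
  hence "3 * 6 - 3 * fps_nth B_fps 1 = 27" using fps_init by (simp add: power3_eq_cube fps_mult_nth_1)
  hence "3 * (fps_nth B_fps 1 + 3) = 0" by (simp add: algebra_simps)
  thus ?thesis unfolding mult_eq_0_iff eq_neg_iff_add_eq_0 by simp
qed

section \<open>Degree l\<close>

text \<open>The eta quotient inside H has order (l + 1)/12 in q, so its e-th power has order exactly
  1: H is q times a unit power series.\<close>

locale cubic_degree =
  fixes l e :: nat
  assumes l: "l \<ge> 2" and le: "(l + 1) * e = 12"
begin

text \<open>Primes denote images under q to q^l. With a of weight 1, the quantities
  \<open>v\<close>, \<open>d\<close>, \<open>s\<close>, \<open>k\<close>, \<open>z\<close> all have
  weight 0. In \<open>s\<close> the difference l \<rho>' - \<rho> is D log(b'/b), so the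
  quasimodular parts cancel. The inverses exist because the constant terms of \<open>\<beta>\<close>
  and \<open>K\<close> are 1 and l + 1.\<close>

definition "lc = (of_nat l :: complex fps)"
definition "sub F = F oo (fps_X ^ l :: complex fps)"
definition "A' = sub A_fps"
definition "B' = sub B_fps"
definition "R' = sub R_fps"
definition "E' = sub E_fps"
definition "Z = A_fps ^ 3 - B_fps ^ 3"
definition "Z' = A' ^ 3 - B' ^ 3"
definition "H = fps_X * (E_fps * E') ^ e"
definition "\<beta> = B_fps * B'"
definition "\<beta>i = inverse \<beta>"
definition "K = A_fps ^ 2 + lc * A' ^ 2"
definition "Ki = inverse K"
definition "m = K * fps_const (1 / (of_nat l + 1))"
definition "v = A_fps * A' * \<beta>i"
definition "d = (lc * A' ^ 2 - A_fps ^ 2) * \<beta>i"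
definition "s = (lc * R' - R_fps) * \<beta>i"
definition "k = (B_fps ^ 3 * A' + lc * B' ^ 3 * A_fps) * \<beta>i * Ki"
definition "z = (B_fps ^ 3 * A' - lc * B' ^ 3 * A_fps) * \<beta>i ^ 2"

lemma Xl0: "fps_nth (fps_X ^ l :: complex fps) 0 = 0"
  using l by (simp add: fps_power_zeroth)

lemma sub_mult: "sub (F * G) = sub F * sub G"
  and sub_add: "sub (F + G) = sub F + sub G"
  and sub_diff: "sub (F - G) = sub F - sub G"
  and sub_power: "sub (F ^ n) = sub F ^ n"
  and sub_numeral: "sub (numeral w) = numeral w"
  and sub_1: "sub 1 = 1"
  and sub_X: "sub fps_X = fps_X ^ l"
  and sub_nth_0: "fps_nth (sub F) 0 = fps_nth F 0"
  unfolding sub_def using Xl0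
  by (simp_all add: fps_compose_mult_distrib fps_compose_add_distrib fps_compose_sub_distrib fps_compose_power)

lemma sub_nth_1: "fps_nth (sub F) 1 = 0"
  using l by (simp add: sub_def fps_compose_nth fps_X_power_nth)

lemma theta_sub: "fps_theta (sub F) = lc * sub (fps_theta F)"
proof -
  have *: "fps_X * fps_deriv (fps_X ^ l :: complex fps) = lc * fps_X ^ l"
    using fps_theta_X_power_mult[of l 1] by (simp add: lc_def mult.commute)
  have "fps_X * (sub (fps_deriv F) * fps_deriv (fps_X ^ l)) = sub (fps_deriv F) * (lc * fps_X ^ l)"
    by (subst mult.left_commute) (simp only: *)
  thus ?thesis
    unfolding sub_mult sub_X unfolding sub_def by (simp add: fps_compose_deriv[OF Xl0] mult_ac)
qed

lemma unit0: "fps_nth A_fps 0 = 1" "fps_nth B_fps 0 = 1" "fps_nth E_fps 0 = 1" "fps_nth R_fps 0 = 0"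
  "fps_nth A' 0 = 1" "fps_nth B' 0 = 1" "fps_nth E' 0 = 1" "fps_nth R' 0 = 0" "fps_nth lc 0 = of_nat l"
  using fps_init by (simp_all add: A'_def B'_def E'_def R'_def sub_nth_0 lc_def fps_of_nat)

lemma \<beta>i: "\<beta>i * \<beta> = 1" and Ki: "Ki * K = 1" and \<beta>i0: "fps_nth \<beta>i 0 = 1"
proof -
  have "of_nat l + 1 \<noteq> (0 :: complex)"
    by (metis of_nat_Suc of_nat_eq_0_iff nat.distinct(1) add.commute)
  thus "\<beta>i * \<beta> = 1" "Ki * K = 1" "fps_nth \<beta>i 0 = 1"
    by (auto simp: \<beta>i_def Ki_def \<beta>_def K_def unit0 fps_power_zeroth add.commute intro!: inverse_mult_eq_1)
qed

lemma theta_A: "3 * fps_theta A_fps = 3 * (A_fps * R_fps) + Z"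
  unfolding Z_def by (rule fps_theta_A)

lemma theta_A': "3 * fps_theta A' = lc * (3 * (A' * R') + Z')"
proof -
  have "3 * fps_theta A' = lc * sub (3 * fps_theta A_fps)"
    unfolding A'_def theta_sub sub_mult[of 3] sub_numeral by (simp only: mult.left_commute)
  thus ?thesis unfolding fps_theta_A sub_add sub_diff sub_mult sub_power sub_numeral
    unfolding A'_def[symmetric] B'_def[symmetric] R'_def[symmetric] Z'_def[symmetric] .
qed

lemma theta_R: "9 * fps_theta R_fps = 9 * R_fps ^ 2 - A_fps * Z"
  unfolding Z_def by (rule fps_theta_R)

lemma theta_R': "9 * fps_theta R' = lc * (9 * R' ^ 2 - A' * Z')"
proof -
  have "9 * fps_theta R' = lc * sub (9 * fps_theta R_fps)"
    unfolding R'_def theta_sub sub_mult[of 9] sub_numeral by (simp only: mult.left_commute)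
  thus ?thesis unfolding fps_theta_R sub_add sub_diff sub_mult sub_power sub_numeral
    unfolding A'_def[symmetric] B'_def[symmetric] R'_def[symmetric] Z'_def[symmetric] .
qed

lemma theta_B': "fps_theta B' = lc * (B' * R')"
  unfolding B'_def theta_sub fps_theta_B sub_mult R'_def ..

lemma theta_E': "12 * fps_theta E' = lc * (E' * (A' ^ 2 - 1))"
proof -
  have "12 * fps_theta E' = lc * sub (12 * fps_theta E_fps)"
    unfolding E'_def theta_sub sub_mult[of 12] sub_numeral by (simp only: mult.left_commute)
  thus ?thesis unfolding fps_theta_E sub_add sub_diff sub_mult sub_power sub_numeral sub_1
    unfolding A'_def[symmetric] E'_def[symmetric] .
qed

lemma theta_\<beta>: "fps_theta \<beta> = \<beta> * (R_fps + lc * R')"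
  unfolding \<beta>_def fps_theta_mult fps_theta_B theta_B' by (simp add: algebra_simps)

lemma theta_lc: "fps_theta lc = 0"
  by (simp add: lc_def)

lemma theta_\<beta>i: "fps_theta \<beta>i = - \<beta>i * (R_fps + lc * R')"
proof -
  have "fps_theta \<beta>i * \<beta> + \<beta>i * fps_theta \<beta> = 0"
    using arg_cong[OF \<beta>i, of fps_theta] unfolding fps_theta_mult by simp
  hence "fps_theta \<beta>i * \<beta> + (\<beta>i * \<beta>) * (R_fps + lc * R') = 0"
    unfolding theta_\<beta> by (simp only: mult.assoc)
  hence "(fps_theta \<beta>i * \<beta> + (R_fps + lc * R')) * \<beta>i = 0" unfolding \<beta>i by simp
  moreover have "(fps_theta \<beta>i * \<beta> + (R_fps + lc * R')) * \<beta>i = fps_theta \<beta>i * (\<beta>i * \<beta>) + \<beta>i * (R_fps + lc * R')"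
    by (simp add: algebra_simps)
  ultimately have "fps_theta \<beta>i * (\<beta>i * \<beta>) + \<beta>i * (R_fps + lc * R') = 0" by simp
  thus ?thesis unfolding \<beta>i by (simp add: eq_neg_iff_add_eq_0)
qed

lemma m_eq: "m * of_nat (l + 1) = K"
proof -
  have "of_nat l + 1 \<noteq> (0 :: complex)"
    by (metis of_nat_Suc of_nat_eq_0_iff nat.distinct(1) add.commute)
  hence "fps_const (1 / (of_nat l + 1)) * of_nat (l + 1) = (1 :: complex fps)"
    by (simp add: fps_of_nat[symmetric] fps_const_mult del: of_nat_add of_nat_Suc) (simp add: add.commute)
  thus ?thesis by (simp only: m_def mult.assoc) simp
qed

lemma m0: "fps_nth m 0 = 1"
proof -
  have "of_nat l + 1 \<noteq> (0 :: complex)"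
    by (metis of_nat_Suc of_nat_eq_0_iff nat.distinct(1) add.commute)
  thus ?thesis by (simp add: m_def K_def unit0 fps_power_zeroth add.commute)
qed

text \<open>The two eta quotients contribute e (a^2 - 1 + l (a'^2 - 1))/12 to D log H and the factor
  q contributes 1. Because e (l + 1) = 12 the constants cancel, leaving K/(l + 1).\<close>

lemma theta_H: "fps_theta H = H * m"
proof -
  have e0: "e \<noteq> 0" using le by (cases e) auto
  have "12 * fps_theta (E_fps * E') = E_fps * E' * (A_fps ^ 2 - 1 + lc * (A' ^ 2 - 1))"
  proof -
    have "12 * fps_theta (E_fps * E') = (12 * fps_theta E_fps) * E' + E_fps * (12 * fps_theta E')"
      by (simp only: fps_theta_mult distrib_left ac_simps)
    thus ?thesis unfolding fps_theta_E theta_E' by (simp add: algebra_simps)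
  qed
  moreover have "12 * fps_theta ((E_fps * E') ^ e) = of_nat e * (E_fps * E') ^ (e - 1) * (12 * fps_theta (E_fps * E'))"
    unfolding fps_theta_power by (simp only: ac_simps)
  ultimately have "12 * fps_theta ((E_fps * E') ^ e) = of_nat e * ((E_fps * E') ^ (e - 1) * (E_fps * E')) * (A_fps ^ 2 - 1 + lc * (A' ^ 2 - 1))"
    by (simp only: mult.assoc)
  also have "(E_fps * E') ^ (e - 1) * (E_fps * E') = (E_fps * E') ^ e"
    using e0 by (simp only: power_minus_mult) 
  finally have 1: "12 * fps_theta ((E_fps * E') ^ e) = of_nat e * (E_fps * E') ^ e * (K - of_nat (l + 1))"
    by (simp add: K_def lc_def algebra_simps)
  have "12 * fps_theta H = 12 * H + fps_X * (12 * fps_theta ((E_fps * E') ^ e))"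
    unfolding H_def fps_theta_mult by (simp add: algebra_simps)
  also have "\<dots> = 12 * H + H * of_nat e * (K - of_nat (l + 1))"
    unfolding 1 H_def by (simp only: ac_simps)
  also have "\<dots> = H * of_nat e * of_nat (l + 1) * m + H * (12 - of_nat ((l + 1) * e))"
    unfolding m_eq[symmetric] of_nat_mult by (simp only: ring_distribs) (simp add: mult_ac)
  also have "\<dots> = H * of_nat ((l + 1) * e) * m + H * (12 - of_nat ((l + 1) * e))"
    by (simp only: of_nat_mult ac_simps)
  also have "\<dots> = 12 * (H * m)" unfolding le by simp
  finally show ?thesis by simp
qed

text \<open>With a^3 - b^3 = c^3 this is a formula for (c c')^3. The exponent 12 of the eta
  quotients splits as e (l + 1), which makes their product and q^(l+1) together a power of
  H.\<close>

lemma ZZ': "Z * Z' = 729 * H ^ (l + 1) * \<beta> ^ 3"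
proof -
  have "Z' = sub Z" unfolding Z'_def Z_def A'_def B'_def sub_diff sub_power ..
  also have "Z = 27 * (fps_X * E_fps ^ 12 * B_fps ^ 3)" unfolding Z_def by (rule A3_minus_B3)
  finally have "Z' = 27 * (fps_X ^ l * E' ^ 12 * B' ^ 3)"
    unfolding sub_mult sub_power sub_numeral sub_X E'_def B'_def by (simp only: mult.assoc)
  moreover have "((E_fps * E') ^ e) ^ (l + 1) = (E_fps * E') ^ 12"
    unfolding power_mult[symmetric] using le by (simp only: mult.commute)
  ultimately show ?thesis
    unfolding A3_minus_B3 Z_def[of] H_def \<beta>_def power_mult_distrib by (simp add: mult_ac power_add)
qed

lemma modular_relations_level3: "modular_relations l H m v d s z k"
proof -
  note ring = algebra_simps power2_eq_square power3_eq_cube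
  define P where "P = B_fps ^ 3 * A' + lc * B' ^ 3 * A_fps"
  define M where "M = B_fps ^ 3 * A' - lc * B' ^ 3 * A_fps"
  have Kk: "K * k = P * \<beta>i" unfolding k_def P_def using Ki by (simp add: mult_ac)
  have z: "z = M * \<beta>i ^ 2" unfolding z_def M_def ..
  have r1: "3 * fps_theta v = K * (v - k)"
  proof -
    have "3 * fps_theta v = (3 * fps_theta A_fps * A' + A_fps * (3 * fps_theta A')) * \<beta>i + 3 * A_fps * A' * fps_theta \<beta>i"
      unfolding v_def fps_theta_mult by (simp add: ring)
    also have "\<dots> = K * v - P * \<beta>i"
      unfolding theta_A theta_A' theta_\<beta>i unfolding Z_def Z'_def K_def v_def P_def by (simp add: ring)
    finally show ?thesis by (simp only: right_diff_distrib Kk)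
  qed
  have r2: "3 * v * fps_theta d = K * (3 * s * v + 2 * d * v - (d * k - z))"
  proof -
    have "3 * fps_theta d = (2 * lc * A' * (3 * fps_theta A') - 2 * A_fps * (3 * fps_theta A_fps)) * \<beta>i
        + 3 * (lc * A' ^ 2 - A_fps ^ 2) * fps_theta \<beta>i"
      unfolding d_def fps_theta_mult fps_theta_diff fps_theta_power theta_lc by (simp add: ring)
    hence "3 * v * fps_theta d = v * ((2 * lc * A' * (3 * fps_theta A') - 2 * A_fps * (3 * fps_theta A_fps)) * \<beta>i
        + 3 * (lc * A' ^ 2 - A_fps ^ 2) * fps_theta \<beta>i)"
      by (metis mult.assoc mult.commute)
    also have "\<dots> = K * (3 * s * v + 2 * d * v) - d * (P * \<beta>i) + K * z"
      unfolding theta_A theta_A' theta_\<beta>i z unfolding Z_def Z'_def K_def v_def P_def M_def d_def s_def by (simp add: ring)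
    also have "\<dots> = K * (3 * s * v + 2 * d * v - (d * k - z))"
      unfolding Kk[symmetric] by (simp add: ring)
    finally show ?thesis .
  qed
  have r3: "18 * v * fps_theta s = K * (- 2 * d * v + (d * k - z))"
  proof -
    have "9 * fps_theta s = (lc * (9 * fps_theta R') - 9 * fps_theta R_fps) * \<beta>i + 9 * (lc * R' - R_fps) * fps_theta \<beta>i"
      unfolding s_def fps_theta_mult fps_theta_diff theta_lc by (simp add: ring)
    hence "2 * v * (9 * fps_theta s) = 2 * v * ((lc * (9 * fps_theta R') - 9 * fps_theta R_fps) * \<beta>i + 9 * (lc * R' - R_fps) * fps_theta \<beta>i)"
      by (simp only:)
    also have "\<dots> = K * (- 2 * d * v) + d * (P * \<beta>i) - K * z"
      unfolding theta_R theta_R' theta_\<beta>i z unfolding Z_def Z'_def K_def v_def P_def M_def d_def by (simp add: ring)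
    also have "\<dots> = K * (- 2 * d * v + (d * k - z))"
      unfolding Kk[symmetric] by (simp add: ring)
    finally show ?thesis by (simp add: mult.assoc)
  qed
  \<comment> \<open>From (l a'^2 - a^2)^2 + 4 l a^2 a'^2 = (l a'^2 + a^2)^2.\<close>
  have dv: "d\<^sup>2 + 4 * lc * v\<^sup>2 = K ^ 2 * \<beta>i ^ 2"
    unfolding d_def v_def K_def by (simp add: ring)
  have \<beta>i3: "\<beta>i ^ 3 * \<beta> ^ 3 = 1"
    using \<beta>i by (simp flip: power_mult_distrib)
  have Hl: "729 * H ^ (l + 1) = Z * Z' * \<beta>i ^ 3"
  proof -
    have "Z * Z' * \<beta>i ^ 3 = 729 * H ^ (l + 1) * (\<beta>i ^ 3 * \<beta> ^ 3)" unfolding ZZ' by (simp only: ac_simps)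
    thus ?thesis unfolding \<beta>i3 by simp
  qed
  \<comment> \<open>The cross terms in P K + M (l a'^2 - a^2) cancel to 2 l (b^3 a'^3 + b'^3 a^3),
    and the bracket equals a^3 a'^3 + b^3 b'^3 - Z Z'.\<close>
  have r4: "k * (d\<^sup>2 + 4 * lc * v\<^sup>2) = 2 * lc * (v ^ 3 + 1 - 729 * H ^ (l + 1)) - d * z"
  proof -
    have "k * (d\<^sup>2 + 4 * lc * v\<^sup>2) = (K * k) * K * \<beta>i ^ 2"
      unfolding dv by (simp add: ring)
    also have "\<dots> = 2 * lc * (v ^ 3 + \<beta>i ^ 3 * \<beta> ^ 3 - Z * Z' * \<beta>i ^ 3) - d * z"
      unfolding Kk z unfolding P_def M_def K_def v_def d_def \<beta>_def Z_def Z'_def by (simp add: ring)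
    finally show ?thesis unfolding \<beta>i3 Hl .
  qed
  \<comment> \<open>Here K a a' - P = a' Z + l a Z', while (l a'^2 - a^2) a a' + M = l a Z' - a' Z.
    The difference of the squares is 4 l a a' Z Z', which is where H enters.\<close>
  have r5: "(d\<^sup>2 + 4 * lc * v\<^sup>2) * (v - k)\<^sup>2 - (d * v + z)\<^sup>2 = 2916 * lc * H ^ (l + 1) * v"
  proof -
    have "(d\<^sup>2 + 4 * lc * v\<^sup>2) * (v - k)\<^sup>2 = (K * v - K * k)\<^sup>2 * \<beta>i ^ 2"
      unfolding dv by (simp add: ring)
    hence "(d\<^sup>2 + 4 * lc * v\<^sup>2) * (v - k)\<^sup>2 - (d * v + z)\<^sup>2 = 4 * lc * (Z * Z' * \<beta>i ^ 3) * v"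
      unfolding Kk z unfolding P_def M_def K_def v_def d_def Z_def Z'_def by (simp add: ring)
    thus ?thesis unfolding Hl[symmetric] by simp
  qed
  show ?thesis
    unfolding modular_relations_def m_eq using r1 r2 r3 r4 r5 unfolding lc_def by blast
qed

lemma level3_init:
  "fps_nth v 0 = 1" "fps_nth d 0 = of_nat l - 1" "fps_nth s 0 = 0" "fps_nth z 0 = 1 - of_nat l" "fps_nth k 0 = 1"
proof -
  have n: "of_nat l + 1 \<noteq> (0 :: complex)"
    by (metis of_nat_Suc of_nat_eq_0_iff nat.distinct(1) add.commute)
  show "fps_nth v 0 = 1" "fps_nth d 0 = of_nat l - 1" "fps_nth s 0 = 0" "fps_nth z 0 = 1 - of_nat l"
    by (simp_all add: v_def d_def s_def z_def unit0 \<beta>i0 fps_power_zeroth)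
  show "fps_nth k 0 = 1"
    using n by (simp add: k_def Ki_def K_def unit0 \<beta>i0 fps_power_zeroth add.commute)
qed

lemma v_nth_1: "fps_nth v 1 = 9"
proof -
  have "v * \<beta> = A_fps * A'" using \<beta>i by (simp add: v_def mult.assoc)
  from arg_cong[OF this, of "\<lambda>f. fps_nth f 1"] show ?thesis
    using unit0 level3_init(1) fps_init B_nth_1 sub_nth_1[of A_fps] sub_nth_1[of B_fps]
    unfolding A'_def[symmetric] B'_def[symmetric]
    by (simp add: fps_mult_nth_1 \<beta>_def)
qed

lemma H_eq: "H = fps_X * (E_fps * E') ^ e" and H_factor_0: "fps_nth ((E_fps * E') ^ e) 0 = 1"
  by (simp_all add: H_def fps_power_zeroth unit0)

text \<open>Only the ratio d/v = l a'/a - a/a' matters for the left side up to v^2, so the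
  derivative of \<open>\<beta>i\<close> drops out. Differentiating that ratio produces K times the
  Wronskian of a and a'.\<close>

lemma wronskian: "v * fps_theta d - d * fps_theta v = K * \<beta>i ^ 2 * (A_fps * fps_theta A' - A' * fps_theta A_fps)"
  unfolding v_def d_def K_def fps_theta_mult fps_theta_diff fps_theta_power theta_lc
  by (simp add: algebra_simps power2_eq_square)

end

text \<open>The factor 4 makes the coefficients of all candidate polynomials integral.\<close>
lemma modular_relations_scaled:
  assumes k: "4 * k = k4"
    and 1: "12 * fps_theta v = m * of_nat (l + 1) * (4 * v - k4)"
    and 2: "12 * v * fps_theta d = m * of_nat (l + 1) * (12 * s * v + 8 * d * v - (d * k4 - 4 * z))"
    and 3: "72 * v * fps_theta s = m * of_nat (l + 1) * (- 8 * d * v + (d * k4 - 4 * z))"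
    and 4: "k4 * (d\<^sup>2 + 4 * of_nat l * v\<^sup>2) = 8 * of_nat l * (v ^ 3 + 1 - 729 * H ^ (l + 1)) - 4 * d * z"
    and 5: "(d\<^sup>2 + 4 * of_nat l * v\<^sup>2) * (4 * v - k4)\<^sup>2 - 16 * (d * v + z)\<^sup>2 = 46656 * of_nat l * H ^ (l + 1) * v"
  shows "modular_relations l H m v d s z k"
proof -
  note ring = algebra_simps power2_eq_square
  have c4: "f = g" if "4 * f = 4 * g" for f g :: "complex fps" using that by simp
  have c16: "f = g" if "16 * f = 16 * g" for f g :: "complex fps" using that by simp
  define L where "L = (of_nat l :: complex fps)"
  have L1: "of_nat (l + 1) = L + 1" by (simp add: L_def)
  show ?thesis
    unfolding modular_relations_def L1 L_def[symmetric]
  proof (intro conjI)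
    show "3 * fps_theta v = m * (L + 1) * (v - k)"
      by (rule c4) (use 1 in \<open>simp add: k[symmetric] L_def ring\<close>)
    show "3 * v * fps_theta d = m * (L + 1) * (3 * s * v + 2 * d * v - (d * k - z))"
      by (rule c4) (use 2 in \<open>simp add: k[symmetric] L_def ring\<close>)
    show "18 * v * fps_theta s = m * (L + 1) * (- 2 * d * v + (d * k - z))"
      by (rule c4) (use 3 in \<open>simp add: k[symmetric] L_def ring\<close>)
    show "k * (d\<^sup>2 + 4 * L * v\<^sup>2) = 2 * L * (v ^ 3 + 1 - 729 * H ^ (l + 1)) - d * z"
      by (rule c4) (use 4 in \<open>simp add: k[symmetric] L_def ring\<close>)
    show "(d\<^sup>2 + 4 * L * v\<^sup>2) * (v - k)\<^sup>2 - (d * v + z)\<^sup>2 = 2916 * L * H ^ (l + 1) * v"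
      by (rule c16) (use 5 in \<open>simp add: k[symmetric] L_def ring\<close>)
  qed
qed

context cubic_degree
begin

text \<open>The hypotheses are shaped as identities between polynomials in H. The displayed factors
  of H witness the initial values and the divisibility that uniqueness asks for. The first relation
  ties the constant coefficient of \<open>p\<close> to the linear coefficient 9 of v'; it is 4 *
  27/(l + 1) because k4 = 4 k. The value -27 is the leading coefficient of -a'(a^3 - b^3).\<close>

lemma level3_unique:
  assumes rel: "12 * fps_theta v' = m * of_nat (l + 1) * (4 * v' - k4)"
      "12 * v' * fps_theta d' = m * of_nat (l + 1) * (12 * s' * v' + 8 * d' * v' - (d' * k4 - 4 * z'))"
      "72 * v' * fps_theta s' = m * of_nat (l + 1) * (- 8 * d' * v' + (d' * k4 - 4 * z'))"
      "k4 * (d'\<^sup>2 + 4 * of_nat l * v'\<^sup>2) = 8 * of_nat l * (v' ^ 3 + 1 - 729 * H ^ (l + 1)) - 4 * d' * z'"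
      "(d'\<^sup>2 + 4 * of_nat l * v'\<^sup>2) * (4 * v' - k4)\<^sup>2 - 16 * (d' * v' + z')\<^sup>2 = 46656 * of_nat l * H ^ (l + 1) * v'"
    and init: "v' = 1 + H * v1" "fps_nth v1 0 = 9" "d' = of_nat l - 1 + H * d1" "s' = H * s1" "z' = 1 - of_nat l + H * z1"
    and p: "4 * v' - k4 = H * p" "fps_nth p 0 = 108 / (of_nat l + 1)"
    and g: "d' * v' + z' = H * g" "fps_nth g 0 = - 27"
    and w: "v' * fps_theta d' - d' * fps_theta v' = - 6 * (of_nat (l + 1) * m) * (H * u)"
  shows "A_fps * A' = \<beta> * v'" and "A_fps * fps_theta A' - A' * fps_theta A_fps = - 6 * (H * \<beta> ^ 2 * u)"
proof -
  define h where "h = (E_fps * E') ^ e"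
  have Hh: "H = fps_X * h" and h0: "fps_nth h 0 = 1"
    unfolding h_def by (rule H_eq H_factor_0)+
  have H0: "fps_nth H 0 = 0" by (simp add: Hh)
  define k' where "k' = fps_const (1 / 4) * k4"
  have k: "4 * k' = k4"
    by (simp add: k'_def numeral_fps_const fps_const_mult flip: mult.assoc)
  have k'_eq: "k' = v' - fps_const (1 / 4) * (H * p)"
  proof -
    have "fps_const (1 / 4) * (4 * k') = fps_const (1 / 4) * (4 * v' - H * p)"
      using k p(1) by (simp add: algebra_simps)
    moreover have "fps_const (1 / 4) * (4 * f) = f" for f :: "complex fps"
      by (simp add: numeral_fps_const fps_const_mult flip: mult.assoc)
    ultimately show ?thesis by (simp add: right_diff_distrib)
  qed
  have rel': "modular_relations l H m v' d' s' z' k'"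
    by (rule modular_relations_scaled[OF k rel])
  have init0: "fps_nth v' 0 = 1" "fps_nth d' 0 = of_nat l - 1" "fps_nth s' 0 = 0" "fps_nth z' 0 = 1 - of_nat l"
    by (simp_all add: init H0 fps_of_nat)
  have "fps_nth k' 0 = 1" by (simp add: k'_eq init0 H0)
  note init' = init0 this
  have v1: "fps_nth v' 1 = 9"
    using init(2) by (simp add: init(1) Hh mult.assoc h0)
  have p': "v' - k' = fps_X * (fps_const (1 / 4) * h * p)" "fps_nth (fps_const (1 / 4) * h * p) 0 = 27 / (of_nat l + 1)"
    by (simp_all add: k'_eq Hh h0 p(2) mult_ac)
  have g': "d' * v' + z' = fps_X * (h * g)" "fps_nth (h * g) 0 = - 27"
    by (simp_all add: g Hh h0 mult_ac)
  note uniq = modular_relations_unique[OF modular_relations_level3 rel' l Hh m0 level3_init init' p' g',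
      unfolded v_nth_1 v1, OF refl]
  show "A_fps * A' = \<beta> * v'"
    unfolding uniq(1)[symmetric] v_def using \<beta>i by (simp add: mult_ac)
  define W where "W = A_fps * fps_theta A' - A' * fps_theta A_fps"
  have K: "K = of_nat (l + 1) * m" using m_eq by (simp add: mult.commute)
  have K0: "K \<noteq> 0" using Ki by auto
  have "K * (\<beta>i ^ 2 * W) = K * (- 6 * (H * u))"
    using w wronskian unfolding uniq K[symmetric] W_def by (simp add: mult_ac)
  hence "\<beta>i ^ 2 * W = - 6 * (H * u)" by (rule iffD1[OF mult_left_cancel[OF K0]])
  moreover have "(\<beta>i * \<beta>) ^ 2 * W = \<beta> ^ 2 * (\<beta>i ^ 2 * W)"
    by (simp only: power_mult_distrib ac_simps)
  ultimately have "(\<beta>i * \<beta>) ^ 2 * W = - 6 * (H * \<beta> ^ 2 * u)"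
    by (simp add: mult_ac)
  thus "A_fps * fps_theta A' - A' * fps_theta A_fps = - 6 * (H * \<beta> ^ 2 * u)"
    unfolding \<beta>i W_def by simp
qed

section \<open>From power series to functions on the unit disc\<close>

definition "H_fun q = q * (eta_ratio q * eta_ratio (q ^ l)) ^ e"
definition "\<beta>_fun q = cubic_b q * cubic_b (q ^ l)"

lemma sub_expansion: "f has_fps_expansion F \<Longrightarrow> (\<lambda>q. f (q ^ l)) has_fps_expansion sub F"
  unfolding sub_def using has_fps_expansion_compose[of f F "\<lambda>q. q ^ l" "fps_X ^ l"] Xl0
  by (auto simp: o_def intro!: fps_expansion_intros)

lemma level_expansions:
  "(\<lambda>q. cubic_a (q ^ l)) has_fps_expansion A'"
  "H_fun has_fps_expansion H"
  "\<beta>_fun has_fps_expansion \<beta>"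
proof -
  show "(\<lambda>q. cubic_a (q ^ l)) has_fps_expansion A'"
    unfolding A'_def by (intro sub_expansion expansions)
  have "(\<lambda>q. eta_ratio (q ^ l)) has_fps_expansion E'" "(\<lambda>q. cubic_b (q ^ l)) has_fps_expansion B'"
    unfolding E'_def B'_def by (intro sub_expansion expansions)+
  thus "H_fun has_fps_expansion H" "\<beta>_fun has_fps_expansion \<beta>"
    unfolding H_fun_def[abs_def] H_def \<beta>_fun_def[abs_def] \<beta>_def
    by (auto intro!: fps_expansion_intros)
qed

lemma level_holomorphic:
  "(\<lambda>q. cubic_a (q ^ l)) holomorphic_on ball 0 1" "H_fun holomorphic_on ball 0 1" "\<beta>_fun holomorphic_on ball 0 1"
  unfolding H_fun_def[abs_def] \<beta>_fun_def[abs_def] using l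
  by (auto intro!: holomorphic_intros holomorphic_compose_power holomorphic_cubic_a holomorphic_cubic_b holomorphic_eta_ratio)

lemma \<beta>_fun_nz: "norm q < 1 \<Longrightarrow> \<beta>_fun q \<noteq> 0"
  using l cubic_b_nz[of q] cubic_b_nz[of "q ^ l"] power_in_unit_ball[of q l] by (simp add: \<beta>_fun_def)

text \<open>Both sides are holomorphic on the whole unit disc, so equality of their expansions at 0
  extends by analytic continuation; in particular no smallness of H is involved.\<close>

lemma transfer:
  assumes v: "A_fps * A' = \<beta> * v'" and w: "A_fps * fps_theta A' - A' * fps_theta A_fps = - 6 * (H * \<beta> ^ 2 * u)"
    and V: "(\<lambda>q. V_fun (H_fun q)) has_fps_expansion v'" "V_fun holomorphic_on UNIV"
    and U: "(\<lambda>q. U_fun (H_fun q)) has_fps_expansion u" "U_fun holomorphic_on UNIV"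
    and q: "norm q < 1"
  shows "cubic_a q * cubic_a (q ^ l) = \<beta>_fun q * V_fun (H_fun q)"
    and "cubic_a q * (q * deriv (\<lambda>z. cubic_a (z ^ l)) q) - cubic_a (q ^ l) * (q * deriv cubic_a q)
      = - 6 * (H_fun q * \<beta>_fun q ^ 2 * U_fun (H_fun q))"
proof -
  have comp: "(\<lambda>q. f (H_fun q)) holomorphic_on ball 0 1" if "f holomorphic_on UNIV" for f
    using holomorphic_on_compose_gen[OF level_holomorphic(2) that] by (simp add: o_def)
  have "cubic_a q * cubic_a (q ^ l) - \<beta>_fun q * V_fun (H_fun q) = 0"
  proof (rule has_fps_expansion_0_analytic_continuation[of "\<lambda>q. cubic_a q * cubic_a (q ^ l) - \<beta>_fun q * V_fun (H_fun q)" "ball 0 1"])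
    have "(\<lambda>q. cubic_a q * cubic_a (q ^ l) - \<beta>_fun q * V_fun (H_fun q)) has_fps_expansion (A_fps * A' - \<beta> * v')"
      by (intro fps_expansion_intros level_expansions V)
    thus "(\<lambda>q. cubic_a q * cubic_a (q ^ l) - \<beta>_fun q * V_fun (H_fun q)) has_fps_expansion 0"
      using v by simp
    show "(\<lambda>q. cubic_a q * cubic_a (q ^ l) - \<beta>_fun q * V_fun (H_fun q)) holomorphic_on ball 0 1"
      by (intro holomorphic_intros level_holomorphic holomorphic_cubic_a comp V)
  qed (use q in auto)
  thus "cubic_a q * cubic_a (q ^ l) = \<beta>_fun q * V_fun (H_fun q)" by simp
  define w_fun where "w_fun = (\<lambda>q. (cubic_a q * (q * deriv (\<lambda>z. cubic_a (z ^ l)) q) - cubic_a (q ^ l) * (q * deriv cubic_a q))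
      - (- 6 * (H_fun q * \<beta>_fun q ^ 2 * U_fun (H_fun q))))"
  have "w_fun q = 0"
  proof (rule has_fps_expansion_0_analytic_continuation[of w_fun "ball 0 1"])
    have "w_fun has_fps_expansion ((A_fps * fps_theta A' - A' * fps_theta A_fps) - (- 6 * (H * \<beta> ^ 2 * u)))"
      unfolding w_fun_def by (intro fps_expansion_intros level_expansions U)
    thus "w_fun has_fps_expansion 0" using w by simp
    show "w_fun holomorphic_on ball 0 1"
      unfolding w_fun_def
      by (intro holomorphic_intros holomorphic_deriv open_ball level_holomorphic holomorphic_cubic_a comp U)
  qed (use q in auto)
  thus "cubic_a q * (q * deriv (\<lambda>z. cubic_a (z ^ l)) q) - cubic_a (q ^ l) * (q * deriv cubic_a q)
      = - 6 * (H_fun q * \<beta>_fun q ^ 2 * U_fun (H_fun q))" by (simp only: w_fun_def right_minus_eq)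
qed

text \<open>The fractional powers of q removed from the two eta quotients have total exponent e (l +
  1)/12 = 1, and the factor q in \<open>H_fun\<close> restores exactly that.\<close>

lemma H_dagger_eq: 
  assumes \<tau>: "Im \<tau> > 0"
  shows "H_dagger l \<tau> = H_fun (nome \<tau>)"
proof -
  let ?x = "\<lambda>\<tau>. exp (- (of_real pi * \<i> / 6) * \<tau>)"
  have e: "12 div (l + 1) = e" using le by (metis div_mult_self1_is_m add_gr_0 zero_less_one)
  have nl: "nome \<tau> ^ l = nome (of_nat l * \<tau>)"
    by (simp add: algebra_simps flip: exp_of_nat_mult)
  have x: "(?x \<tau> * ?x (of_nat l * \<tau>)) ^ e * nome \<tau> = 1"
  proof -
    have "of_nat e * (- (of_real pi * \<i> / 6) * \<tau> + - (of_real pi * \<i> / 6) * (of_nat l * \<tau>)) =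
        - (of_real pi * \<i> / 6) * \<tau> * of_nat ((l + 1) * e)"
      by (simp add: algebra_simps)
    also have "\<dots> = - (2 * of_real pi * \<i> * \<tau>)" unfolding le by simp
    finally show ?thesis
      by (simp only: exp_add[symmetric] exp_of_nat_mult[symmetric]) simp
  qed
  have "H_fun (nome \<tau>) = (dedekind_eta (3 * \<tau>) / dedekind_eta \<tau> * (dedekind_eta (3 * (of_nat l * \<tau>)) / dedekind_eta (of_nat l * \<tau>))) ^ e
      * ((?x \<tau> * ?x (of_nat l * \<tau>)) ^ e * nome \<tau>)"
    unfolding H_fun_def nl eta_ratio_nome by (simp only: power_mult_distrib ac_simps)
  also have "\<dots> = H_dagger l \<tau>"
    unfolding x H_dagger_def e by (simp add: mult.assoc)
  finally show ?thesis ..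
qed

text \<open>The determinant is the Wronskian a D a' - a' D a, divided by (a a')^2 = (\<beta> V)^2,
  so \<open>\<beta>_fun\<close> cancels. Since a a' does not vanish where C is defined, neither does
  the polynomial V.\<close>

lemma C_eq:
  assumes \<tau>: "Im \<tau> > 0" and def: "C_defined l (nome \<tau>)"
    and v: "A_fps * A' = \<beta> * v'" and w: "A_fps * fps_theta A' - A' * fps_theta A_fps = - 6 * (H * \<beta> ^ 2 * u)"
    and V: "(\<lambda>q. V_fun (H_fun q)) has_fps_expansion v'" "V_fun holomorphic_on UNIV"
    and U: "(\<lambda>q. U_fun (H_fun q)) has_fps_expansion u" "U_fun holomorphic_on UNIV"
  defines "x \<equiv> H_dagger l \<tau>"
  shows "V_fun x \<noteq> 0 \<and> C l (nome \<tau>) = - 6 * (x * U_fun x / (V_fun x)\<^sup>2)"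
proof -
  define q where "q = nome \<tau>"
  have q: "norm q < 1" using \<tau> by (simp add: q_def)
  have x: "H_fun q = x" unfolding x_def H_dagger_eq[OF \<tau>] q_def ..
  note T = transfer[OF v w V U q, unfolded x]
  have "cubic_a q \<noteq> 0" "cubic_a (q ^ l) \<noteq> 0" using def by (auto simp: C_defined_def q_def)
  hence nz: "V_fun x \<noteq> 0" using T(1) by auto
  have \<beta>: "\<beta>_fun q \<noteq> 0" by (rule \<beta>_fun_nz[OF q])
  have "C l q = 1 / (cubic_a q * cubic_a (q ^ l))\<^sup>2 *
     (cubic_a q * (q * deriv (\<lambda>z. cubic_a (z ^ l)) q) - cubic_a (q ^ l) * (q * deriv cubic_a q))"
    unfolding C_def by (simp add: det_2 power_mult_distrib)
  also have "\<dots> = - 6 * (x * U_fun x / (V_fun x)\<^sup>2)"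
    unfolding T using \<beta> nz by (simp add: field_simps power2_eq_square)
  finally show ?thesis using nz by (simp add: q_def)
qed

lemma theta_H_poly: "fps_theta (numeral c) = 0" "fps_theta (of_nat n) = 0" "fps_theta 1 = 0" "fps_theta (H ^ n) = of_nat n * H ^ n * m"
proof -
  show "fps_theta (H ^ n) = of_nat n * H ^ n * m"
    by (cases n) (simp_all only: fps_theta_power theta_H, simp_all)
qed simp_all

end

text \<open>
  In each degree the Wronskian condition \<open>init7\<close> determines \<open>d'\<close> from the polynomials in the claim; the relations
  then determine \<open>k4\<close>, \<open>z'\<close> and \<open>s'\<close>, in this order.
\<close>
lemma degree_2:
  assumes \<tau>: "Im \<tau> > 0" and def: "C_defined 2 (nome \<tau>)"
  defines "x \<equiv> H_dagger 2 \<tau>"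
  shows "1 + 9 * x \<noteq> 0 \<and>
    C 2 (nome \<tau>) = - 6 * (x * (1) / (1 + 9 * x)\<^sup>2)"
proof -
  interpret cubic_degree 2 4 by unfold_locales auto
  define t where "t = H"
  have t0: "fps_nth t 0 = 0" unfolding t_def H_def by simp
  note th = fps_theta_add fps_theta_diff fps_theta_mult theta_H_poly[folded t_def] theta_H[folded t_def]
  define v' where "v' = 1 + 9 * t"
  define d' where "d' = 1 - 9 * t"
  define s' where "s' = 3 * t"
  define z' where "z' = - 1 - 27 * t"
  \<comment> \<open>The first relation reads 4 k = 4 v - 12/(l + 1) t dv/dt, here 4 v - 4 t
    dv/dt.\<close>
  define k4 :: "complex fps" where "k4 = 4"
  note defs = v'_def d'_def s'_def z'_def k4_def
  \<comment> \<open>D acts on polynomials in t as m t d/dt. The relations therefore become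
    polynomial identities in t and m, with m treated as an indeterminate.\<close>
  have theta: "fps_theta v' = (9 * t) * m" "fps_theta d' = (- 9 * t) * m" "fps_theta s' = (3 * t) * m"
    unfolding defs th by (simp_all add: algebra_simps)
  have l1: "of_nat (2 + 1) = (3 :: complex fps)" "of_nat 2 = (2 :: complex fps)" "t ^ (2 + 1) = t ^ 3" by simp_all
  have rel1: "12 * fps_theta v' = m * of_nat (2 + 1) * (4 * v' - k4)"
    unfolding theta l1 unfolding defs by algebra
  have rel2: "12 * v' * fps_theta d' = m * of_nat (2 + 1) * (12 * s' * v' + 8 * d' * v' - (d' * k4 - 4 * z'))"
    unfolding theta l1 unfolding defs by algebra
  have rel3: "72 * v' * fps_theta s' = m * of_nat (2 + 1) * (- 8 * d' * v' + (d' * k4 - 4 * z'))"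
    unfolding theta l1 unfolding defs by algebra
  have rel4: "k4 * (d'\<^sup>2 + 4 * of_nat 2 * v'\<^sup>2) = 8 * of_nat 2 * (v' ^ 3 + 1 - 729 * t ^ (2 + 1)) - 4 * d' * z'"
    unfolding theta l1 unfolding defs by algebra
  have rel5: "(d'\<^sup>2 + 4 * of_nat 2 * v'\<^sup>2) * (4 * v' - k4)\<^sup>2 - 16 * (d' * v' + z')\<^sup>2 = 46656 * of_nat 2 * t ^ (2 + 1) * v'"
    unfolding theta l1 unfolding defs by algebra
  have init1: "v' = 1 + t * (9)"
    unfolding theta l1 unfolding defs by algebra
  have init2: "d' = of_nat 2 - 1 + t * (- 9)"
    unfolding theta l1 unfolding defs by algebra
  have init3: "s' = t * (3)"
    unfolding theta l1 unfolding defs by algebra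
  have init4: "z' = 1 - of_nat 2 + t * (- 27)"
    unfolding theta l1 unfolding defs by algebra
  have init5: "4 * v' - k4 = t * (36)"
    unfolding theta l1 unfolding defs by algebra
  have init6: "d' * v' + z' = t * (- 27 - 81 * t)"
    unfolding theta l1 unfolding defs by algebra
  have init7: "v' * fps_theta d' - d' * fps_theta v' = - 6 * (of_nat (2 + 1) * m) * (t * (1))"
    unfolding theta l1 unfolding defs by algebra
  have nth: "fps_nth (9 :: complex fps) 0 = 9" "fps_nth (36 :: complex fps) 0 = 108 / (of_nat 2 + 1)" "fps_nth (- 27 - 81 * t :: complex fps) 0 = - 27"
    by (simp_all add: t0 fps_power_zeroth fps_numeral_nth)
  note L = level3_unique[folded t_def, OF rel1 rel2 rel3 rel4 rel5 init1 nth(1) init2 init3 init4 init5 nth(2) init6 nth(3) init7]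
  have exp_t: "H_fun has_fps_expansion t" unfolding t_def by (rule level_expansions)
  show ?thesis
    unfolding x_def
  proof (rule C_eq[OF \<tau> def L[unfolded t_def v'_def]])
    show "(\<lambda>q. 1 + 9 * H_fun q) has_fps_expansion 1 + 9 * H"
      "(\<lambda>q. 1) has_fps_expansion 1"
      using exp_t unfolding t_def by (auto intro!: fps_expansion_intros)
  qed (auto intro!: holomorphic_intros)
qed

lemma degree_5:
  assumes \<tau>: "Im \<tau> > 0" and def: "C_defined 5 (nome \<tau>)"
  defines "x \<equiv> H_dagger 5 \<tau>"
  shows "1 + 9 * x + 9 * x ^ 2 \<noteq> 0 \<and>
    C 5 (nome \<tau>) = - 6 * (x * (1 + 4 * x + 9 * x ^ 2) / (1 + 9 * x + 9 * x ^ 2)\<^sup>2)"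
proof -
  interpret cubic_degree 5 2 by unfold_locales auto
  define t where "t = H"
  have t0: "fps_nth t 0 = 0" unfolding t_def H_def by simp
  note th = fps_theta_add fps_theta_diff fps_theta_mult theta_H_poly[folded t_def] theta_H[folded t_def]
  define v' where "v' = 1 + 9 * t + 9 * t ^ 2"
  define d' where "d' = 4 - 36 * t ^ 2"
  define s' where "s' = 3 * t + 12 * t ^ 2"
  define z' where "z' = - 4 - 63 * t - 189 * t ^ 2 - 243 * t ^ 3"
  \<comment> \<open>Again from the first relation: 4 v - 2 t dv/dt, where the quadratic terms
    cancel.\<close>
  define k4 :: "complex fps" where "k4 = 4 + 18 * t"
  note defs = v'_def d'_def s'_def z'_def k4_def
  have theta: "fps_theta v' = (9 * t + 18 * t ^ 2) * m" "fps_theta d' = (- 72 * t ^ 2) * m" "fps_theta s' = (3 * t + 24 * t ^ 2) * m"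
    unfolding defs th by (simp_all add: algebra_simps)
  have l1: "of_nat (5 + 1) = (6 :: complex fps)" "of_nat 5 = (5 :: complex fps)" "t ^ (5 + 1) = t ^ 6" by simp_all
  have rel1: "12 * fps_theta v' = m * of_nat (5 + 1) * (4 * v' - k4)"
    unfolding theta l1 unfolding defs by algebra
  have rel2: "12 * v' * fps_theta d' = m * of_nat (5 + 1) * (12 * s' * v' + 8 * d' * v' - (d' * k4 - 4 * z'))"
    unfolding theta l1 unfolding defs by algebra
  have rel3: "72 * v' * fps_theta s' = m * of_nat (5 + 1) * (- 8 * d' * v' + (d' * k4 - 4 * z'))"
    unfolding theta l1 unfolding defs by algebra
  have rel4: "k4 * (d'\<^sup>2 + 4 * of_nat 5 * v'\<^sup>2) = 8 * of_nat 5 * (v' ^ 3 + 1 - 729 * t ^ (5 + 1)) - 4 * d' * z'"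
    unfolding theta l1 unfolding defs by algebra
  have rel5: "(d'\<^sup>2 + 4 * of_nat 5 * v'\<^sup>2) * (4 * v' - k4)\<^sup>2 - 16 * (d' * v' + z')\<^sup>2 = 46656 * of_nat 5 * t ^ (5 + 1) * v'"
    unfolding theta l1 unfolding defs by algebra
  have init1: "v' = 1 + t * (9 + 9 * t)"
    unfolding theta l1 unfolding defs by algebra
  have init2: "d' = of_nat 5 - 1 + t * (- 36 * t)"
    unfolding theta l1 unfolding defs by algebra
  have init3: "s' = t * (3 + 12 * t)"
    unfolding theta l1 unfolding defs by algebra
  have init4: "z' = 1 - of_nat 5 + t * (- 63 - 189 * t - 243 * t ^ 2)"
    unfolding theta l1 unfolding defs by algebra
  have init5: "4 * v' - k4 = t * (18 + 36 * t)"
    unfolding theta l1 unfolding defs by algebra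
  have init6: "d' * v' + z' = t * (- 27 - 189 * t - 567 * t ^ 2 - 324 * t ^ 3)"
    unfolding theta l1 unfolding defs by algebra
  have init7: "v' * fps_theta d' - d' * fps_theta v' = - 6 * (of_nat (5 + 1) * m) * (t * (1 + 4 * t + 9 * t ^ 2))"
    unfolding theta l1 unfolding defs by algebra
  have nth: "fps_nth (9 + 9 * t :: complex fps) 0 = 9" "fps_nth (18 + 36 * t :: complex fps) 0 = 108 / (of_nat 5 + 1)" "fps_nth (- 27 - 189 * t - 567 * t ^ 2 - 324 * t ^ 3 :: complex fps) 0 = - 27"
    by (simp_all add: t0 fps_power_zeroth fps_numeral_nth)
  note L = level3_unique[folded t_def, OF rel1 rel2 rel3 rel4 rel5 init1 nth(1) init2 init3 init4 init5 nth(2) init6 nth(3) init7]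
  have exp_t: "H_fun has_fps_expansion t" unfolding t_def by (rule level_expansions)
  show ?thesis
    unfolding x_def
  proof (rule C_eq[OF \<tau> def L[unfolded t_def v'_def]])
    show "(\<lambda>q. 1 + 9 * H_fun q + 9 * H_fun q ^ 2) has_fps_expansion 1 + 9 * H + 9 * H ^ 2"
      "(\<lambda>q. 1 + 4 * H_fun q + 9 * H_fun q ^ 2) has_fps_expansion 1 + 4 * H + 9 * H ^ 2"
      using exp_t unfolding t_def by (auto intro!: fps_expansion_intros)
  qed (auto intro!: holomorphic_intros)
qed

lemma degree_11:
  assumes \<tau>: "Im \<tau> > 0" and def: "C_defined 11 (nome \<tau>)"
  defines "x \<equiv> H_dagger 11 \<tau>"
  shows "1 + 9 * x + 18 * x ^ 2 + 27 * x ^ 3 + 9 * x ^ 4 \<noteq> 0 \<and>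
    C 11 (nome \<tau>) = - 6 * (x * (1 + 5 * x + 18 * x ^ 2 + 37 * x ^ 3 + 54 * x ^ 4 + 45 * x ^ 5 + 27 * x ^ 6) / (1 + 9 * x + 18 * x ^ 2 + 27 * x ^ 3 + 9 * x ^ 4)\<^sup>2)"
proof -
  interpret cubic_degree 11 1 by unfold_locales auto
  define t where "t = H"
  have t0: "fps_nth t 0 = 0" unfolding t_def H_def by simp
  note th = fps_theta_add fps_theta_diff fps_theta_mult theta_H_poly[folded t_def] theta_H[folded t_def]
  define v' where "v' = 1 + 9 * t + 18 * t ^ 2 + 27 * t ^ 3 + 9 * t ^ 4"
  define d' where "d' = 10 + 18 * t - 54 * t ^ 3 - 90 * t ^ 4"
  define s' where "s' = 3 * t + 15 * t ^ 2 + 27 * t ^ 3 + 30 * t ^ 4"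
  define z' where "z' = - 10 - 135 * t - 558 * t ^ 2 - 1512 * t ^ 3 - 2538 * t ^ 4 - 2916 * t ^ 5 - 1944 * t ^ 6 - 729 * t ^ 7"
  \<comment> \<open>For l = 11 this is 4 v - t dv/dt, which loses the term of degree 4.\<close>
  define k4 :: "complex fps" where "k4 = 4 + 27 * t + 36 * t ^ 2 + 27 * t ^ 3"
  note defs = v'_def d'_def s'_def z'_def k4_def
  have theta: "fps_theta v' = (9 * t + 36 * t ^ 2 + 81 * t ^ 3 + 36 * t ^ 4) * m" "fps_theta d' = (18 * t - 162 * t ^ 3 - 360 * t ^ 4) * m" "fps_theta s' = (3 * t + 30 * t ^ 2 + 81 * t ^ 3 + 120 * t ^ 4) * m"
    unfolding defs th by (simp_all add: algebra_simps)
  have l1: "of_nat (11 + 1) = (12 :: complex fps)" "of_nat 11 = (11 :: complex fps)" "t ^ (11 + 1) = t ^ 12" by simp_all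
  have rel1: "12 * fps_theta v' = m * of_nat (11 + 1) * (4 * v' - k4)"
    unfolding theta l1 unfolding defs by algebra
  have rel2: "12 * v' * fps_theta d' = m * of_nat (11 + 1) * (12 * s' * v' + 8 * d' * v' - (d' * k4 - 4 * z'))"
    unfolding theta l1 unfolding defs by algebra
  have rel3: "72 * v' * fps_theta s' = m * of_nat (11 + 1) * (- 8 * d' * v' + (d' * k4 - 4 * z'))"
    unfolding theta l1 unfolding defs by algebra
  have rel4: "k4 * (d'\<^sup>2 + 4 * of_nat 11 * v'\<^sup>2) = 8 * of_nat 11 * (v' ^ 3 + 1 - 729 * t ^ (11 + 1)) - 4 * d' * z'"
    unfolding theta l1 unfolding defs by algebra
  have rel5: "(d'\<^sup>2 + 4 * of_nat 11 * v'\<^sup>2) * (4 * v' - k4)\<^sup>2 - 16 * (d' * v' + z')\<^sup>2 = 46656 * of_nat 11 * t ^ (11 + 1) * v'"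
    unfolding theta l1 unfolding defs by algebra
  have init1: "v' = 1 + t * (9 + 18 * t + 27 * t ^ 2 + 9 * t ^ 3)"
    unfolding theta l1 unfolding defs by algebra
  have init2: "d' = of_nat 11 - 1 + t * (18 - 54 * t ^ 2 - 90 * t ^ 3)"
    unfolding theta l1 unfolding defs by algebra
  have init3: "s' = t * (3 + 15 * t + 27 * t ^ 2 + 30 * t ^ 3)"
    unfolding theta l1 unfolding defs by algebra
  have init4: "z' = 1 - of_nat 11 + t * (- 135 - 558 * t - 1512 * t ^ 2 - 2538 * t ^ 3 - 2916 * t ^ 4 - 1944 * t ^ 5 - 729 * t ^ 6)"
    unfolding theta l1 unfolding defs by algebra
  have init5: "4 * v' - k4 = t * (9 + 36 * t + 81 * t ^ 2 + 36 * t ^ 3)"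
    unfolding theta l1 unfolding defs by algebra
  have init6: "d' * v' + z' = t * (- 27 - 216 * t - 972 * t ^ 2 - 2538 * t ^ 3 - 4536 * t ^ 4 - 5022 * t ^ 5 - 3645 * t ^ 6 - 810 * t ^ 7)"
    unfolding theta l1 unfolding defs by algebra
  have init7: "v' * fps_theta d' - d' * fps_theta v' = - 6 * (of_nat (11 + 1) * m) * (t * (1 + 5 * t + 18 * t ^ 2 + 37 * t ^ 3 + 54 * t ^ 4 + 45 * t ^ 5 + 27 * t ^ 6))"
    unfolding theta l1 unfolding defs by algebra
  have nth: "fps_nth (9 + 18 * t + 27 * t ^ 2 + 9 * t ^ 3 :: complex fps) 0 = 9" "fps_nth (9 + 36 * t + 81 * t ^ 2 + 36 * t ^ 3 :: complex fps) 0 = 108 / (of_nat 11 + 1)" "fps_nth (- 27 - 216 * t - 972 * t ^ 2 - 2538 * t ^ 3 - 4536 * t ^ 4 - 5022 * t ^ 5 - 3645 * t ^ 6 - 810 * t ^ 7 :: complex fps) 0 = - 27"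
    by (simp_all add: t0 fps_power_zeroth fps_numeral_nth)
  note L = level3_unique[folded t_def, OF rel1 rel2 rel3 rel4 rel5 init1 nth(1) init2 init3 init4 init5 nth(2) init6 nth(3) init7]
  have exp_t: "H_fun has_fps_expansion t" unfolding t_def by (rule level_expansions)
  show ?thesis
    unfolding x_def
  proof (rule C_eq[OF \<tau> def L[unfolded t_def v'_def]])
    show "(\<lambda>q. 1 + 9 * H_fun q + 18 * H_fun q ^ 2 + 27 * H_fun q ^ 3 + 9 * H_fun q ^ 4) has_fps_expansion 1 + 9 * H + 18 * H ^ 2 + 27 * H ^ 3 + 9 * H ^ 4"
      "(\<lambda>q. 1 + 5 * H_fun q + 18 * H_fun q ^ 2 + 37 * H_fun q ^ 3 + 54 * H_fun q ^ 4 + 45 * H_fun q ^ 5 + 27 * H_fun q ^ 6) has_fps_expansion 1 + 5 * H + 18 * H ^ 2 + 37 * H ^ 3 + 54 * H ^ 4 + 45 * H ^ 5 + 27 * H ^ 6"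
      using exp_t unfolding t_def by (auto intro!: fps_expansion_intros)
  qed (auto intro!: holomorphic_intros)
qed

theorem theorem5p3:
  fixes \<tau> q :: complex
  assumes "Im \<tau> > 0"
    and "q = exp (of_real pi * \<i> * \<tau>)"
  shows
    "(C_defined 2 (q\<^sup>2) \<longrightarrow>
        1 + 9 * H_dagger 2 \<tau> \<noteq> 0 \<and>
        C 2 (q\<^sup>2) = - 6 * (H_dagger 2 \<tau> / (1 + 9 * H_dagger 2 \<tau>)\<^sup>2)) \<and>
     (C_defined 5 (q\<^sup>2) \<longrightarrow>
        1 + 9 * H_dagger 5 \<tau> + 9 * (H_dagger 5 \<tau>)\<^sup>2 \<noteq> 0 \<and>
        C 5 (q\<^sup>2) = - 6 * H_dagger 5 \<tau> *
          ((1 + 4 * H_dagger 5 \<tau> + 9 * (H_dagger 5 \<tau>)\<^sup>2) /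
           (1 + 9 * H_dagger 5 \<tau> + 9 * (H_dagger 5 \<tau>)\<^sup>2)\<^sup>2)) \<and>
     (C_defined 11 (q\<^sup>2) \<longrightarrow>
        V (H_dagger 11 \<tau>) \<noteq> 0 \<and>
        C 11 (q\<^sup>2) = - 6 * H_dagger 11 \<tau> * (U (H_dagger 11 \<tau>) / (V (H_dagger 11 \<tau>))\<^sup>2))"
proof -
  \<comment> \<open>The q of the claim is exp(\<pi> i \<tau>), a square root of the variable used in
    the expansions.\<close>
  have q: "q\<^sup>2 = nome \<tau>"
    unfolding assms(2) by (simp add: mult.assoc flip: exp_double)
  show ?thesis
    unfolding q U_def V_def using degree_2[of \<tau>] degree_5[of \<tau>] degree_11[of \<tau>] assms(1) by simp
qed

end
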